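(* Let $r\geq 2$, $m\geq 0$, and let $G$ be a connected graph with vertex set $V_G=[r+m]$ such that the subgraph induced by $G$ on $[r]$ is connected and the endpoints $r+1,\dots,r+m$ are pairwise non-adjacent in $G$. If $m=0$, assume that $\mu$ is a finite diffuse measure on $\mathbb{R}^d$ and that $\varphi:\mathbb{R}^d\times\mathbb{R}^d\to[0,1]$ is symmetric and measurable. If $m\geq 1$, assume that $\mu$ is a diffuse sigma-finite measure on $\mathbb{R}^d$ and that $\varphi:\mathbb{R}^d\times\mathbb{R}^d\to[0,1]$ is symmetric and measurable with $\sup_{x\in\mathbb{R}^d}\int_{\mathbb{R}^d}\varphi(x,y)\,\mu(\mathrm{d}y)<\infty$. Let $n\geq2$ and suppose that the upper boundary $\widehat{\Sigma}_n(G,m)$ is a line segment linking $(n-1,(n-1)a_m(G))$ to $((n-1)r,(n-1)e(G))$. Then, as $\lambda\to\infty$: (a) if $1\gtrsim c_\lambda\gtrsim\lambda^{-(r-1)/(e(G)-a_m(G))}$, we have $\kappa_n(N_G)\asymp\lambda^{1+(r-1)n}c_\lambda^{ne(G)-(n-1)a_m(G)}$; (b) if $c_\lambda\asymp\lambda^{-(r-1)/(e(G)-a_m(G))}$, we have $\kappa_n(N_G)\asymp\lambda c_\lambda^{a_m(G)}$; (c) if $c_\lambda\lesssim\lambda^{-(r-1)/(e(G)-a_m(G))}$, we have $\kappa_n(N_G)\asymp\lambda^rc_\lambda^{e(G)}$.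
   Context: Notation: $[n]:=\{1,\dots,n\}$; for a graph $H$, $v(H)$ and $e(H)$ are its numbers of vertices and edges, and $E_H$ its edge set. For functions $f(\lambda)$ and $g(\lambda)>0$, as $\lambda\to\infty$: $f\lesssim g$ means $\limsup f/g<\infty$; $f\gtrsim g$ means $\liminf f/g>0$; $f\asymp g$ means both. For $G$ with $V_G=[r+m]$, vertices $r+1,\dots,r+m$ are called endpoints, and $a_m(G):=\max_{i\in[r]}|\{j\in\{r+1,\dots,r+m\}:\{i,j\}\in E_G\}|$ (so $a_0(G)=0$). Partitions: let $\pi=\{\pi_1,\dots,\pi_n\}$ be the partition of $[n]\times[r]$ with $\pi_i=\{(i,j):1\leq j\leq r\}$. A set partition $\rho$ of $[n]\times[r]$ is non-flat if $\rho\wedge\pi$ is the partition into singletons (each block of $\rho$ meets each $\pi_i$ in at most one point), and connected if $\rho\vee\pi$ is the one-block partition. $\mathrm{CNF}(n,r)$ is the set of connected non-flat partitions of $[n]\times[r]$. Graph $\rho_G$: for $\rho\in\mathrm{CNF}(n,r)$, $\rho_G$ is the simple graph whose vertices are the blocks of $\rho$ together with $m$ terminal nodes $1,\dots,m$ (so $v(\rho_G)=|\rho|+m$); two distinct blocks $b,b'$ are adjacent iff there are $i\in[n]$ and $(i,j_1)\in b$, $(i,j_2)\in b'$ with $\{j_1,j_2\}\in E_G$; a block $b$ and terminal node $k$ are adjacent iff there is $(i,j)\in b$ with $\{r+k,j\}\in E_G$; terminal nodes are not adjacent to each other. Upper boundary: for $n\geq2$, $\Sigma_n(G,m):=\{(nr+m-v(\rho_G),\,ne(G)-e(\rho_G)):\rho\in\mathrm{CNF}(n,r)\}\subset\mathbb{R}^2$,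 and $\widehat{\Sigma}_n(G,m)$ is the upper boundary of the convex hull of $\Sigma_n(G,m)$ (the graph of the upper concave envelope, over $[n-1,(n-1)r]$). Random-connection model: let $d\ge1$, let $y_1,\dots,y_m\in\mathbb{R}^d$ be fixed distinct points, let $\lambda>0$, let $\mu$ be a diffuse sigma-finite measure on $\mathbb{R}^d$, and under the probability $\mathbb{P}_\lambda$ let $\eta=\sum_{i=1}^\tau\delta_{X_i}$ be a Poisson point process on $\mathbb{R}^d$ with intensity measure $\lambda\cdot\mu$ ($\tau$ is $\mathbb{N}\cup\{\infty\}$-valued). Given $\varphi$ symmetric measurable with values in $[0,1]$ and $c_\lambda\in(0,1)$, set $\varphi_\lambda:=c_\lambda\varphi$. The random graph $G_\varphi(\eta\cup\{y_1,\dots,y_m\})$ has vertex set $\eta\cup\{y_1,\dots,y_m\}$, any two distinct vertices $x,y$ being independently connected by an edge (written $x\leftrightarrow y$) with probability $\varphi_\lambda(x,y)$. Subgraph count: $N_G$ is the number of (labelled) copies of $G$ in this random graph in which endpoint $r+l$ is mapped to $y_l$, $l=1,\dots,m$, that is $$N_G=\sum_{(\alpha_1,\dots,\alpha_r)}\ \prod_{\{i,j\}\in E_G,\ i,j\in[r]}\mathbf{1}_{\{X_{\alpha_i}\leftrightarrow X_{\alpha_j}\}}\prod_{\{r+j,i\}\in E_G,\ i\in[r],\,j\in[m]}\mathbf{1}_{\{y_j\leftrightarrow X_{\alpha_i}\}},$$ the sum being over $r$-tuples of pairwise distinct indices $\alpha_1,\dots,\alpha_r\in\{1,\dots,\tau\}$.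 $\kappa_n(X)$ denotes the cumulant of order $n$ of $X$ under $\mathbb{P}_\lambda$.
   Formalization: The formal theorem also assumes that the integral over μ^r of the product of φ over the edges of G (endpoints fixed at y_1,…,y_m) is nonzero; otherwise, e.g. for φ=0, N_G=0 almost surely, all cumulants vanish and the claimed orders fail. *)

theory Defs
  imports "HOL-Probability.Probability"
begin

section \<open>Asymptotic comparison as the parameter tends to infinity\<close>

definition asymp_lesssim :: "(real \<Rightarrow> real) \<Rightarrow> (real \<Rightarrow> real) \<Rightarrow> bool" (infix "\<lesssim>\<^sub>\<infinity>" 50) where
  "f \<lesssim>\<^sub>\<infinity> g \<longleftrightarrow> Limsup at_top (\<lambda>t. ereal (f t / g t)) < \<infinity>"

definition asymp_gtrsim :: "(real \<Rightarrow> real) \<Rightarrow> (real \<Rightarrow> real) \<Rightarrow> bool" (infix "\<greatersim>\<^sub>\<infinity>" 50) where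
  "f \<greatersim>\<^sub>\<infinity> g \<longleftrightarrow> Liminf at_top (\<lambda>t. ereal (f t / g t)) > 0"

definition asymp_same_order :: "(real \<Rightarrow> real) \<Rightarrow> (real \<Rightarrow> real) \<Rightarrow> bool" (infix "\<asymp>\<^sub>\<infinity>" 50) where
  "f \<asymp>\<^sub>\<infinity> g \<longleftrightarrow> f \<lesssim>\<^sub>\<infinity> g \<and> f \<greatersim>\<^sub>\<infinity> g"


section \<open>Graphs\<close>

text \<open>A graph is given by its vertex set and its set of edges, each edge being a set of two vertices.\<close>

definition simple_graph :: "'v set \<Rightarrow> 'v set set \<Rightarrow> bool" where
  "simple_graph V E \<longleftrightarrow> finite V \<and> (\<forall>e\<in>E. e \<subseteq> V \<and> card e = 2)"

definition connected_graph :: "'v set \<Rightarrow> 'v set set \<Rightarrow> bool" where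
  "connected_graph V E \<longleftrightarrow> V \<noteq> {} \<and> (\<forall>u\<in>V. \<forall>v\<in>V. (u, v) \<in> {(x, y). {x, y} \<in> E}\<^sup>*)"

definition induced_edges :: "'v set \<Rightarrow> 'v set set \<Rightarrow> 'v set set" where
  "induced_edges U E = {e \<in> E. e \<subseteq> U}"

definition max_endpoint_degree :: "nat \<Rightarrow> nat \<Rightarrow> nat set set \<Rightarrow> nat" where
  "max_endpoint_degree r m E = Max ((\<lambda>i. card {j \<in> {r+1..r+m}. {i, j} \<in> E}) ` {1..r})"


section \<open>Connected non-flat partitions and the graphs they define\<close>

definition rows :: "nat \<Rightarrow> nat \<Rightarrow> (nat \<times> nat) set set" where
  "rows n r = (\<lambda>i. {i} \<times> {1..r}) ` {1..n}"

text \<open>The join of two partitions is the partition into the classes of the equivalence relation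
  generated by lying in a common block of either.\<close>

definition partition_join :: "'a set \<Rightarrow> 'a set set \<Rightarrow> 'a set set \<Rightarrow> 'a set set" where
  "partition_join A P Q = A // (\<Union>b\<in>P \<union> Q. b \<times> b)\<^sup>+"

definition CNF :: "nat \<Rightarrow> nat \<Rightarrow> (nat \<times> nat) set set set" where
  "CNF n r = {\<rho>. partition_on ({1..n} \<times> {1..r}) \<rho>
      \<and> (\<forall>b\<in>\<rho>. \<forall>p\<in>rows n r. card (b \<inter> p) \<le> 1)
      \<and> partition_join ({1..n} \<times> {1..r}) \<rho> (rows n r) = {{1..n} \<times> {1..r}}}"

text \<open>In the graph of a partition, \<open>Inl b\<close> is a block and \<open>Inr k\<close> is a terminal node.\<close>

definition partition_graph_verts ::
    "nat \<Rightarrow> (nat \<times> nat) set set \<Rightarrow> ((nat \<times> nat) set + nat) set" where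
  "partition_graph_verts m \<rho> = Inl ` \<rho> \<union> Inr ` {1..m}"

definition partition_graph_edges ::
    "nat \<Rightarrow> nat \<Rightarrow> nat \<Rightarrow> nat set set \<Rightarrow> (nat \<times> nat) set set \<Rightarrow> ((nat \<times> nat) set + nat) set set" where
  "partition_graph_edges n r m E \<rho> =
     {{Inl b, Inl b'} | b b'. b \<in> \<rho> \<and> b' \<in> \<rho> \<and> b \<noteq> b' \<and>
        (\<exists>i\<in>{1..n}. \<exists>j1 j2. (i, j1) \<in> b \<and> (i, j2) \<in> b' \<and> {j1, j2} \<in> E)} \<union>
     {{Inl b, Inr k} | b k. b \<in> \<rho> \<and> k \<in> {1..m} \<and> (\<exists>(i, j)\<in>b. {r + k, j} \<in> E)}"

definition Sigma_set :: "nat \<Rightarrow> nat \<Rightarrow> nat \<Rightarrow> nat set set \<Rightarrow> (real \<times> real) set" where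
  "Sigma_set n r m E =
     (\<lambda>\<rho>. (real (n * r + m) - real (card (partition_graph_verts m \<rho>)),
           real (n * card E) - real (card (partition_graph_edges n r m E \<rho>)))) ` CNF n r"

definition upper_boundary :: "(real \<times> real) set \<Rightarrow> (real \<times> real) set" where
  "upper_boundary S =
     {(p, q). (p, q) \<in> convex hull S \<and> (\<forall>q'. (p, q') \<in> convex hull S \<longrightarrow> q' \<le> q)}"


section \<open>The random-connection model\<close>

definition diffuse :: "'a measure \<Rightarrow> bool" where
  "diffuse \<mu> \<longleftrightarrow> (\<forall>x\<in>space \<mu>. {x} \<in> sets \<mu> \<and> emeasure \<mu> {x} = 0)"

text \<open>The point process \<open>\<Sum>i=1..\<tau>. \<delta>(X i)\<close> as a random measure; the points are indexed from 1.\<close>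

definition point_indices :: "enat \<Rightarrow> nat set" where
  "point_indices t = {i. 1 \<le> i \<and> enat i \<le> t}"

definition point_process ::
    "('w \<Rightarrow> enat) \<Rightarrow> (nat \<Rightarrow> 'w \<Rightarrow> 'a::topological_space) \<Rightarrow> 'w \<Rightarrow> 'a measure" where
  "point_process \<tau> X \<omega> = distr (count_space (point_indices (\<tau> \<omega>))) borel (\<lambda>i. X i \<omega>)"

definition poisson_process :: "'w measure \<Rightarrow> 'a measure \<Rightarrow> ('w \<Rightarrow> 'a measure) \<Rightarrow> bool" where
  "poisson_process M \<nu> \<eta> \<longleftrightarrow>
     (\<forall>B\<in>sets \<nu>. (\<lambda>\<omega>. emeasure (\<eta> \<omega>) B) \<in> borel_measurable M) \<and>
     (\<forall>B\<in>sets \<nu>. emeasure \<nu> B < \<infinity> \<longrightarrow>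
        (\<forall>k. measure M {\<omega> \<in> space M. emeasure (\<eta> \<omega>) B = of_nat k} =
             exp (- measure \<nu> B) * measure \<nu> B ^ k / fact k)) \<and>
     (\<forall>B\<in>sets \<nu>. emeasure \<nu> B = \<infinity> \<longrightarrow> (AE \<omega> in M. emeasure (\<eta> \<omega>) B = \<infinity>)) \<and>
     (\<forall>(B :: nat \<Rightarrow> 'a set) k. (\<forall>i<k. B i \<in> sets \<nu>) \<and> disjoint_family_on B {..<k} \<longrightarrow>
        prob_space.indep_vars M (\<lambda>_. borel) (\<lambda>i \<omega>. emeasure (\<eta> \<omega>) (B i)) {..<k})"

text \<open>Vertices of the random graph: \<open>Pt i\<close> stands for the point \<open>X i\<close> and \<open>Endpt k\<close> for the
  fixed point \<open>y k\<close>.\<close>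

datatype node = Pt nat | Endpt nat

fun location :: "(nat \<Rightarrow> 'a) \<Rightarrow> (nat \<Rightarrow> 'w \<Rightarrow> 'a) \<Rightarrow> 'w \<Rightarrow> node \<Rightarrow> 'a" where
  "location y X \<omega> (Pt i) = X i \<omega>"
| "location y X \<omega> (Endpt k) = y k"

definition graph_nodes :: "nat \<Rightarrow> ('w \<Rightarrow> enat) \<Rightarrow> 'w \<Rightarrow> node set" where
  "graph_nodes m \<tau> \<omega> = Pt ` point_indices (\<tau> \<omega>) \<union> Endpt ` {1..m}"

text \<open>\<open>F \<omega>\<close> is the edge set of the random graph. The last clause says that, conditionally on
  \<open>\<tau>\<close> and \<open>X\<close>, the edges between distinct vertices are independent, an edge between \<open>v\<close> and \<open>w\<close>
  being present with probability \<open>\<psi>\<close> of their locations: the finite set \<open>S\<close> lists unordered pairs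
  of vertices, each of them at most once and in one of its two orders, and \<open>C\<close> runs through the
  events for \<open>(\<tau>, X)\<close>.\<close>

definition random_connection_graph ::
    "'w measure \<Rightarrow> ('a::topological_space \<Rightarrow> 'a \<Rightarrow> real) \<Rightarrow> nat \<Rightarrow> (nat \<Rightarrow> 'a) \<Rightarrow>
     ('w \<Rightarrow> enat) \<Rightarrow> (nat \<Rightarrow> 'w \<Rightarrow> 'a) \<Rightarrow> ('w \<Rightarrow> node set set) \<Rightarrow> bool" where
  "random_connection_graph M \<psi> m y \<tau> X F \<longleftrightarrow>
     (\<forall>\<omega>\<in>space M. F \<omega> \<subseteq> {{v, w} | v w. v \<in> graph_nodes m \<tau> \<omega> \<and> w \<in> graph_nodes m \<tau> \<omega> \<and> v \<noteq> w}) \<and>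
     (\<forall>v w. {\<omega> \<in> space M. {v, w} \<in> F \<omega>} \<in> sets M) \<and>
     (\<forall>S C. finite S \<and> (\<forall>(v, w)\<in>S. v \<noteq> w) \<and> inj_on (\<lambda>(v, w). {v, w}) S \<and>
         C \<in> sets (count_space UNIV \<Otimes>\<^sub>M (\<Pi>\<^sub>M i\<in>UNIV. borel)) \<longrightarrow>
       (let A = {\<omega> \<in> space M. (\<tau> \<omega>, \<lambda>i. X i \<omega>) \<in> C \<and> fst ` S \<union> snd ` S \<subseteq> graph_nodes m \<tau> \<omega>} in
        measure M {\<omega> \<in> A. \<forall>(v, w)\<in>S. {v, w} \<in> F \<omega>} =
        (\<integral>\<omega>. indicator A \<omega> * (\<Prod>(v, w)\<in>S. \<psi> (location y X \<omega> v) (location y X \<omega> w)) \<partial>M)))"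

definition random_connection_model ::
    "'w measure \<Rightarrow> 'a::topological_space measure \<Rightarrow> ('a \<Rightarrow> 'a \<Rightarrow> real) \<Rightarrow> nat \<Rightarrow> (nat \<Rightarrow> 'a) \<Rightarrow>
     ('w \<Rightarrow> enat) \<Rightarrow> (nat \<Rightarrow> 'w \<Rightarrow> 'a) \<Rightarrow> ('w \<Rightarrow> node set set) \<Rightarrow> bool" where
  "random_connection_model M \<nu> \<psi> m y \<tau> X F \<longleftrightarrow>
     prob_space M \<and>
     \<tau> \<in> measurable M (count_space UNIV) \<and>
     (\<forall>i. X i \<in> borel_measurable M) \<and>
     poisson_process M \<nu> (point_process \<tau> X) \<and>
     random_connection_graph M \<psi> m y \<tau> X F"


section \<open>Subgraph counts and cumulants\<close>

text \<open>The sum has infinitely many terms where \<open>\<tau> = \<infinity>\<close>; \<open>infsum\<close> is then 0 if the count is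
  infinite, which in the integrable situations considered here happens with probability 0 only.\<close>

definition subgraph_count ::
    "nat \<Rightarrow> nat \<Rightarrow> nat set set \<Rightarrow> ('w \<Rightarrow> enat) \<Rightarrow> ('w \<Rightarrow> node set set) \<Rightarrow> 'w \<Rightarrow> real" where
  "subgraph_count r m E \<tau> F \<omega> =
     (\<Sum>\<^sub>\<infinity>\<alpha>\<in>{\<alpha> \<in> {1..r} \<rightarrow>\<^sub>E point_indices (\<tau> \<omega>). inj_on \<alpha> {1..r}}.
        (\<Prod>e\<in>induced_edges {1..r} E. of_bool ((\<lambda>i. Pt (\<alpha> i)) ` e \<in> F \<omega>)) *
        (\<Prod>(i, j)\<in>{(i, j). i \<in> {1..r} \<and> j \<in> {1..m} \<and> {r + j, i} \<in> E}.
            of_bool ({Endpt j, Pt (\<alpha> i)} \<in> F \<omega>)))"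

text \<open>Cumulants are defined through the moments, since the moment generating function of a
  subgraph count need not be finite near 0.\<close>

definition cumulant :: "'w measure \<Rightarrow> ('w \<Rightarrow> real) \<Rightarrow> nat \<Rightarrow> real" where
  "cumulant M Y n =
     (\<Sum>P\<in>{P. partition_on {1..n} P}.
        (- 1) ^ (card P - 1) * fact (card P - 1) * (\<Prod>B\<in>P. \<integral>\<omega>. Y \<omega> ^ card B \<partial>M))"

text \<open>By the Mecke formula, the expected value of the subgraph count is this integral times
  a positive factor. It vanishes, e.g. for \<open>\<phi> = 0\<close>, iff the count is almost surely 0, and
  then so are all its cumulants.\<close>

definition subgraph_integral ::
    "'a measure \<Rightarrow> ('a \<Rightarrow> 'a \<Rightarrow> real) \<Rightarrow> nat \<Rightarrow> nat \<Rightarrow> nat set set \<Rightarrow> (nat \<Rightarrow> 'a) \<Rightarrow> ennreal" where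
  "subgraph_integral \<mu> \<phi> r m E y =
     (\<integral>\<^sup>+ x. ennreal
        ((\<Prod>(i, j)\<in>{(i, j). i \<in> {1..r} \<and> j \<in> {1..r} \<and> i < j \<and> {i, j} \<in> E}. \<phi> (x i) (x j)) *
         (\<Prod>(i, j)\<in>{(i, j). i \<in> {1..r} \<and> j \<in> {1..m} \<and> {r + j, i} \<in> E}. \<phi> (y j) (x i)))
      \<partial>(\<Pi>\<^sub>M i\<in>{1..r}. \<mu>))"

end

theory Submission
  imports Defs
begin

text \<open>Expanding the powers of the count and sorting the resulting tuples of points by their
  coincidences turns, by Campbell's formula for the factorial moment measures of a Poisson process,
  the moment of order \<open>k\<close> into a sum over the non-flat partitions \<open>\<rho>\<close> of \<open>k\<close> rows, with terms
  \<open>t ^ \<bar>\<rho>\<bar> * c ^ e(\<rho>\<^sub>G) * I(\<rho>)\<close>, where the integral \<open>I(\<rho>)\<close> does not depend on \<open>t\<close>. In the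
  cumulant only the connected partitions survive, so it is a finite sum of nonnegative monomials in
  \<open>t\<close> and \<open>c\<close>. The assumption on the upper boundary bounds every monomial, on either side of the
  threshold, by the one at the corresponding end of the segment. The two ends are attained
  by the partition gluing the rows at one vertex with the largest number of endpoints and by the
  partition identifying all rows; their integrals are positive since \<open>subgraph_integral\<close> is.\<close>

section \<open>Integrals over finite products\<close>

text \<open>\<open>poisson_process\<close> prescribes only the joint law of the counts of sets, so
  Campbell's formula has to be built up from there: factorial moments of Poisson counts settle
  rectangles with sides from a disjoint family, atoms settle overlapping sides, and exhaustion by
  sets of finite measure settles the rest. The disconnected partitions cancel for two reasons. The
  weight of a partition whose blocks respect a partition \<open>P\<close> of the rows factorizes
  over \<open>P\<close>, since every edge contains a block and the endpoints are fixed. And the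
  coefficients of \<open>cumulant\<close> are values of the Moebius function of the partition
  lattice, whose sum over all \<open>P\<close> coarser than a given partition is 0 unless that
  partition has one block. As no term of the resulting sum is negative, a single term bounds the
  cumulant from below. For the two ends of the segment it is therefore enough to know that the
  integral is positive and that there are not too many edges; no integral has to be evaluated. All
  moments are computed in \<open>ennreal\<close> first, because the count may be infinite on a null
  set.\<close>

lemma nn_integral_PiM_reindex:
  assumes "product_sigma_finite (\<lambda>_::'i. N)" "product_sigma_finite (\<lambda>_::'j. N)"
    and h: "bij_betw h I J" and fin: "finite I"
    and g[measurable]: "g \<in> borel_measurable (PiM I (\<lambda>_. N))"
  shows "(\<integral>\<^sup>+x. g (\<lambda>i\<in>I. x (h i)) \<partial>PiM J (\<lambda>_::'j. N)) = integral\<^sup>N (PiM I (\<lambda>_::'i. N)) g"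
proof -
  interpret I: product_sigma_finite "\<lambda>_::'i. N" by fact
  interpret J: product_sigma_finite "\<lambda>_::'j. N" by fact
  have hJ: "h i \<in> J" if "i \<in> I" for i
    using h that by (auto simp: bij_betw_def)
  have finJ: "finite J"
    using h fin bij_betw_finite by blast
  have meas[measurable]: "(\<lambda>x. \<lambda>i\<in>I. x (h i)) \<in> measurable (PiM J (\<lambda>_. N)) (PiM I (\<lambda>_. N))"
    by (intro measurable_restrict measurable_component_singleton hJ)
  have "distr (PiM J (\<lambda>_. N)) (PiM I (\<lambda>_. N)) (\<lambda>x. \<lambda>i\<in>I. x (h i)) = PiM I (\<lambda>_. N)"
  proof (rule I.PiM_eqI[OF fin])
    fix A assume A: "\<And>i. i \<in> I \<Longrightarrow> A i \<in> sets N"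
    let ?k = "inv_into I h"
    have k: "?k (h i) = i" if "i \<in> I" for i
      using h that by (simp add: bij_betw_def)
    have kJ: "?k j \<in> I" "h (?k j) = j" if "j \<in> J" for j
      using h that by (auto simp: bij_betw_def inv_into_into f_inv_into_f)
    have "(\<lambda>x. \<lambda>i\<in>I. x (h i)) -` Pi\<^sub>E I A \<inter> space (PiM J (\<lambda>_. N)) = Pi\<^sub>E J (\<lambda>j. A (?k j))"
    proof (intro set_eqI iffI)
      fix x assume x: "x \<in> Pi\<^sub>E J (\<lambda>j. A (?k j))"
      have "x (h i) \<in> A i" if "i \<in> I" for i
        using x hJ[OF that] k[OF that] by (auto simp: PiE_iff)
      moreover have "x \<in> space (PiM J (\<lambda>_. N))"
        using x A[THEN sets.sets_into_space] kJ by (fastforce simp: space_PiM PiE_iff)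
      ultimately show "x \<in> (\<lambda>x. \<lambda>i\<in>I. x (h i)) -` Pi\<^sub>E I A \<inter> space (PiM J (\<lambda>_. N))"
        by auto
    next
      fix x assume x: "x \<in> (\<lambda>x. \<lambda>i\<in>I. x (h i)) -` Pi\<^sub>E I A \<inter> space (PiM J (\<lambda>_. N))"
      have "x j \<in> A (?k j)" if "j \<in> J" for j
        using x kJ[OF that] by (auto simp: PiE_iff)
      with x show "x \<in> Pi\<^sub>E J (\<lambda>j. A (?k j))"
        by (auto simp: space_PiM PiE_iff)
    qed
    then have "emeasure (distr (PiM J (\<lambda>_. N)) (PiM I (\<lambda>_. N)) (\<lambda>x. \<lambda>i\<in>I. x (h i))) (Pi\<^sub>E I A)
        = (\<Prod>j\<in>J. emeasure N (A (?k j)))"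
      using A fin finJ kJ by (simp add: emeasure_distr J.emeasure_PiM)
    also have "\<dots> = (\<Prod>i\<in>I. emeasure N (A i))"
      using prod.reindex_bij_betw[OF h, of "\<lambda>j. emeasure N (A (?k j))"] k by (simp cong: prod.cong)
    finally show "emeasure (distr (PiM J (\<lambda>_. N)) (PiM I (\<lambda>_. N)) (\<lambda>x. \<lambda>i\<in>I. x (h i))) (Pi\<^sub>E I A)
        = (\<Prod>i\<in>I. emeasure N (A i))" .
  qed simp
  then show ?thesis
    using nn_integral_distr[OF meas, of g] g by simp
qed

text \<open>Iterated Tonelli, peeling off one \<open>K a\<close> per induction step. It is the
  source of the factorizations below: variables attached to different groups of rows, or to
  different rows once a common vertex is fixed, integrate separately.\<close>

lemma (in product_sigma_finite) product_nn_integral_UN: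
  assumes "finite A" "\<And>a. a \<in> A \<Longrightarrow> finite (K a)"
    and "\<And>a b. a \<in> A \<Longrightarrow> b \<in> A \<Longrightarrow> a \<noteq> b \<Longrightarrow> K a \<inter> K b = {}"
    and "\<And>a. a \<in> A \<Longrightarrow> g a \<in> borel_measurable (PiM (K a) M)"
  shows "(\<integral>\<^sup>+x. (\<Prod>a\<in>A. g a (restrict x (K a))) \<partial>PiM (\<Union>a\<in>A. K a) M)
    = (\<Prod>a\<in>A. integral\<^sup>N (PiM (K a) M) (g a))"
  using assms
proof (induction A)
  case empty
  then show ?case by (simp add: PiM_empty)
next
  case (insert a A)
  let ?U = "\<Union>a\<in>A. K a"
  have disj: "K a \<inter> ?U = {}"
    using insert.prems(2) insert.hyps by fastforce
  have [measurable]: "g b \<in> borel_measurable (PiM (K b) M)" if "b \<in> insert a A" for b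
    using insert.prems(3) that by blast
  have r: "(\<lambda>x. g b (restrict x (K b))) \<in> borel_measurable (PiM L M)"
    if "b \<in> insert a A" "K b \<subseteq> L" for b L
    using insert.prems(3)[OF that(1)] measurable_restrict_subset[OF that(2)]
    by (rule measurable_compose[rotated])
  have meas: "(\<lambda>x. \<Prod>b\<in>insert a A. g b (restrict x (K b))) \<in> borel_measurable (PiM (K a \<union> ?U) M)"
    by (intro borel_measurable_prod_ennreal r) auto
  have meas': "(\<lambda>x. \<Prod>b\<in>A. g b (restrict x (K b))) \<in> borel_measurable (PiM ?U M)"
    by (intro borel_measurable_prod_ennreal r) auto
  have m: "(\<Prod>b\<in>insert a A. g b (restrict (merge (K a) ?U (x, y)) (K b))) =
      g a x * (\<Prod>b\<in>A. g b (restrict y (K b)))"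
    if "x \<in> space (PiM (K a) M)" for x y
  proof -
    have "restrict (merge (K a) ?U (x, y)) (K a) = x"
      using that disj by (simp add: space_PiM PiE_iff extensional_restrict)
    moreover have "restrict (merge (K a) ?U (x, y)) (K b) = restrict y (K b)" if "b \<in> A" for b
      using disj that by (intro ext) (auto simp: merge_def restrict_def)
    ultimately show ?thesis
      using insert.hyps by (simp cong: prod.cong)
  qed
  have "(\<integral>\<^sup>+x. (\<Prod>b\<in>insert a A. g b (restrict x (K b))) \<partial>PiM (K a \<union> ?U) M) =
     (\<integral>\<^sup>+x. \<integral>\<^sup>+y. g a x * (\<Prod>b\<in>A. g b (restrict y (K b))) \<partial>PiM ?U M \<partial>PiM (K a) M)"
    using insert.prems(1) insert.hyps
    by (subst product_nn_integral_fold[OF disj _ _ meas]) (auto simp del: prod.insert intro!: nn_integral_cong m)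
  also have "\<dots> = integral\<^sup>N (PiM (K a) M) (g a) * (\<integral>\<^sup>+y. (\<Prod>b\<in>A. g b (restrict y (K b))) \<partial>PiM ?U M)"
    using meas' by (simp add: nn_integral_cmult nn_integral_multc)
  also have "(\<integral>\<^sup>+y. (\<Prod>b\<in>A. g b (restrict y (K b))) \<partial>PiM ?U M) = (\<Prod>a\<in>A. integral\<^sup>N (PiM (K a) M) (g a))"
    using insert.prems by (intro insert.IH) auto
  finally show ?case
    using insert.hyps by simp
qed

lemma sigma_finite_scale_measure:
  assumes "sigma_finite_measure N" "t < \<infinity>"
  shows "sigma_finite_measure (scale_measure t N)"
proof -
  interpret sigma_finite_measure N by fact
  obtain A where "countable A" "A \<subseteq> sets N" "\<Union>A = space N" "\<forall>a\<in>A. emeasure N a \<noteq> \<infinity>"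
    using sigma_finite_countable by blast
  then show ?thesis
    using assms(2) by unfold_locales (auto intro!: exI[of _ A] simp: space_scale_measure ennreal_mult_eq_top_iff)
qed

text \<open>Each of the \<open>card I\<close> sides of a rectangle contributes a factor
  \<open>t\<close>. Applied with the blocks of a partition as index set, this produces the power of
  the intensity in each monomial.\<close>

lemma PiM_scale_measure:
  assumes N: "sigma_finite_measure N" and t: "t < \<infinity>" and I: "finite I"
  shows "PiM I (\<lambda>_. scale_measure t N) = scale_measure (t ^ card I) (PiM I (\<lambda>_. N))"
proof -
  interpret product_sigma_finite "\<lambda>_. N"
    using N by (simp add: product_sigma_finite_def)
  interpret t: product_sigma_finite "\<lambda>_. scale_measure t N"
    using sigma_finite_scale_measure[OF N t] by (simp add: product_sigma_finite_def)
  have s: "sets (PiM I (\<lambda>_. N)) = sets (PiM I (\<lambda>_. scale_measure t N))"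
    by (intro sets_PiM_cong) auto
  show ?thesis
    using I s by (intro t.PiM_eqI[symmetric]) (auto simp: emeasure_PiM prod.distrib)
qed

section \<open>Partitions and cumulants\<close>

text \<open>The Moebius function of the partition lattice between a partition with \<open>k\<close>
  blocks and the one-block partition. At \<open>k = 0\<close> truncated subtraction gives the value
  1, hence the assumption \<open>k > 0\<close> in the recursion below.\<close>

definition moebius_weight :: "nat \<Rightarrow> real" where
  "moebius_weight k = (- 1) ^ (k - 1) * fact (k - 1)"

lemma moebius_weight_Suc: "k > 0 \<Longrightarrow> moebius_weight (Suc k) = - real k * moebius_weight k"
  by (cases k) (auto simp: moebius_weight_def algebra_simps)

lemma partition_on_eqI:
  assumes "partition_on A P" "B \<in> P" "C \<in> P" "x \<in> B" "x \<in> C" shows "B = C"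
  using assms by (auto simp: partition_on_def disjoint_def)

text \<open>A partition of \<open>insert x A\<close> is a partition of \<open>A\<close> together
  with the block that receives \<open>x\<close>. The choice \<open>B = {}\<close> encodes that
  \<open>x\<close> stays alone: \<open>{}\<close> is never a member of \<open>P\<close>, so removing
  it changes nothing and \<open>{x}\<close> is added.\<close>

lemma bij_betw_partitions_insert:
  assumes "x \<notin> A"
  shows "bij_betw (\<lambda>(P, B). insert (insert x B) (P - {B}))
    (SIGMA P:{P. partition_on A P}. insert {} P) {Q. partition_on (insert x A) Q}"
proof -
  define cl where "cl Q = (THE C. C \<in> Q \<and> x \<in> C)" for Q :: "'a set set"
  have cl: "cl Q = C" if "partition_on (insert x A) Q" "C \<in> Q" "x \<in> C" for Q C
    unfolding cl_def using that by (intro the_equality) (auto dest: partition_on_eqI)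
  have new: "partition_on (insert x A) (insert (insert x B) (P - {B}))"
    if P: "partition_on A P" and B: "B \<in> insert {} P" for P B
  proof (subst partition_on_insert)
    show "disjnt (insert x B) (\<Union>(P - {B}))"
      using P B assms by (auto simp: disjnt_def partition_on_def disjoint_def)
    have "P - {{}} = P" using partition_onD3[OF P] by blast
    then have "partition_on (A - B) (P - {B})"
      using P B by (auto simp: partition_on_def disjoint_def)
    moreover have "insert x A - insert x B = A - B" "B \<subseteq> A"
      using assms P B by (auto simp: partition_on_def)
    ultimately show "partition_on (insert x A - insert x B) (P - {B}) \<and> insert x B \<subseteq> insert x A \<and> insert x B \<noteq> {}"
      by auto
  qed
  have old: "partition_on A ((Q - {C}) \<union> ({C - {x}} - {{}}))"
    if Q: "partition_on (insert x A) Q" and C: "C \<in> Q" "x \<in> C" for Q C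
  proof (rule partition_onI)
    show "\<Union> (Q - {C} \<union> ({C - {x}} - {{}})) = A" 
    proof -
      have "\<Union> (Q - {C} \<union> ({C - {x}} - {{}})) = \<Union>(Q - {C}) \<union> (C - {x})" by auto
      moreover have "\<Union>(Q - {C}) = insert x A - C"
      proof -
        have "\<Union>Q = insert x A" "\<And>D. D \<in> Q - {C} \<Longrightarrow> D \<inter> C = {}"
          using Q C by (auto simp: partition_on_def disjoint_def)
        moreover have "\<Union>Q = C \<union> \<Union>(Q - {C})" using C by auto
        ultimately show ?thesis by (simp only:) blast
      qed
      moreover have "C \<subseteq> insert x A" using C Q by (auto simp: partition_on_def)
      ultimately show ?thesis using assms C by auto
    qed
    show "{} \<notin> Q - {C} \<union> ({C - {x}} - {{}})" using Q by (auto simp: partition_on_def)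
    show "disjnt p q" if "p \<in> Q - {C} \<union> ({C - {x}} - {{}})" "q \<in> Q - {C} \<union> ({C - {x}} - {{}})" "p \<noteq> q" for p q
      using that C Q by (auto simp: partition_on_def disjoint_def disjnt_def)
  qed
  \<comment> \<open>The inverse takes \<open>x\<close> out of its block. Subtracting
    \<open>{{}}\<close> drops the remainder when that block was \<open>{x}\<close>, while the second
    component then records the choice \<open>{}\<close>.\<close>
  define bk where "bk Q = ((Q - {cl Q}) \<union> ({cl Q - {x}} - {{}}), cl Q - {x})" for Q
  show ?thesis
  proof (rule bij_betw_byWitness[where f' = bk])
    show "\<forall>a\<in>SIGMA P:{P. partition_on A P}. insert {} P.
       bk (case a of (P, B) \<Rightarrow> insert (insert x B) (P - {B})) = a"
    proof (intro ballI)
      fix a assume "a \<in> (SIGMA P:{P. partition_on A P}. insert {} P)"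
      then obtain P B where a: "a = (P, B)" and P: "partition_on A P" and B: "B \<in> insert {} P"
        by auto
      let ?Q = "insert (insert x B) (P - {B})"
      have c: "cl ?Q = insert x B"
        by (rule cl[OF new[OF P B]]) auto
      have x: "x \<notin> B" "insert x B \<notin> P" "{} \<notin> P"
        using assms P B by (auto simp: partition_on_def)
      have "bk ?Q = (P, B)"
        unfolding bk_def c using x B by auto
      then show "bk (case a of (P, B) \<Rightarrow> insert (insert x B) (P - {B})) = a"
        by (simp add: a)
    qed
  next
    show "\<forall>Q\<in>{Q. partition_on (insert x A) Q}.
       (case bk Q of (P, B) \<Rightarrow> insert (insert x B) (P - {B})) = Q"
    proof (intro ballI)
      fix Q assume "Q \<in> {Q. partition_on (insert x A) Q}"
      then have Q: "partition_on (insert x A) Q" by simp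
      then obtain C where C: "C \<in> Q" "x \<in> C" by (auto simp: partition_on_def)
      have c: "cl Q = C" by (rule cl[OF Q C])
      have "C - {x} \<notin> Q"
      proof
        assume D: "C - {x} \<in> Q"
        moreover have "C - {x} \<noteq> C" using C by auto
        ultimately have "(C - {x}) \<inter> C = {}"
          using Q C by (auto simp: partition_on_def disjoint_def)
        then have "C - {x} = {}" by auto
        then have "{} \<in> Q" using D by (simp only:)
        then show False using Q by (simp add: partition_on_def)
      qed
      then have "insert (insert x (C - {x})) ((Q - {C}) \<union> ({C - {x}} - {{}}) - {C - {x}}) = Q"
        using C by (auto simp: insert_absorb)
      then show "(case bk Q of (P, B) \<Rightarrow> insert (insert x B) (P - {B})) = Q"
        unfolding bk_def c by simp
    qed
  next
    show "(\<lambda>(P, B). insert (insert x B) (P - {B})) ` (SIGMA P:{P. partition_on A P}. insert {} P)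
      \<subseteq> {Q. partition_on (insert x A) Q}"
      using new by auto
    show "bk ` {Q. partition_on (insert x A) Q} \<subseteq> (SIGMA P:{P. partition_on A P}. insert {} P)"
    proof (rule image_subsetI)
      fix Q assume "Q \<in> {Q. partition_on (insert x A) Q}"
      then have Q: "partition_on (insert x A) Q" by simp
      then obtain C where C: "C \<in> Q" "x \<in> C" by (auto simp: partition_on_def)
      have c: "cl Q = C" by (rule cl[OF Q C])
      show "bk Q \<in> (SIGMA P:{P. partition_on A P}. insert {} P)"
        unfolding bk_def c using old[OF Q C] by auto
    qed
  qed
qed

text \<open>With \<open>x\<close> removed, a partition of the rest into \<open>k\<close> blocks
  extends in \<open>k\<close> ways to \<open>k\<close> blocks and in one way to \<open>k + 1\<close>
  blocks, and \<open>k * moebius_weight k + moebius_weight (Suc k) = 0\<close>. Only a singleton,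
  whose rest is empty, escapes this cancellation.\<close>

lemma sum_moebius_weight:
  assumes "finite A" "A \<noteq> {}"
  shows "(\<Sum>P | partition_on A P. moebius_weight (card P)) = (if card A = 1 then 1 else 0)"
proof -
  obtain x where x: "x \<in> A" using assms by blast
  let ?A = "A - {x}"
  have A: "insert x ?A = A" using x by blast
  show ?thesis
  proof (cases "?A = {}")
    case True
    then have "A = {x}" using A by auto
    moreover have "{P. partition_on {x} P} = {{{x}}}"
    proof -
      have "P = {{x}}" if P: "partition_on {x} P" for P
      proof -
        have "B = {x}" if "B \<in> P" for B
        proof -
          have "B \<subseteq> {x}" "B \<noteq> {}" using P that by (auto simp: partition_on_def)
          then show ?thesis by blast
        qed
        moreover have "P \<noteq> {}" using P by (auto simp: partition_on_def)
        ultimately show ?thesis by auto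
      qed
      then show ?thesis by (auto simp: partition_on_space)
    qed
    ultimately show ?thesis by (simp add: moebius_weight_def)
  next
    case False
    have fin: "finite {P. partition_on ?A P}"
      using assms by (intro finitely_many_partition_on) auto
    have finP: "finite P" if "partition_on ?A P" for P
      using finite_elements[OF _ that] assms by simp
    have "(\<Sum>P | partition_on A P. moebius_weight (card P)) =
      (\<Sum>(P, B)\<in>(SIGMA P:{P. partition_on ?A P}. insert {} P).
         moebius_weight (card (insert (insert x B) (P - {B}))))"
      using sum.reindex_bij_betw[OF bij_betw_partitions_insert, of x ?A "\<lambda>P. moebius_weight (card P)"] A
      by (simp add: case_prod_unfold)
    also have "\<dots> = (\<Sum>P | partition_on ?A P. \<Sum>B\<in>insert {} P.
         moebius_weight (card (insert (insert x B) (P - {B}))))"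
      using fin finP by (subst sum.Sigma) auto
    also have "\<dots> = (\<Sum>P | partition_on ?A P. 0)"
    proof (intro sum.cong refl)
      fix P assume "P \<in> {P. partition_on ?A P}"
      then have P: "partition_on ?A P" by simp
      have e: "{} \<notin> P" "P \<noteq> {}" and x: "\<And>B. insert x B \<notin> P"
        using P False by (auto simp: partition_on_def)
      have k: "card P > 0" using e finP[OF P] by (simp add: card_gt_0_iff)
      have "card (insert (insert x B) (P - {B})) = card P" if "B \<in> P" for B
        using that x k finP[OF P] by (simp add: card_insert_if)
      then have "(\<Sum>B\<in>insert {} P. moebius_weight (card (insert (insert x B) (P - {B})))) =
        moebius_weight (Suc (card P)) + real (card P) * moebius_weight (card P)"
        using e x finP[OF P] by simp
      then show "(\<Sum>B\<in>insert {} P. moebius_weight (card (insert (insert x B) (P - {B})))) = 0"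
        using k by (simp add: moebius_weight_Suc)
    qed
    also have "card A \<noteq> 1"
      using False x by (auto simp: card_1_singleton_iff)
    ultimately show ?thesis by simp
  qed
qed

text \<open>The partitions coarser than \<sigma> form the partition lattice of the set \<sigma>: a
  block of \<open>P\<close> becomes the set of the members of \<sigma> inside it, with union as
  inverse, and the number of blocks is kept. So the previous sum applies to \<sigma> in place of
  \<open>A\<close>.\<close>

lemma sum_moebius_weight_coarser:
  assumes "finite A" "A \<noteq> {}" and \<sigma>: "partition_on A \<sigma>"
  shows "(\<Sum>P | partition_on A P \<and> (\<forall>s\<in>\<sigma>. \<exists>B\<in>P. s \<subseteq> B). moebius_weight (card P))
     = (if card \<sigma> = 1 then 1 else 0)"
proof -
  define down where "down P = (\<lambda>B. {s \<in> \<sigma>. s \<subseteq> B}) ` P" for P :: "'a set set"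
  define up where "up Q = Union ` Q" for Q :: "'a set set set"
  have fin: "finite \<sigma>" "\<sigma> \<noteq> {}"
    using finite_elements[OF assms(1) \<sigma>] assms(2) \<sigma> by (auto simp: partition_on_def)
  \<comment> \<open>A set of nonempty disjoint sets is recovered from its union; this gives
    \<open>hi\<close> and thereby \<open>down (up Q) = Q\<close>.\<close>
  have inj: "inj_on Union (Pow \<sigma>)"
  proof (rule inj_onI)
    have sub: "S \<subseteq> T" if "S \<subseteq> \<sigma>" "T \<subseteq> \<sigma>" "\<Union>S = \<Union>T" for S T
    proof
      fix s assume s: "s \<in> S"
      then have "s \<noteq> {}" using \<sigma> that by (auto simp: partition_on_def)
      then obtain x where x: "x \<in> s" by auto
      then have "x \<in> \<Union>T" using s that(3) by blast
      then obtain t where "t \<in> T" "x \<in> t" by blast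
      then have "s = t" using partition_on_eqI[OF \<sigma> _ _ x] s that by auto
      then show "s \<in> T" using \<open>t \<in> T\<close> by simp
    qed
    show "S = T" if "S \<in> Pow \<sigma>" "T \<in> Pow \<sigma>" "\<Union>S = \<Union>T" for S T
      using sub[of S T] sub[of T S] that by auto
  qed
  have low: "\<Union>{s \<in> \<sigma>. s \<subseteq> B} = B"
    if P: "partition_on A P" "\<forall>s\<in>\<sigma>. \<exists>B\<in>P. s \<subseteq> B" and B: "B \<in> P" for P B
  proof -
    have "\<exists>s\<in>\<sigma>. x \<in> s \<and> s \<subseteq> B" if "x \<in> B" for x
    proof -
      have "x \<in> A" using that B P by (auto simp: partition_on_def)
      then obtain s where s: "s \<in> \<sigma>" "x \<in> s" using \<sigma> by (auto simp: partition_on_def)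
      then obtain B' where "B' \<in> P" "s \<subseteq> B'" using P by auto
      then have "B' = B" using partition_on_eqI[OF P(1) _ B] s that by auto
      then show ?thesis using s \<open>s \<subseteq> B'\<close> by auto
    qed
    then show ?thesis by blast
  qed
  have hi: "{s \<in> \<sigma>. s \<subseteq> \<Union>S} = S" if "S \<subseteq> \<sigma>" for S
  proof (rule inj_onD[OF inj])
    show "\<Union> {s \<in> \<sigma>. s \<subseteq> \<Union> S} = \<Union>S" using that by auto
  qed (use that in auto)
  have "(\<Sum>P | partition_on A P \<and> (\<forall>s\<in>\<sigma>. \<exists>B\<in>P. s \<subseteq> B). moebius_weight (card P)) =
    (\<Sum>Q | partition_on \<sigma> Q. moebius_weight (card Q))"
  proof (rule sum.reindex_bij_witness[where i = up and j = down])
    fix P assume "P \<in> {P. partition_on A P \<and> (\<forall>s\<in>\<sigma>. \<exists>B\<in>P. s \<subseteq> B)}"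
    then have P: "partition_on A P" "\<forall>s\<in>\<sigma>. \<exists>B\<in>P. s \<subseteq> B" by auto
    show ud: "up (down P) = P"
      using low[OF P] by (simp add: up_def down_def image_image cong: image_cong)
    show "moebius_weight (card (down P)) = moebius_weight (card P)"
    proof -
      have "inj_on (\<lambda>B. {s \<in> \<sigma>. s \<subseteq> B}) P"
        using low[OF P] by (metis (no_types, lifting) inj_onI)
      then show ?thesis by (simp add: down_def card_image)
    qed
    show "down P \<in> {Q. partition_on \<sigma> Q}"
    proof (intro CollectI partition_onI)
      show "\<Union> (down P) = \<sigma>" using P by (auto simp: down_def)
      show "{} \<notin> down P"
      proof
        assume "{} \<in> down P"
        then have "{} \<in> up (down P)" by (force simp: up_def)
        then show False using ud P by (auto simp: partition_on_def)
      qed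
      show "disjnt p q" if pq: "p \<in> down P" "q \<in> down P" "p \<noteq> q" for p q
      proof -
        obtain B C where BC: "B \<in> P" "C \<in> P" "p = {s \<in> \<sigma>. s \<subseteq> B}" "q = {s \<in> \<sigma>. s \<subseteq> C}"
          using pq by (auto simp: down_def)
        then have "B \<noteq> C" using pq by auto
        have "False" if "s \<in> p" "s \<in> q" for s
        proof -
          have "s \<noteq> {}" using \<sigma> that BC by (auto simp: partition_on_def)
          then show False using partition_on_eqI[OF P(1) BC(1,2)] that BC \<open>B \<noteq> C\<close> by blast
        qed
        then show ?thesis by (auto simp: disjnt_def)
      qed
    qed
  next
    fix Q assume "Q \<in> {Q. partition_on \<sigma> Q}"
    then have Q: "partition_on \<sigma> Q" by simp
    have sub: "S \<subseteq> \<sigma>" if "S \<in> Q" for S using Q that by (auto simp: partition_on_def)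
    show "down (up Q) = Q"
      using hi sub by (simp add: up_def down_def image_image cong: image_cong)
    show "up Q \<in> {P. partition_on A P \<and> (\<forall>s\<in>\<sigma>. \<exists>B\<in>P. s \<subseteq> B)}"
    proof (intro CollectI conjI partition_onI)
      show "\<Union> (up Q) = A" using Q \<sigma> by (auto simp: partition_on_def up_def)
      show "{} \<notin> up Q"
      proof
        assume "{} \<in> up Q"
        then obtain S where S: "S \<in> Q" "\<Union>S = {}" by (auto simp: up_def)
        then have "S \<noteq> {}" using Q by (auto simp: partition_on_def)
        then obtain s where "s \<in> S" by auto
        then have "s = {}" "s \<in> \<sigma>" using S sub by auto
        then show False using \<sigma> by (auto simp: partition_on_def)
      qed
      show "\<forall>s\<in>\<sigma>. \<exists>B\<in>up Q. s \<subseteq> B" using Q by (auto simp: partition_on_def up_def)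
      show "disjnt p q" if pq: "p \<in> up Q" "q \<in> up Q" "p \<noteq> q" for p q
      proof -
        obtain S T where ST: "S \<in> Q" "T \<in> Q" "p = \<Union>S" "q = \<Union>T"
          using pq by (auto simp: up_def)
        then have d: "S \<inter> T = {}" using pq Q by (auto simp: partition_on_def disjoint_def)
        have "False" if "s \<in> S" "t \<in> T" "x \<in> s" "x \<in> t" for s t x
          using partition_on_eqI[OF \<sigma> _ _ that(3,4)] sub ST that d by blast
        then show ?thesis using ST by (auto simp: disjnt_def)
      qed
    qed
  qed
  then show ?thesis using sum_moebius_weight[OF fin] by simp
qed

section \<open>Non-flat partitions over a partition of the rows\<close>

lemma partition_on_Sigma_restrict:
  assumes P: "partition_on A P" and \<rho>: "partition_on (A \<times> R) \<rho>"
    and resp: "\<forall>b\<in>\<rho>. \<exists>B\<in>P. fst ` b \<subseteq> B" and B: "B \<in> P"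
  shows "partition_on (B \<times> R) {b \<in> \<rho>. fst ` b \<subseteq> B}"
proof (rule partition_onI)
  show "\<Union> {b \<in> \<rho>. fst ` b \<subseteq> B} = B \<times> R"
  proof safe
    fix i j b assume b: "(i, j) \<in> b" "b \<in> \<rho>" "fst ` b \<subseteq> B"
    then show "i \<in> B" by force
    show "j \<in> R" using b \<rho> by (auto simp: partition_on_def)
  next
    fix i j assume ij: "i \<in> B" "j \<in> R"
    then have "(i, j) \<in> A \<times> R" using P B by (auto simp: partition_on_def)
    then obtain b where b: "b \<in> \<rho>" "(i, j) \<in> b" using \<rho> by (auto simp: partition_on_def)
    \<comment> \<open>The member of \<open>P\<close> below the block through \<open>(i, j)\<close>
      shares the row \<open>i\<close> with \<open>B\<close>, hence equals \<open>B\<close>.\<close>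
    then obtain C where C: "C \<in> P" "fst ` b \<subseteq> C" using resp by auto
    then have "i \<in> C" using b by force
    then have "C = B" using partition_on_eqI[OF P _ B] C ij by auto
    then show "(i, j) \<in> \<Union> {b \<in> \<rho>. fst ` b \<subseteq> B}" using b C by auto
  qed
qed (use \<rho> in \<open>auto simp: partition_on_def disjoint_def disjnt_def\<close>)

text \<open>A block meets every row in at most one point iff \<open>fst\<close> is injective on it.\<close>

definition NF :: "nat \<Rightarrow> nat set \<Rightarrow> (nat \<times> nat) set set set" where
  "NF r A = {\<rho>. partition_on (A \<times> {1..r}) \<rho> \<and> (\<forall>b\<in>\<rho>. inj_on fst b)}"

lemma finite_NF: "finite A \<Longrightarrow> finite (NF r A)"
  unfolding NF_def by (rule finite_subset[OF _ finitely_many_partition_on[of "A \<times> {1..r}"]]) auto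

text \<open>This turns a product, over the blocks of \<open>P\<close>, of sums over non-flat
  partitions into one sum over non-flat partitions of all rows. Restriction inverts the union,
  because a nonempty block lying over \<open>B\<close> cannot lie over another member of
  \<open>P\<close>.\<close>

lemma bij_betw_NF_Union:
  assumes P: "partition_on A P"
  shows "bij_betw (\<lambda>f. \<Union>B\<in>P. f B) (Pi\<^sub>E P (NF r)) {\<rho> \<in> NF r A. \<forall>b\<in>\<rho>. \<exists>B\<in>P. fst ` b \<subseteq> B}"
proof (rule bij_betw_byWitness[where f' = "\<lambda>\<rho>. \<lambda>B\<in>P. {b \<in> \<rho>. fst ` b \<subseteq> B}"])
  have sub: "b \<subseteq> B \<times> {1..r}" "fst ` b \<subseteq> B" "b \<noteq> {}" "inj_on fst b"
    if "f \<in> Pi\<^sub>E P (NF r)" "B \<in> P" "b \<in> f B" for f B b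
  proof -
    have f: "partition_on (B \<times> {1..r}) (f B)" "\<forall>b\<in>f B. inj_on fst b"
      using that by (auto simp: PiE_iff NF_def)
    show "b \<subseteq> B \<times> {1..r}" using f that by (auto simp: partition_on_def)
    then show "fst ` b \<subseteq> B" by auto
    show "b \<noteq> {}" "inj_on fst b" using f that by (auto simp: partition_on_def)
  qed
  have eq: "B = C" if "f \<in> Pi\<^sub>E P (NF r)" "B \<in> P" "C \<in> P" "b \<in> f B" "fst ` b \<subseteq> C" for f B C b
  proof -
    have "b \<noteq> {}" using sub(3)[OF that(1,2,4)] .
    then obtain x where "x \<in> b" by auto
    then have "fst x \<in> B" "fst x \<in> C" using that(5) sub(2)[OF that(1,2,4)] by auto
    then show ?thesis using partition_on_eqI[OF P that(2,3)] by auto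
  qed
  show "\<forall>f\<in>Pi\<^sub>E P (NF r). (\<lambda>B\<in>P. {b \<in> \<Union>B\<in>P. f B. fst ` b \<subseteq> B}) = f"
  proof
    fix f assume f: "f \<in> Pi\<^sub>E P (NF r)"
    have "{b \<in> \<Union>B\<in>P. f B. fst ` b \<subseteq> B} = f B" if B: "B \<in> P" for B
    proof (intro set_eqI iffI)
      fix b assume "b \<in> {b \<in> \<Union>B\<in>P. f B. fst ` b \<subseteq> B}"
      then show "b \<in> f B" using eq[OF f _ B] by blast
    next
      fix b assume "b \<in> f B"
      then show "b \<in> {b \<in> \<Union>B\<in>P. f B. fst ` b \<subseteq> B}" using sub(2)[OF f B] B by blast
    qed
    then show "(\<lambda>B\<in>P. {b \<in> \<Union>B\<in>P. f B. fst ` b \<subseteq> B}) = f"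
      using f by (auto simp: PiE_iff extensional_def fun_eq_iff restrict_def)
  qed
  show "\<forall>\<rho>\<in>{\<rho> \<in> NF r A. \<forall>b\<in>\<rho>. \<exists>B\<in>P. fst ` b \<subseteq> B}. (\<Union>B\<in>P. (\<lambda>B\<in>P. {b \<in> \<rho>. fst ` b \<subseteq> B}) B) = \<rho>"
    by auto
  show "(\<lambda>\<rho>. \<lambda>B\<in>P. {b \<in> \<rho>. fst ` b \<subseteq> B}) ` {\<rho> \<in> NF r A. \<forall>b\<in>\<rho>. \<exists>B\<in>P. fst ` b \<subseteq> B} \<subseteq> Pi\<^sub>E P (NF r)"
    using partition_on_Sigma_restrict[OF P] by (auto simp: NF_def)
  show "(\<lambda>f. \<Union>B\<in>P. f B) ` Pi\<^sub>E P (NF r) \<subseteq> {\<rho> \<in> NF r A. \<forall>b\<in>\<rho>. \<exists>B\<in>P. fst ` b \<subseteq> B}"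
  proof (rule image_subsetI)
    fix f assume f: "f \<in> Pi\<^sub>E P (NF r)"
    have "partition_on (A \<times> {1..r}) (\<Union>B\<in>P. f B)"
    proof (rule partition_onI)
      have "\<Union> (\<Union>B\<in>P. f B) = (\<Union>B\<in>P. \<Union>(f B))" by auto
      also have "\<dots> = (\<Union>B\<in>P. B \<times> {1..r})"
        using f by (intro SUP_cong) (auto simp: PiE_iff NF_def partition_on_def)
      also have "\<dots> = A \<times> {1..r}" using P by (auto simp: partition_on_def)
      finally show "\<Union> (\<Union>B\<in>P. f B) = A \<times> {1..r}" .
      show "{} \<notin> (\<Union>B\<in>P. f B)" using sub(3)[OF f] by auto
      show "disjnt p q" if pq: "p \<in> (\<Union>B\<in>P. f B)" "q \<in> (\<Union>B\<in>P. f B)" "p \<noteq> q" for p q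
      proof -
        obtain B C where BC: "B \<in> P" "C \<in> P" "p \<in> f B" "q \<in> f C" using pq by auto
        show ?thesis
        proof (cases "B = C")
          case True
          have "partition_on (B \<times> {1..r}) (f B)" using f BC by (auto simp: PiE_iff NF_def)
          then show ?thesis using BC pq True by (auto simp: partition_on_def disjoint_def disjnt_def)
        next
          case False
          then have "B \<inter> C = {}" using P BC by (auto simp: partition_on_def disjoint_def)
          then show ?thesis using sub(1)[OF f BC(1,3)] sub(1)[OF f BC(2,4)] by (auto simp: disjnt_def)
        qed
      qed
    qed
    then show "(\<Union>B\<in>P. f B) \<in> {\<rho> \<in> NF r A. \<forall>b\<in>\<rho>. \<exists>B\<in>P. fst ` b \<subseteq> B}"
      unfolding NF_def using sub(2,4)[OF f] by blast
  qed
qed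

section \<open>Connectedness in terms of rows\<close>

definition links :: "nat \<Rightarrow> nat \<Rightarrow> (nat \<times> nat) set set \<Rightarrow> ((nat \<times> nat) \<times> (nat \<times> nat)) set" where
  "links n r \<rho> = (\<Union>b\<in>\<rho> \<union> rows n r. b \<times> b)\<^sup>+"

lemma equiv_links:
  assumes \<rho>: "partition_on ({1..n} \<times> {1..r}) \<rho>"
  shows "equiv ({1..n} \<times> {1..r}) (links n r \<rho>)"
proof -
  let ?U = "\<Union>b\<in>\<rho> \<union> rows n r. b \<times> b"
  have sub: "?U \<subseteq> ({1..n} \<times> {1..r}) \<times> ({1..n} \<times> {1..r})"
  proof -
    have "b \<subseteq> {1..n} \<times> {1..r}" if "b \<in> \<rho> \<union> rows n r" for b
      using that \<rho> by (auto simp: partition_on_def rows_def)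
    then show ?thesis by blast
  qed
  have "links n r \<rho> \<subseteq> ({1..n} \<times> {1..r}) \<times> ({1..n} \<times> {1..r})"
    unfolding links_def using trancl_subset_Sigma[OF sub] .
  moreover have "sym ?U" by (auto simp: sym_def)
  then have "sym (links n r \<rho>)" unfolding links_def by (rule sym_trancl)
  moreover have "trans (links n r \<rho>)" unfolding links_def by (rule trans_trancl)
  moreover have "(p, p) \<in> links n r \<rho>" if "p \<in> {1..n} \<times> {1..r}" for p
    using that unfolding links_def rows_def by (intro r_into_trancl) auto
  ultimately show ?thesis by (auto simp: equiv_def refl_on_def)
qed

text \<open>The cells of a row are linked among themselves through \<open>rows n r\<close>, so the
  first column, which exists by \<open>r \<ge> 1\<close>, represents all of them.\<close>

lemma partition_join_full_iff:
  assumes \<rho>: "partition_on ({1..n} \<times> {1..r}) \<rho>" and nr: "n \<ge> 1" "r \<ge> 1"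
  shows "partition_join ({1..n} \<times> {1..r}) \<rho> (rows n r) = {{1..n} \<times> {1..r}} \<longleftrightarrow>
    (\<forall>i\<in>{1..n}. \<forall>i'\<in>{1..n}. ((i, 1), (i', 1)) \<in> links n r \<rho>)"
    (is "?J = _ \<longleftrightarrow> _")
proof -
  let ?V = "{1..n} \<times> {1..r}"
  have eq: "equiv ?V (links n r \<rho>)" by (rule equiv_links[OF \<rho>])
  have J: "?J = ?V // links n r \<rho>" by (simp add: partition_join_def links_def)
  have row: "((i, j), (i, j')) \<in> links n r \<rho>" if "i \<in> {1..n}" "j \<in> {1..r}" "j' \<in> {1..r}" for i j j'
    using that unfolding links_def rows_def by (intro r_into_trancl) auto
  have tr: "(a, c) \<in> links n r \<rho>" if "(a, b) \<in> links n r \<rho>" "(b, c) \<in> links n r \<rho>" for a b c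
    using that unfolding links_def by (rule trancl_trans)
  show ?thesis
  proof
    assume "?J = {?V}"
    then have "?V // links n r \<rho> = {?V}" using J by simp
    then have all: "(p, q) \<in> links n r \<rho>" if "p \<in> ?V" "q \<in> ?V" for p q
    proof -
      have "links n r \<rho> `` {p} \<in> ?V // links n r \<rho>" using that by (intro quotientI)
      then have "links n r \<rho> `` {p} = ?V" using \<open>?V // links n r \<rho> = {?V}\<close> by auto
      then show ?thesis using that by auto
    qed
    then show "\<forall>i\<in>{1..n}. \<forall>i'\<in>{1..n}. ((i, 1), (i', 1)) \<in> links n r \<rho>"
      using nr by auto
  next
    assume c: "\<forall>i\<in>{1..n}. \<forall>i'\<in>{1..n}. ((i, 1), (i', 1)) \<in> links n r \<rho>"
    have all: "((i, j), (i', j')) \<in> links n r \<rho>"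
      if "i \<in> {1..n}" "i' \<in> {1..n}" "j \<in> {1..r}" "j' \<in> {1..r}" for i i' j j'
    proof -
      have one: "1 \<in> {1..r}" using nr by simp
      show ?thesis
        using tr[OF tr[OF row[OF that(1,3) one] c[rule_format, OF that(1,2)]] row[OF that(2) one that(4)]] .
    qed
    have "links n r \<rho> \<subseteq> ?V \<times> ?V" using eq by (simp add: equiv_def refl_on_def)
    then have "links n r \<rho> `` {p} = ?V" if "p \<in> ?V" for p
      using that all by (cases p) blast
    then have "?V // links n r \<rho> = (\<Union>p\<in>?V. {?V})"
      unfolding quotient_def by simp
    moreover have "?V \<noteq> {}" using nr by auto
    ultimately show "?J = {?V}" using J by simp
  qed
qed

text \<open>Call two rows equivalent if their cells are linked. The blocks of \<rho> respect a row
  partition \<open>P\<close> iff \<open>P\<close> is coarser than the partition \<sigma> into these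
  classes, so the sum runs over the coarsenings of \<sigma>. It is 1 iff there is a single class,
  that is, iff \<rho> is connected.\<close>

lemma sum_moebius_weight_respecting:
  assumes \<rho>: "partition_on ({1..n} \<times> {1..r}) \<rho>" and nr: "n \<ge> 1" "r \<ge> 1"
  shows "(\<Sum>P | partition_on {1..n} P \<and> (\<forall>b\<in>\<rho>. \<exists>B\<in>P. fst ` b \<subseteq> B). moebius_weight (card P)) =
    (if partition_join ({1..n} \<times> {1..r}) \<rho> (rows n r) = {{1..n} \<times> {1..r}} then 1 else 0)"
proof -
  let ?V = "{1..n} \<times> {1..r}"
  let ?L = "links n r \<rho>"
  have eq: "equiv ?V ?L" by (rule equiv_links[OF \<rho>])
  have row: "((i, j), (i, j')) \<in> ?L" if "i \<in> {1..n}" "j \<in> {1..r}" "j' \<in> {1..r}" for i j j'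
    using that unfolding links_def rows_def by (intro r_into_trancl) auto
  have tr: "(a, c) \<in> ?L" if "(a, b) \<in> ?L" "(b, c) \<in> ?L" for a b c
    using that unfolding links_def by (rule trancl_trans)
  have one: "1 \<in> {1..r}" using nr by simp
  define S where "S = {(i, i'). i \<in> {1..n} \<and> i' \<in> {1..n} \<and> ((i, 1), (i', 1)) \<in> ?L}"
  have S: "equiv {1..n} S"
  proof (rule equivI)
    show "S \<subseteq> {1..n} \<times> {1..n}" by (auto simp: S_def)
    show "refl_on {1..n} S" using row[OF _ one one] by (auto simp: S_def refl_on_def)
    have "sym ?L" using eq by (simp add: equiv_def)
    then show "sym S" unfolding sym_def S_def by blast
    show "trans S" unfolding S_def by (rule transI) (use tr in blast)
  qed
  define \<sigma> where "\<sigma> = {1..n} // S"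
  have \<sigma>: "partition_on {1..n} \<sigma>" unfolding \<sigma>_def by (rule partition_on_quotient[OF S])
  have resp: "(\<forall>b\<in>\<rho>. \<exists>B\<in>P. fst ` b \<subseteq> B) \<longleftrightarrow> (\<forall>s\<in>\<sigma>. \<exists>B\<in>P. s \<subseteq> B)" if P: "partition_on {1..n} P" for P
  proof
    assume c: "\<forall>b\<in>\<rho>. \<exists>B\<in>P. fst ` b \<subseteq> B"
    \<comment> \<open>Along a chain of links the row stays in one member of \<open>P\<close>: for a
      step inside a block of \<rho> by assumption, for a step inside a row because the row does not
      change.\<close>
    have "\<exists>B\<in>P. fst p \<in> B \<and> fst q \<in> B" if "(p, q) \<in> ?L" for p q
      using that unfolding links_def
    proof (induction rule: trancl_induct)
      case (base q)
      then obtain b where b: "b \<in> \<rho> \<union> rows n r" "p \<in> b" "q \<in> b" by auto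
      show ?case
      proof (cases "b \<in> \<rho>")
        case True
        then obtain B where B: "B \<in> P" "fst ` b \<subseteq> B" using c by auto
        show ?thesis by (rule bexI[OF _ B(1)]) (use B(2) b(2,3) in blast)
      next
        case False
        then have "fst p = fst q" "fst p \<in> {1..n}" using b by (auto simp: rows_def)
        then show ?thesis using P by (auto simp: partition_on_def)
      qed
    next
      case (step q q')
      then obtain B where B: "B \<in> P" "fst p \<in> B" "fst q \<in> B" by auto
      from step obtain b where b: "b \<in> \<rho> \<union> rows n r" "q \<in> b" "q' \<in> b" by auto
      have "\<exists>C\<in>P. fst q \<in> C \<and> fst q' \<in> C"
      proof (cases "b \<in> \<rho>")
        case True
        then obtain C where C: "C \<in> P" "fst ` b \<subseteq> C" using c by auto
        show ?thesis by (rule bexI[OF _ C(1)]) (use C(2) b(2,3) in blast)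
      next
        case False
        then have "fst q = fst q'" using b by (auto simp: rows_def)
        then show ?thesis using B by auto
      qed
      then obtain C where C: "C \<in> P" "fst q \<in> C" "fst q' \<in> C" by auto
      then have "B = C" using B partition_on_eqI[OF P] by auto
      then show ?case using B C by auto
    qed
    then have L: "\<exists>B\<in>P. i \<in> B \<and> i' \<in> B" if "(i, i') \<in> S" for i i'
      using that by (fastforce simp: S_def)
    show "\<forall>s\<in>\<sigma>. \<exists>B\<in>P. s \<subseteq> B"
    proof
      fix s assume "s \<in> \<sigma>"
      then obtain i where i: "i \<in> {1..n}" "s = S `` {i}" by (auto simp: \<sigma>_def quotient_def)
      have "i \<in> \<Union>P" using P i(1) by (simp add: partition_on_def)
      then obtain B where B: "B \<in> P" "i \<in> B" by auto
      have "i' \<in> B" if "i' \<in> s" for i'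
        using L[of i i'] that i B partition_on_eqI[OF P] by auto
      then show "\<exists>B\<in>P. s \<subseteq> B" using B by auto
    qed
  next
    assume c: "\<forall>s\<in>\<sigma>. \<exists>B\<in>P. s \<subseteq> B"
    show "\<forall>b\<in>\<rho>. \<exists>B\<in>P. fst ` b \<subseteq> B"
    proof
      fix b assume b: "b \<in> \<rho>"
      then have bV: "b \<subseteq> ?V" "b \<noteq> {}" using \<rho> by (auto simp: partition_on_def)
      then obtain i j where ij1: "(i, j) \<in> b" by fast
      then have "(i, j) \<in> ?V" using bV(1) by (rule subsetD[rotated])
      with ij1 have ij: "(i, j) \<in> b" "i \<in> {1..n}" "j \<in> {1..r}" by simp_all
      have "S `` {i} \<in> \<sigma>" using ij by (auto simp: \<sigma>_def intro: quotientI)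
      then obtain B where B: "B \<in> P" "S `` {i} \<subseteq> B" using c by auto
      have "(i, i') \<in> S" if "(i', j') \<in> b" for i' j'
      proof -
        have "(i', j') \<in> ?V" using that bV(1) by (rule subsetD[rotated])
        then have m: "i' \<in> {1..n}" "j' \<in> {1..r}" by simp_all
        have "((i, j), (i', j')) \<in> ?L" unfolding links_def using b ij that by (intro r_into_trancl) auto
        then show ?thesis
          using tr[OF tr[OF row[OF ij(2) one ij(3)]] row[OF m one]] m ij by (auto simp: S_def)
      qed
      then have "fst ` b \<subseteq> B" using B by auto
      then show "\<exists>B\<in>P. fst ` b \<subseteq> B" using B by auto
    qed
  qed
  have "card \<sigma> = 1 \<longleftrightarrow> (\<forall>i\<in>{1..n}. \<forall>i'\<in>{1..n}. ((i, 1), (i', 1)) \<in> ?L)"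
  proof
    assume "card \<sigma> = 1"
    then obtain s where "\<sigma> = {s}" by (auto simp: card_1_singleton_iff)
    then have "s = {1..n}" using \<sigma> by (auto simp: partition_on_def)
    have "((i, 1), (i', 1)) \<in> ?L" if "i \<in> {1..n}" "i' \<in> {1..n}" for i i'
    proof -
      have "S `` {i} \<in> \<sigma>" using that by (auto simp: \<sigma>_def intro: quotientI)
      then have "i' \<in> S `` {i}" using \<open>\<sigma> = {s}\<close> \<open>s = _\<close> that by auto
      then show ?thesis by (auto simp: S_def)
    qed
    then show "\<forall>i\<in>{1..n}. \<forall>i'\<in>{1..n}. ((i, 1), (i', 1)) \<in> ?L" by auto
  next
    assume "\<forall>i\<in>{1..n}. \<forall>i'\<in>{1..n}. ((i, 1), (i', 1)) \<in> ?L"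
    then have "S `` {i} = {1..n}" if "i \<in> {1..n}" for i using that by (auto simp: S_def)
    then have "\<sigma> = {{1..n}}" using nr by (auto simp: \<sigma>_def quotient_def)
    then show "card \<sigma> = 1" by simp
  qed
  then show ?thesis
    using sum_moebius_weight_coarser[OF _ _ \<sigma>] nr resp partition_join_full_iff[OF \<rho> nr]
    by (simp cong: conj_cong)
qed

lemma CNF_eq: "CNF n r = {\<rho> \<in> NF r {1..n}.
  partition_join ({1..n} \<times> {1..r}) \<rho> (rows n r) = {{1..n} \<times> {1..r}}}"
proof -
  have "(\<forall>b\<in>\<rho>. \<forall>p\<in>rows n r. card (b \<inter> p) \<le> 1) \<longleftrightarrow> (\<forall>b\<in>\<rho>. inj_on fst b)"
    if \<rho>: "partition_on ({1..n} \<times> {1..r}) \<rho>" for \<rho>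
  proof (intro ball_cong refl)
    fix b assume b: "b \<in> \<rho>"
    then have bV: "b \<subseteq> {1..n} \<times> {1..r}" using \<rho> by (auto simp: partition_on_def)
    then have fin: "finite b" by (rule finite_subset) auto
    show "(\<forall>p\<in>rows n r. card (b \<inter> p) \<le> 1) \<longleftrightarrow> inj_on fst b"
    proof
      assume c: "\<forall>p\<in>rows n r. card (b \<inter> p) \<le> 1"
      show "inj_on fst b"
      proof (rule inj_onI)
        fix p q assume pq: "p \<in> b" "q \<in> b" "fst p = fst q"
        let ?p = "{fst p} \<times> {1..r}"
        have "?p \<in> rows n r" using pq bV by (auto simp: rows_def)
        then have "card (b \<inter> ?p) \<le> 1" using c by blast
        moreover have "p \<in> b \<inter> ?p" "q \<in> b \<inter> ?p" using pq bV by (auto simp: mem_Times_iff)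
        ultimately show "p = q" using fin card_le_Suc0_iff_eq[of "b \<inter> ?p"] by auto
      qed
    next
      assume i: "inj_on fst b"
      show "\<forall>p\<in>rows n r. card (b \<inter> p) \<le> 1"
      proof
        fix p assume "p \<in> rows n r"
        then obtain i where "p = {i} \<times> {1..r}" by (auto simp: rows_def)
        then have "x = y" if "x \<in> b \<inter> p" "y \<in> b \<inter> p" for x y
          using that inj_onD[OF i, of x y] by auto
        then show "card (b \<inter> p) \<le> 1" using fin card_le_Suc0_iff_eq[of "b \<inter> p"] by auto
      qed
    qed
  qed
  then show ?thesis by (auto simp: CNF_def NF_def)
qed

text \<open>Expanding the products of moments turns the cumulant into a sum over non-flat partitions, in
  which the weights of the row partitions cancel unless the non-flat partition is connected.\<close>

lemma moments_to_cumulant: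
  fixes w :: "(nat \<times> nat) set set \<Rightarrow> real"
  assumes nr: "n \<ge> 1" "r \<ge> 1"
    and mult: "\<And>P f. partition_on {1..n} P \<Longrightarrow> f \<in> Pi\<^sub>E P (NF r) \<Longrightarrow> w (\<Union>B\<in>P. f B) = (\<Prod>B\<in>P. w (f B))"
  shows "(\<Sum>P | partition_on {1..n} P. moebius_weight (card P) * (\<Prod>B\<in>P. \<Sum>\<rho>\<in>NF r B. w \<rho>)) =
    (\<Sum>\<rho>\<in>CNF n r. w \<rho>)"
proof -
  have "(\<Sum>P | partition_on {1..n} P. moebius_weight (card P) * (\<Prod>B\<in>P. \<Sum>\<rho>\<in>NF r B. w \<rho>)) =
    (\<Sum>P | partition_on {1..n} P. \<Sum>\<rho>\<in>NF r {1..n}.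
       if \<forall>b\<in>\<rho>. \<exists>B\<in>P. fst ` b \<subseteq> B then moebius_weight (card P) * w \<rho> else 0)"
  proof (intro sum.cong refl)
    fix P assume "P \<in> {P. partition_on {1..n} P}"
    then have P: "partition_on {1..n} P" by simp
    have fin: "finite P" using finite_elements[OF _ P] by simp
    have finB: "finite B" if "B \<in> P" for B
      using that P by (intro finite_subset[of B "{1..n}"]) (auto simp: partition_on_def)
    \<comment> \<open>A choice of one non-flat partition for each block of \<open>P\<close> glues to
      one non-flat partition of all rows, whose weight is the product of the chosen weights by
      \<open>mult\<close>.\<close>
    have "(\<Prod>B\<in>P. \<Sum>\<rho>\<in>NF r B. w \<rho>) = (\<Sum>f\<in>Pi\<^sub>E P (NF r). \<Prod>B\<in>P. w (f B))"
      using fin finite_NF[OF finB] by (subst prod_sum_PiE) auto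
    also have "\<dots> = (\<Sum>f\<in>Pi\<^sub>E P (NF r). w (\<Union>B\<in>P. f B))"
      using mult[OF P] by simp
    also have "\<dots> = (\<Sum>\<rho> | \<rho> \<in> NF r {1..n} \<and> (\<forall>b\<in>\<rho>. \<exists>B\<in>P. fst ` b \<subseteq> B). w \<rho>)"
      by (rule sum.reindex_bij_betw[OF bij_betw_NF_Union[OF P]])
    finally have "(\<Prod>B\<in>P. \<Sum>\<rho>\<in>NF r B. w \<rho>) =
      (\<Sum>\<rho> | \<rho> \<in> NF r {1..n} \<and> (\<forall>b\<in>\<rho>. \<exists>B\<in>P. fst ` b \<subseteq> B). w \<rho>)" .
    then show "moebius_weight (card P) * (\<Prod>B\<in>P. \<Sum>\<rho>\<in>NF r B. w \<rho>) = (\<Sum>\<rho>\<in>NF r {1..n}.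
       if \<forall>b\<in>\<rho>. \<exists>B\<in>P. fst ` b \<subseteq> B then moebius_weight (card P) * w \<rho> else 0)"
      by (simp add: sum_distrib_left sum.inter_filter finite_NF if_distrib[of "\<lambda>x. moebius_weight (card P) * x"] cong: if_cong)
  qed
  also have "\<dots> = (\<Sum>\<rho>\<in>NF r {1..n}. \<Sum>P | partition_on {1..n} P.
       if \<forall>b\<in>\<rho>. \<exists>B\<in>P. fst ` b \<subseteq> B then moebius_weight (card P) * w \<rho> else 0)"
    by (rule sum.swap)
  also have "\<dots> = (\<Sum>\<rho>\<in>NF r {1..n}. w \<rho> *
     (\<Sum>P | partition_on {1..n} P \<and> (\<forall>b\<in>\<rho>. \<exists>B\<in>P. fst ` b \<subseteq> B). moebius_weight (card P)))"
  proof (intro sum.cong refl)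
    fix \<rho>
    have fin: "finite {P. partition_on {1..n} P}" by (simp add: finitely_many_partition_on)
    show "(\<Sum>P | partition_on {1..n} P.
       if \<forall>b\<in>\<rho>. \<exists>B\<in>P. fst ` b \<subseteq> B then moebius_weight (card P) * w \<rho> else 0) = w \<rho> *
     (\<Sum>P | partition_on {1..n} P \<and> (\<forall>b\<in>\<rho>. \<exists>B\<in>P. fst ` b \<subseteq> B). moebius_weight (card P))"
      using sum.inter_filter[OF fin, of "\<lambda>P. moebius_weight (card P) * w \<rho>" "\<lambda>P. \<forall>b\<in>\<rho>. \<exists>B\<in>P. fst ` b \<subseteq> B"]
      by (simp add: sum_distrib_left mult.commute)
  qed
  also have "\<dots> = (\<Sum>\<rho>\<in>NF r {1..n}. if partition_join ({1..n} \<times> {1..r}) \<rho> (rows n r) = {{1..n} \<times> {1..r}} then w \<rho> else 0)"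
  proof (intro sum.cong refl)
    fix \<rho> assume "\<rho> \<in> NF r {1..n}"
    then have "partition_on ({1..n} \<times> {1..r}) \<rho>" by (simp add: NF_def)
    from sum_moebius_weight_respecting[OF this nr]
    show "w \<rho> * (\<Sum>P | partition_on {1..n} P \<and> (\<forall>b\<in>\<rho>. \<exists>B\<in>P. fst ` b \<subseteq> B). moebius_weight (card P)) =
      (if partition_join ({1..n} \<times> {1..r}) \<rho> (rows n r) = {{1..n} \<times> {1..r}} then w \<rho> else 0)"
      by (simp only:) simp
  qed
  also have "\<dots> = (\<Sum>\<rho>\<in>CNF n r. w \<rho>)"
    unfolding CNF_eq by (rule sum.inter_filter[symmetric]) (simp add: finite_NF)
  finally show ?thesis .
qed

section \<open>Factorial moments of a Poisson process\<close>

text \<open>Values are chosen one index at a time. For \<open>j\<close> only those elements of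
  \<open>K (T j)\<close> are forbidden that other indices of the same class use, since the sets
  \<open>K c\<close> are disjoint; this gives one falling factorial per class. Truncated subtraction
  makes it 0 when a class has too few elements.\<close>

lemma card_inj_PiE_disjoint:
  assumes J: "finite J" and C: "finite C" "T ` J \<subseteq> C"
    and K: "\<And>c. c \<in> C \<Longrightarrow> finite (K c)" "disjoint_family_on K C"
  shows "finite {\<beta> \<in> J \<rightarrow>\<^sub>E UNIV. inj_on \<beta> J \<and> (\<forall>j\<in>J. \<beta> j \<in> K (T j))} \<and>
    card {\<beta> \<in> J \<rightarrow>\<^sub>E UNIV. inj_on \<beta> J \<and> (\<forall>j\<in>J. \<beta> j \<in> K (T j))} =
    (\<Prod>c\<in>C. \<Prod>i<card {j \<in> J. T j = c}. card (K c) - i)"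
  using J C(2)
proof (induction J)
  case empty
  have "{\<beta> \<in> {} \<rightarrow>\<^sub>E UNIV. inj_on \<beta> {} \<and> (\<forall>j\<in>{}. \<beta> j \<in> K (T j))} = {\<lambda>_. undefined}"
    by auto
  then show ?case by simp
next
  case (insert j J)
  define S where "S J = {\<beta> \<in> J \<rightarrow>\<^sub>E UNIV. inj_on \<beta> J \<and> (\<forall>j\<in>J. \<beta> j \<in> K (T j))}" for J
  let ?c = "T j"
  have c: "?c \<in> C" and TJ: "T ` J \<subseteq> C" using insert.prems by auto
  have IH: "finite (S J)" "card (S J) = (\<Prod>c\<in>C. \<Prod>i<card {j \<in> J. T j = c}. card (K c) - i)"
    using insert.IH[OF TJ] by (simp_all add: S_def)
  have S: "S (insert j J) = (\<lambda>(g, k). g(j := k)) ` (SIGMA g:S J. K ?c - g ` J)"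
  proof (intro set_eqI iffI)
    fix \<beta> assume \<beta>: "\<beta> \<in> S (insert j J)"
    have "restrict \<beta> J \<in> S J" using \<beta> by (auto simp: S_def inj_on_def)
    moreover have "\<beta> j \<in> K ?c - restrict \<beta> J ` J"
      using \<beta> insert.hyps by (auto simp: S_def inj_on_def)
    moreover have "\<beta> = (restrict \<beta> J)(j := \<beta> j)"
      using \<beta> by (auto simp: S_def PiE_iff extensional_def fun_eq_iff)
    ultimately show "\<beta> \<in> (\<lambda>(g, k). g(j := k)) ` (SIGMA g:S J. K ?c - g ` J)"
      by (intro image_eqI[of _ _ "(restrict \<beta> J, \<beta> j)"]) auto
  next
    fix \<beta> assume "\<beta> \<in> (\<lambda>(g, k). g(j := k)) ` (SIGMA g:S J. K ?c - g ` J)"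
    then obtain g k where g: "g \<in> S J" "k \<in> K ?c" "k \<notin> g ` J" "\<beta> = g(j := k)" by auto
    have "inj_on \<beta> (insert j J)"
      using g insert.hyps by (auto simp: S_def inj_on_def)
    moreover have "\<beta> \<in> insert j J \<rightarrow>\<^sub>E UNIV"
      using g by (auto simp: S_def PiE_iff extensional_def)
    ultimately show "\<beta> \<in> S (insert j J)"
      using g insert.hyps by (auto simp: S_def)
  qed
  have inj: "inj_on (\<lambda>(g, k). g(j := k)) (SIGMA g:S J. K ?c - g ` J)"
  proof (rule inj_onI, clarify)
    fix g k g' k' assume g: "g \<in> S J" "g' \<in> S J" and eq: "g(j := k) = g'(j := k')"
    have "g i = g' i" for i
      using fun_cong[OF eq, of i] g insert.hyps by (cases "i = j") (auto simp: S_def PiE_iff extensional_def)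
    then show "g = g' \<and> k = k'" using fun_cong[OF eq, of j] by auto
  qed
  have ck: "card (K ?c - g ` J) = card (K ?c) - card {i \<in> J. T i = ?c}" if g: "g \<in> S J" for g
  proof -
    have "K ?c \<inter> g ` J = g ` {i \<in> J. T i = ?c}"
    proof -
      have "T i = ?c" if "i \<in> J" "g i \<in> K ?c" for i
      proof (rule ccontr)
        assume "T i \<noteq> ?c"
        then have "K (T i) \<inter> K ?c = {}"
          using K(2) c TJ that(1) by (intro disjoint_family_onD[OF K(2)]) auto
        then show False using that g by (auto simp: S_def)
      qed
      then show ?thesis using g by (auto simp: S_def)
    qed
    moreover have "inj_on g {i \<in> J. T i = ?c}" using g by (auto simp: S_def inj_on_def)
    ultimately show ?thesis
      using K(1)[OF c] by (subst card_Diff_subset_Int) (auto simp: card_image insert.hyps(1))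
  qed
  have fin: "finite (S (insert j J))"
    unfolding S using IH(1) K(1)[OF c] by auto
  have "card (S (insert j J)) = (\<Sum>g\<in>S J. card (K ?c) - card {i \<in> J. T i = ?c})"
    unfolding S using IH(1) K(1)[OF c] ck by (simp add: card_image[OF inj] card_SigmaI)
  also have "\<dots> = (\<Prod>c\<in>C. \<Prod>i<card {j \<in> J. T j = c}. card (K c) - i) * (card (K ?c) - card {i \<in> J. T i = ?c})"
    by (simp add: IH)
  also have "\<dots> = (\<Prod>c\<in>C. \<Prod>i<card {i \<in> insert j J. T i = c}. card (K c) - i)"
  proof -
    have 1: "{i \<in> insert j J. T i = ?c} = insert j {i \<in> J. T i = ?c}" by auto
    have 2: "{i \<in> insert j J. T i = c} = {i \<in> J. T i = c}" if "c \<noteq> ?c" for c using that by auto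
    have "(\<Prod>c\<in>C. \<Prod>i<card {i \<in> insert j J. T i = c}. card (K c) - i) =
      (\<Prod>i<card {i \<in> insert j J. T i = ?c}. card (K ?c) - i) *
      (\<Prod>c\<in>C - {?c}. \<Prod>i<card {i \<in> J. T i = c}. card (K c) - i)"
      by (subst prod.remove[OF C(1) c], intro arg_cong2[where f = "(*)"] refl prod.cong) (subst 2, auto)
    also have "(\<Prod>i<card {i \<in> insert j J. T i = ?c}. card (K ?c) - i) =
      (\<Prod>i<card {i \<in> J. T i = ?c}. card (K ?c) - i) * (card (K ?c) - card {i \<in> J. T i = ?c})"
      unfolding 1 using insert.hyps by simp
    finally show ?thesis by (simp add: prod.remove[OF C(1) c] mult_ac)
  qed
  finally show ?case using fin by (simp add: S_def)
qed

text \<open>Falling factorial on \<open>ennreal\<close>. Subtraction is truncated there too, so it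
  vanishes at a natural number smaller than \<open>k\<close>.\<close>

definition ffact :: "ennreal \<Rightarrow> nat \<Rightarrow> ennreal" where
  "ffact x k = (\<Prod>i<k. x - of_nat i)"

lemma measurable_ffact[measurable]: "(\<lambda>x. ffact x k) \<in> borel_measurable borel"
  unfolding ffact_def by measurable

lemma ffact_of_nat: "ffact (of_nat m) k = of_nat (\<Prod>i<k. m - i)"
proof -
  have "(of_nat m - of_nat i :: ennreal) = of_nat (m - i)" for i
  proof (cases "i \<le> m")
    case True
    then have "(of_nat m :: ennreal) = of_nat (m - i) + of_nat i"
      by (simp flip: of_nat_add)
    then show ?thesis by simp
  next
    case False
    then have "(of_nat m :: ennreal) \<le> of_nat i" by simp
    then show ?thesis using False by (simp add: diff_eq_0_iff_ennreal of_nat_less_top)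
  qed
  then show ?thesis by (simp add: ffact_def)
qed

section \<open>Campbell's formula from the laws of the counts\<close>

locale poisson_points = prob_space M
  for M :: "'w measure" +
  fixes \<tau> :: "'w \<Rightarrow> enat" and X :: "nat \<Rightarrow> 'w \<Rightarrow> 'a::topological_space" and \<nu> :: "'a measure"
  assumes sets_\<nu>: "sets \<nu> = sets borel" and sigma_finite_\<nu>: "sigma_finite_measure \<nu>"
    and measurable_\<tau>[measurable]: "\<tau> \<in> measurable M (count_space UNIV)"
    and measurable_X[measurable]: "\<And>i. X i \<in> borel_measurable M"
    and poisson: "poisson_process M \<nu> (point_process \<tau> X)"
begin

abbreviation N :: "'a set \<Rightarrow> 'w \<Rightarrow> ennreal" where
  "N B \<omega> \<equiv> emeasure (point_process \<tau> X \<omega>) B"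

lemma measurable_N: "B \<in> sets borel \<Longrightarrow> N B \<in> borel_measurable M"
  using poisson by (simp add: poisson_process_def sets_\<nu>)

lemma N_eq: "B \<in> sets borel \<Longrightarrow> N B \<omega> = emeasure (count_space UNIV) {i \<in> point_indices (\<tau> \<omega>). X i \<omega> \<in> B}"
proof -
  assume B: "B \<in> sets borel"
  let ?I = "point_indices (\<tau> \<omega>)"
  have "N B \<omega> = emeasure (count_space ?I) {i \<in> ?I. X i \<omega> \<in> B}"
    unfolding point_process_def using B
    by (subst emeasure_distr) (auto intro!: arg_cong[where f = "emeasure (count_space ?I)"])
  also have "\<dots> = emeasure (count_space UNIV) {i \<in> ?I. X i \<omega> \<in> B}"
    by (subst (1 2) emeasure_count_space) auto
  finally show ?thesis .
qed

text \<open>The Poisson probabilities sum to 1, so the count is almost surely a natural number. In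
  the factorial moment the falling factorial of \<open>j\<close> cancels against
  \<open>fact j\<close>, and the exponential series shifted by \<open>k\<close> leaves
  \<open>v ^ k\<close>.\<close>

lemma
  assumes B: "B \<in> sets borel" "emeasure \<nu> B < \<infinity>"
  shows AE_N_finite: "AE \<omega> in M. \<exists>k::nat. N B \<omega> = of_nat k"
    and nn_integral_ffact_N: "(\<integral>\<^sup>+\<omega>. ffact (N B \<omega>) k \<partial>M) = emeasure \<nu> B ^ k"
proof -
  define v where "v = measure \<nu> B"
  note [measurable] = measurable_N[OF B(1)]
  have v: "emeasure \<nu> B = ennreal v" "v \<ge> 0"
    using B(2) by (simp_all add: v_def emeasure_eq_ennreal_measure)
  define D where "D j = {\<omega> \<in> space M. N B \<omega> = of_nat j}" for j :: nat
  have D[measurable]: "D j \<in> sets M" for j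
    unfolding D_def by measurable
  have pD: "emeasure M (D j) = ennreal (exp (- v) * v ^ j / fact j)" for j
    using poisson B by (simp add: poisson_process_def sets_\<nu> D_def emeasure_eq_measure v_def)
  have disj: "disjoint_family D" by (auto simp: disjoint_family_on_def D_def)
  have exps: "(\<lambda>j. exp (- v) * v ^ j / fact j) sums 1"
  proof -
    have "(\<lambda>j. exp (- v) * (v ^ j /\<^sub>R fact j)) sums (exp (- v) * exp v)"
      by (intro sums_mult exp_converges)
    then show ?thesis by (simp add: exp_minus field_simps)
  qed
  have "emeasure M (\<Union>j. D j) = (\<Sum>j. ennreal (exp (- v) * v ^ j / fact j))"
    using suminf_emeasure[of D M] disj D by (simp add: pD image_subset_iff)
  also have "\<dots> = 1"
    using v(2) exps by (subst suminf_ennreal_eq[OF _ exps]) auto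
  finally have one: "emeasure M (\<Union>j. D j) = 1" .
  have "AE \<omega> in M. \<omega> \<in> (\<Union>j. D j)"
    using one by (subst AE_in_set_eq_1) (auto simp: emeasure_eq_measure)
  then show AE: "AE \<omega> in M. \<exists>k::nat. N B \<omega> = of_nat k"
    by eventually_elim (auto simp: D_def)
  have "(\<integral>\<^sup>+\<omega>. ffact (N B \<omega>) k \<partial>M) = (\<integral>\<^sup>+\<omega>. (\<Sum>j. ffact (of_nat j) k * indicator (D j) \<omega>) \<partial>M)"
  proof (intro nn_integral_cong_AE)
    show "AE \<omega> in M. ffact (N B \<omega>) k = (\<Sum>j. ffact (of_nat j) k * indicator (D j) \<omega>)"
      using AE AE_space
    proof eventually_elim
      case (elim \<omega>)
      then obtain l :: nat where l: "N B \<omega> = of_nat l" by auto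
      have "(\<Sum>j. ffact (of_nat j) k * indicator (D j) \<omega>) = (\<Sum>j\<in>{l}. ffact (of_nat j) k * indicator (D j) \<omega>)"
        by (rule suminf_finite) (auto simp: D_def l indicator_def)
      also have "\<dots> = ffact (N B \<omega>) k" using elim l by (simp add: D_def)
      finally show ?case by simp
    qed
  qed
  also have "\<dots> = (\<Sum>j. ffact (of_nat j) k * ennreal (exp (- v) * v ^ j / fact j))"
    by (subst nn_integral_suminf) (auto simp: nn_integral_cmult_indicator pD)
  also have "\<dots> = (\<Sum>j. ennreal (real (\<Prod>i<k. j - i) * (exp (- v) * v ^ j / fact j)))"
  proof -
    have "ffact (of_nat j) k * ennreal q = ennreal (real (\<Prod>i<k. j - i) * q)" for j q
      by (subst ffact_of_nat) (simp add: ennreal_mult' ennreal_of_nat_eq_real_of_nat del: of_nat_prod)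
    then show ?thesis by (simp only:)
  qed
  also have "\<dots> = ennreal (v ^ k)"
  proof (rule suminf_ennreal_eq)
    show "0 \<le> real (\<Prod>i<k. j - i) * (exp (- v) * v ^ j / fact j)" for j
      using v(2) by (intro mult_nonneg_nonneg divide_nonneg_nonneg) (auto intro!: prod_nonneg)
    have shift: "real (\<Prod>i<k. (j + k) - i) / fact (j + k) = 1 / fact j" for j
    proof (induction k)
      case (Suc k)
      have "(\<Prod>i<Suc k. (j + Suc k) - i) = (j + Suc k) * (\<Prod>i<k. (j + Suc k) - Suc i)"
        by (subst prod.lessThan_Suc_shift) simp
      then have "real (\<Prod>i<Suc k. (j + Suc k) - i) / fact (j + Suc k) =
        real (\<Prod>i<k. (j + k) - i) / fact (j + k)" 
        by (simp only: of_nat_mult add_Suc_right fact_Suc of_nat_fact) (simp del: of_nat_prod of_nat_Suc)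
      with Suc show ?case by simp
    qed simp
    have "(\<lambda>j. v ^ k * (exp (- v) * v ^ j / fact j)) sums (v ^ k * 1)"
      by (intro sums_mult exps)
    also have "(\<lambda>j. v ^ k * (exp (- v) * v ^ j / fact j)) =
      (\<lambda>j. real (\<Prod>i<k. (j + k) - i) * (exp (- v) * v ^ (j + k) / fact (j + k)))"
    proof
      fix j
      have "real (\<Prod>i<k. (j + k) - i) * (exp (- v) * v ^ (j + k) / fact (j + k)) =
        (real (\<Prod>i<k. (j + k) - i) / fact (j + k)) * (exp (- v) * v ^ (j + k))" by simp
      also have "\<dots> = v ^ k * (exp (- v) * v ^ j / fact j)"
        unfolding shift by (simp add: power_add)
      finally show "v ^ k * (exp (- v) * v ^ j / fact j) =
        real (\<Prod>i<k. (j + k) - i) * (exp (- v) * v ^ (j + k) / fact (j + k))" by simp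
    qed
    \<comment> \<open>The terms with \<open>j < k\<close> are 0 because the factor with
      \<open>i = j\<close> is, so the shifted series has the same sum as the full one.\<close>
    finally show "(\<lambda>j. real (\<Prod>i<k. j - i) * (exp (- v) * v ^ j / fact j)) sums (v ^ k)"
      by (subst (asm) sums_zero_iff_shift) (auto intro!: prod_zero)
  qed
  finally show "(\<integral>\<^sup>+\<omega>. ffact (N B \<omega>) k \<partial>M) = emeasure \<nu> B ^ k"
    using v by (simp add: ennreal_power)
qed

definition tuples :: "'j set \<Rightarrow> ('j \<Rightarrow> nat) \<Rightarrow> 'w set" where
  "tuples J \<beta> = {\<omega> \<in> space M. inj_on \<beta> J \<and> \<beta> ` J \<subseteq> point_indices (\<tau> \<omega>)}"

lemma sets_indices: "finite K \<Longrightarrow> {\<omega> \<in> space M. K \<subseteq> point_indices (\<tau> \<omega>)} \<in> sets M"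
proof -
  assume K: "finite K"
  have "{t. K \<subseteq> point_indices t} \<in> sets (count_space UNIV)" by simp
  from measurable_sets[OF measurable_\<tau> this] show ?thesis
    by (simp add: vimage_def Int_def conj_commute)
qed

lemma sets_tuples[measurable]: "finite J \<Longrightarrow> tuples J \<beta> \<in> sets M"
  using sets_indices[of "\<beta> ` J"] by (cases "inj_on \<beta> J") (auto simp: tuples_def)

text \<open>The factorial moment measure of order \<open>card J\<close>: the expected number of
  families of distinct indices whose points fall into a given set. Distinctness is that of the
  indices, not of the points.\<close>

definition factorial_moment :: "'j set \<Rightarrow> ('j \<Rightarrow> 'a) measure" where
  "factorial_moment J = distr
     (density (count_space (J \<rightarrow>\<^sub>E UNIV) \<Otimes>\<^sub>M M) (\<lambda>(\<beta>, \<omega>). indicator (tuples J \<beta>) \<omega>))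
     (PiM J (\<lambda>_. borel)) (\<lambda>(\<beta>, \<omega>). \<lambda>j\<in>J. X (\<beta> j) \<omega>)"

lemma nn_integral_factorial_moment:
  assumes J: "finite J" and f[measurable]: "f \<in> borel_measurable (PiM J (\<lambda>_. borel))"
  shows "integral\<^sup>N (factorial_moment J) f =
    (\<integral>\<^sup>+\<beta>. \<integral>\<^sup>+\<omega>. indicator (tuples J \<beta>) \<omega> * f (\<lambda>j\<in>J. X (\<beta> j) \<omega>) \<partial>M \<partial>count_space (J \<rightarrow>\<^sub>E UNIV))"
proof -
  have cnt: "countable (J \<rightarrow>\<^sub>E (UNIV :: nat set))" using J by (intro countable_PiE) auto
  have [measurable]: "(\<lambda>(\<beta>, \<omega>). indicator (tuples J \<beta>) \<omega> :: ennreal)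
    \<in> borel_measurable (count_space (J \<rightarrow>\<^sub>E (UNIV :: nat set)) \<Otimes>\<^sub>M M)"
    using J by (intro measurable_pair_measure_countable1[OF cnt]) auto
  have X: "(\<lambda>(\<beta>, \<omega>). \<lambda>j\<in>J. X (\<beta> j) \<omega>)
    \<in> measurable (count_space (J \<rightarrow>\<^sub>E (UNIV :: nat set)) \<Otimes>\<^sub>M M) (PiM J (\<lambda>_. borel))"
    by (intro measurable_pair_measure_countable1[OF cnt]) auto
  have X': "(\<lambda>(\<beta>, \<omega>). \<lambda>j\<in>J. X (\<beta> j) \<omega>) \<in> measurable
    (density (count_space (J \<rightarrow>\<^sub>E UNIV) \<Otimes>\<^sub>M M) (\<lambda>(\<beta>, \<omega>). indicator (tuples J \<beta>) \<omega>)) (PiM J (\<lambda>_. borel))"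
    using X by simp
  note [measurable] = X
  have "integral\<^sup>N (factorial_moment J) f = (\<integral>\<^sup>+p. f ((\<lambda>(\<beta>, \<omega>). \<lambda>j\<in>J. X (\<beta> j) \<omega>) p)
    \<partial>density (count_space (J \<rightarrow>\<^sub>E UNIV) \<Otimes>\<^sub>M M) (\<lambda>(\<beta>, \<omega>). indicator (tuples J \<beta>) \<omega>))"
    unfolding factorial_moment_def by (rule nn_integral_distr[OF X']) (use f in simp)
  also have "\<dots> = (\<integral>\<^sup>+p. (\<lambda>(\<beta>, \<omega>). indicator (tuples J \<beta>) \<omega>) p * f ((\<lambda>(\<beta>, \<omega>). \<lambda>j\<in>J. X (\<beta> j) \<omega>) p)
    \<partial>(count_space (J \<rightarrow>\<^sub>E UNIV) \<Otimes>\<^sub>M M))"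
    by (rule nn_integral_density) measurable
  also have "\<dots> = (\<integral>\<^sup>+\<beta>. \<integral>\<^sup>+\<omega>. indicator (tuples J \<beta>) \<omega> * f (\<lambda>j\<in>J. X (\<beta> j) \<omega>) \<partial>M \<partial>count_space (J \<rightarrow>\<^sub>E UNIV))"
    by (subst nn_integral_fst[symmetric]) (auto simp: case_prod_unfold intro!: borel_measurable_times_ennreal)
  finally show ?thesis .
qed

lemma sets_factorial_moment[simp]: "sets (factorial_moment J) = sets (PiM J (\<lambda>_. borel))"
  by (simp add: factorial_moment_def)

text \<open>For sides from a disjoint family the number of such index families is a product of
  falling factorials of the counts of the sets \<open>C i\<close>, the order \<open>cnt i\<close>
  being the number of sides with index \<open>i\<close>. Counts of disjoint sets are independent, so
  the expectation splits into Poisson factorial moments.\<close>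

lemma factorial_moment_disjoint:
  fixes k :: nat
  assumes J: "finite J" and T: "T ` J \<subseteq> {..<k}"
    and C: "\<And>i. i < k \<Longrightarrow> C i \<in> sets borel" "\<And>i. i < k \<Longrightarrow> emeasure \<nu> (C i) < \<infinity>"
    and disj: "disjoint_family_on C {..<k}"
  shows "emeasure (factorial_moment J) (Pi\<^sub>E J (\<lambda>j. C (T j))) = (\<Prod>j\<in>J. emeasure \<nu> (C (T j)))"
proof -
  let ?R = "Pi\<^sub>E J (\<lambda>j. C (T j))"
  let ?S = "J \<rightarrow>\<^sub>E (UNIV :: nat set)"
  define cnt where "cnt i = card {j \<in> J. T j = i}" for i
  have cS: "countable ?S" using J by (intro countable_PiE) auto
  have CT: "C (T j) \<in> sets borel" if "j \<in> J" for j
    using T C(1) that by auto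
  have R[measurable]: "?R \<in> sets (PiM J (\<lambda>_. borel))"
    using J CT by (intro sets_PiM_I_finite) auto
  have "emeasure (factorial_moment J) ?R = (\<integral>\<^sup>+x. indicator ?R x \<partial>factorial_moment J)"
    by simp
  also have "\<dots> = (\<integral>\<^sup>+\<beta>. \<integral>\<^sup>+\<omega>. indicator (tuples J \<beta>) \<omega> * indicator ?R (\<lambda>j\<in>J. X (\<beta> j) \<omega>) \<partial>M \<partial>count_space ?S)"
    using R by (intro nn_integral_factorial_moment[OF J]) auto
  also have "\<dots> = (\<integral>\<^sup>+\<omega>. \<integral>\<^sup>+\<beta>. indicator (tuples J \<beta>) \<omega> * indicator ?R (\<lambda>j\<in>J. X (\<beta> j) \<omega>) \<partial>count_space ?S \<partial>M)"
  proof (rule nn_integral_count_space_nn_integral[OF cS, symmetric])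
    fix \<beta>
    have "(\<lambda>\<omega>. \<lambda>j\<in>J. X (\<beta> j) \<omega>) \<in> measurable M (PiM J (\<lambda>_. borel))" by measurable
    from measurable_compose[OF this borel_measurable_indicator[OF R]]
    show "(\<lambda>\<omega>. indicator (tuples J \<beta>) \<omega> * indicator ?R (\<lambda>j\<in>J. X (\<beta> j) \<omega>) :: ennreal) \<in> borel_measurable M"
      using J by (intro borel_measurable_times_ennreal borel_measurable_indicator) simp_all
  qed
  also have "\<dots> = (\<integral>\<^sup>+\<omega>. (\<Prod>i<k. ffact (N (C i) \<omega>) (cnt i)) \<partial>M)"
  proof (rule nn_integral_cong_AE)
    have "AE \<omega> in M. \<forall>i\<in>{..<k}. \<exists>l::nat. N (C i) \<omega> = of_nat l"
      by (rule AE_finite_allI[OF finite_lessThan]) (use C AE_N_finite in auto)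
    then show "AE \<omega> in M. (\<integral>\<^sup>+\<beta>. indicator (tuples J \<beta>) \<omega> * indicator ?R (\<lambda>j\<in>J. X (\<beta> j) \<omega>) \<partial>count_space ?S) =
      (\<Prod>i<k. ffact (N (C i) \<omega>) (cnt i))"
      using AE_space
    proof eventually_elim
      case (elim \<omega>)
      define K where "K i = {l \<in> point_indices (\<tau> \<omega>). X l \<omega> \<in> C i}" for i
      have K: "finite (K i)" "N (C i) \<omega> = of_nat (card (K i))" if i: "i < k" for i
      proof -
        have n: "N (C i) \<omega> = emeasure (count_space UNIV) (K i)" using N_eq[OF C(1)[OF i]] by (simp add: K_def)
        show "finite (K i)"
        proof (rule ccontr)
          assume "infinite (K i)"
          then have "N (C i) \<omega> = \<infinity>" using n by simp
          moreover obtain l :: nat where "N (C i) \<omega> = of_nat l" using elim i by auto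
          ultimately show False by simp
        qed
        then show "N (C i) \<omega> = of_nat (card (K i))" using n by simp
      qed
      have dK: "disjoint_family_on K {..<k}"
        using disj by (auto simp: disjoint_family_on_def K_def)
      \<comment> \<open>The index families counted by the inner integral at this \<omega>; they are
        finite in number because the counts of the sets \<open>C i\<close> are finite here.\<close>
      define A where "A = {\<beta> \<in> ?S. inj_on \<beta> J \<and> (\<forall>j\<in>J. \<beta> j \<in> K (T j))}"
      have A: "finite A" "card A = (\<Prod>i<k. \<Prod>l<cnt i. card (K i) - l)"
        unfolding A_def cnt_def using card_inj_PiE_disjoint[OF J _ T K(1) dK] by auto
      have "(\<integral>\<^sup>+\<beta>. indicator (tuples J \<beta>) \<omega> * indicator ?R (\<lambda>j\<in>J. X (\<beta> j) \<omega>) \<partial>count_space ?S) =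
        (\<integral>\<^sup>+\<beta>. indicator A \<beta> \<partial>count_space ?S)"
        using elim by (intro nn_integral_cong) (auto simp: indicator_def tuples_def A_def K_def)
      also have "\<dots> = of_nat (card A)"
        using A(1) by (subst nn_integral_indicator) (auto simp: A_def emeasure_count_space)
      also have "\<dots> = (\<Prod>i<k. ffact (N (C i) \<omega>) (cnt i))"
        unfolding A(2) of_nat_prod using K(2) by (simp add: ffact_of_nat)
      finally show ?case .
    qed
  qed
  also have "\<dots> = (\<Prod>i<k. \<integral>\<^sup>+\<omega>. ffact (N (C i) \<omega>) (cnt i) \<partial>M)"
  proof (rule indep_vars_nn_integral)
    have "indep_vars (\<lambda>_. borel) (\<lambda>i \<omega>. N (C i) \<omega>) {..<k}"
      using poisson C(1) disj by (simp add: poisson_process_def sets_\<nu>)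
    then show "indep_vars (\<lambda>_. borel) (\<lambda>i \<omega>. ffact (N (C i) \<omega>) (cnt i)) {..<k}"
      by (rule indep_vars_compose2) measurable
  qed auto
  also have "\<dots> = (\<Prod>i<k. emeasure \<nu> (C i) ^ cnt i)"
    using C by (intro prod.cong refl nn_integral_ffact_N) auto
  also have "\<dots> = (\<Prod>i<k. \<Prod>j | j \<in> J \<and> T j = i. emeasure \<nu> (C (T j)))"
    by (intro prod.cong refl) (simp add: cnt_def)
  also have "\<dots> = (\<Prod>j\<in>J. emeasure \<nu> (C (T j)))"
    using T J by (intro prod.group) auto
  finally show ?thesis .
qed

text \<open>Overlapping sides are reduced to disjoint ones by the atoms of the algebra that they
  generate. Each side is a disjoint union of atoms and the rectangle a disjoint union of rectangles
  of atoms; the product of the sums of their measures distributes in the same way.\<close>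

lemma factorial_moment_finite_rectangle:
  assumes J: "finite J" and B: "\<And>j. j \<in> J \<Longrightarrow> B j \<in> sets borel" "\<And>j. j \<in> J \<Longrightarrow> emeasure \<nu> (B j) < \<infinity>"
  shows "emeasure (factorial_moment J) (Pi\<^sub>E J B) = (\<Prod>j\<in>J. emeasure \<nu> (B j))"
proof -
  define k where "k = card (Pow J)"
  obtain e where e: "bij_betw e {..<k} (Pow J)"
    using ex_bij_betw_nat_finite[of "Pow J"] J by (auto simp: k_def atLeast0LessThan)
  \<comment> \<open>The atom of the membership pattern \<open>e i\<close>. Restricting to the union
    of the sides keeps the atom of the empty pattern empty, so that all atoms have finite
    measure.\<close>
  define C where "C i = {x \<in> \<Union>j\<in>J. B j. {j \<in> J. x \<in> B j} = e i}" for i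
  have C_eq: "C i = (\<Union>j\<in>J. B j) \<inter> (\<Inter>j\<in>J. if j \<in> e i then B j else - B j)" if "i < k" for i
  proof -
    have "e i \<subseteq> J" using e that by (auto simp: bij_betw_def)
    then show ?thesis by (auto simp: C_def split: if_splits)
  qed
  have UB: "(\<Union>j\<in>J. B j) \<in> sets borel" "emeasure \<nu> (\<Union>j\<in>J. B j) < \<infinity>"
  proof -
    show "(\<Union>j\<in>J. B j) \<in> sets borel" using J B by auto
    have "emeasure \<nu> (\<Union>j\<in>J. B j) \<le> (\<Sum>j\<in>J. emeasure \<nu> (B j))"
      using J B by (intro emeasure_subadditive_finite) (auto simp: sets_\<nu>)
    also have "\<dots> < \<infinity>" using J B by simp
    finally show "emeasure \<nu> (\<Union>j\<in>J. B j) < \<infinity>" .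
  qed
  have C: "C i \<in> sets borel" "emeasure \<nu> (C i) < \<infinity>" if i: "i < k" for i
  proof -
    show "C i \<in> sets borel"
    proof (cases "J = {}")
      case False
      then show ?thesis unfolding C_eq[OF i] using J B UB by (intro sets.Int sets.finite_INT) auto
    qed (simp add: C_def)
    have "emeasure \<nu> (C i) \<le> emeasure \<nu> (\<Union>j\<in>J. B j)"
      using UB(1) by (intro emeasure_mono) (auto simp: C_def sets_\<nu>)
    then show "emeasure \<nu> (C i) < \<infinity>" using UB(2) by (rule order.strict_trans1)
  qed
  have disj: "disjoint_family_on C {..<k}"
    using e by (auto simp: disjoint_family_on_def C_def bij_betw_def inj_on_def)
  define I where "I j = {i. i < k \<and> j \<in> e i}" for j
  have B_eq: "B j = (\<Union>i\<in>I j. C i)" if j: "j \<in> J" for j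
  proof (intro set_eqI iffI)
    fix x assume x: "x \<in> B j"
    have "{j \<in> J. x \<in> B j} \<in> e ` {..<k}" using e by (auto simp: bij_betw_def)
    then obtain i where "i < k" "{j \<in> J. x \<in> B j} = e i" by auto
    then show "x \<in> (\<Union>i\<in>I j. C i)" using x j by (auto simp: I_def C_def)
  qed (auto simp: I_def C_def)
  have finI: "finite (I j)" for j by (simp add: I_def)
  have \<nu>B: "emeasure \<nu> (B j) = (\<Sum>i\<in>I j. emeasure \<nu> (C i))" if j: "j \<in> J" for j
    unfolding B_eq[OF j]
    by (rule sum_emeasure[symmetric])
      (use C disj finI in \<open>auto simp: I_def sets_\<nu> disjoint_family_on_def\<close>)
  have Pi_eq: "Pi\<^sub>E J B = (\<Union>T\<in>Pi\<^sub>E J I. Pi\<^sub>E J (\<lambda>j. C (T j)))"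
  proof (intro set_eqI iffI)
    fix x assume x: "x \<in> Pi\<^sub>E J B"
    then have "\<forall>j\<in>J. \<exists>i\<in>I j. x j \<in> C i" using B_eq by (auto simp: PiE_iff)
    then obtain T where T: "\<And>j. j \<in> J \<Longrightarrow> T j \<in> I j \<and> x j \<in> C (T j)" by metis
    then show "x \<in> (\<Union>T\<in>Pi\<^sub>E J I. Pi\<^sub>E J (\<lambda>j. C (T j)))"
      using x by (intro UN_I[of "restrict T J"]) (auto simp: PiE_iff)
  next
    fix x assume "x \<in> (\<Union>T\<in>Pi\<^sub>E J I. Pi\<^sub>E J (\<lambda>j. C (T j)))"
    then obtain T where T: "T \<in> Pi\<^sub>E J I" "x \<in> Pi\<^sub>E J (\<lambda>j. C (T j))" by auto
    have "x j \<in> B j" if "j \<in> J" for j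
      unfolding B_eq[OF that] using T that by (auto simp: PiE_iff)
    then show "x \<in> Pi\<^sub>E J B" using T by (auto simp: PiE_iff)
  qed
  have "emeasure (factorial_moment J) (Pi\<^sub>E J B) =
    (\<Sum>T\<in>Pi\<^sub>E J I. emeasure (factorial_moment J) (Pi\<^sub>E J (\<lambda>j. C (T j))))"
    unfolding Pi_eq
  proof (rule sum_emeasure[symmetric])
    show "finite (Pi\<^sub>E J I)" using J finI by (intro finite_PiE) auto
    show "(\<lambda>T. Pi\<^sub>E J (\<lambda>j. C (T j))) ` Pi\<^sub>E J I \<subseteq> sets (factorial_moment J)"
      using J C by (auto simp: PiE_iff I_def intro!: sets_PiM_I_finite)
    show "disjoint_family_on (\<lambda>T. Pi\<^sub>E J (\<lambda>j. C (T j))) (Pi\<^sub>E J I)"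
    proof (unfold disjoint_family_on_def, intro ballI impI)
      fix T T' assume T: "T \<in> Pi\<^sub>E J I" "T' \<in> Pi\<^sub>E J I" "T \<noteq> T'"
      then obtain j where j: "j \<in> J" "T j \<noteq> T' j" by (metis PiE_ext)
      then have "C (T j) \<inter> C (T' j) = {}"
        using T disj by (intro disjoint_family_onD[OF disj]) (auto simp: I_def PiE_iff)
      then show "Pi\<^sub>E J (\<lambda>j. C (T j)) \<inter> Pi\<^sub>E J (\<lambda>j. C (T' j)) = {}"
        using j by (auto simp: PiE_iff disjoint_iff)
    qed
  qed
  also have "\<dots> = (\<Sum>T\<in>Pi\<^sub>E J I. \<Prod>j\<in>J. emeasure \<nu> (C (T j)))"
    using C disj by (intro sum.cong refl factorial_moment_disjoint[OF J, of _ k]) (auto simp: I_def PiE_iff)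
  also have "\<dots> = (\<Prod>j\<in>J. \<Sum>i\<in>I j. emeasure \<nu> (C i))"
    using J finI by (subst prod_sum_PiE) auto
  finally show ?thesis using \<nu>B by simp
qed

text \<open>The product measure is determined by its values on rectangles. Sides of infinite measure
  are cut down to the sets \<open>S n\<close>, which exhaust the space and bring back the finite
  case, and monotone limits are taken in both measures.\<close>

lemma factorial_moment_eq_PiM:
  assumes J: "finite J"
  shows "factorial_moment J = PiM J (\<lambda>_. \<nu>)"
proof -
  interpret \<nu>: product_sigma_finite "\<lambda>_. \<nu>"
    using sigma_finite_\<nu> by (simp add: product_sigma_finite_def)
  obtain S :: "nat \<Rightarrow> 'a set" where S: "range S \<subseteq> sets \<nu>" "(\<Union>i. S i) = space \<nu>"
    "\<And>i. emeasure \<nu> (S i) \<noteq> \<infinity>" "incseq S"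
    by (rule sigma_finite_measure.sigma_finite_incseq[OF sigma_finite_\<nu>]) (rule that)
  have s: "sets (PiM J (\<lambda>_. borel)) = sets (PiM J (\<lambda>_. \<nu>))"
    by (intro sets_PiM_cong) (auto simp: sets_\<nu>)
  show ?thesis
  proof (rule \<nu>.PiM_eqI[OF J])
    show "sets (factorial_moment J) = sets (PiM J (\<lambda>_. \<nu>))" using s by simp
    fix A assume A: "\<And>j. j \<in> J \<Longrightarrow> A j \<in> sets \<nu>"
    define R where "R n = Pi\<^sub>E J (\<lambda>j. A j \<inter> S n)" for n
    have Rs: "R n \<in> sets (PiM J (\<lambda>_. \<nu>))" for n
      unfolding R_def using J A S by (intro sets_PiM_I_finite) auto
    have inc: "incseq R"
    proof (rule incseq_SucI)
      fix n
      have "S n \<subseteq> S (Suc n)" using S(4) by (rule incseq_SucD)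
      then show "R n \<subseteq> R (Suc n)" unfolding R_def by (intro PiE_mono) blast
    qed
    have U: "(\<Union>n. R n) = Pi\<^sub>E J A"
    proof (intro set_eqI iffI)
      fix x assume x: "x \<in> Pi\<^sub>E J A"
      have "\<exists>n. x j \<in> S n" if "j \<in> J" for j
      proof -
        have "x j \<in> space \<nu>" using PiE_mem[OF x that] sets.sets_into_space[OF A[OF that]] by blast
        then show ?thesis unfolding S(2)[symmetric] by blast
      qed
      then obtain n where n: "\<And>j. j \<in> J \<Longrightarrow> x j \<in> S (n j)" by metis
      define m where "m = Max (insert 0 (n ` J))"
      have "x j \<in> S m" if "j \<in> J" for j
      proof -
        have "n j \<le> m" using J that by (auto simp: m_def)
        then show ?thesis using n[OF that] S(4) by (auto simp: incseq_def)
      qed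
      then show "x \<in> (\<Union>n. R n)" using x by (auto simp: R_def PiE_iff)
    qed (auto simp: R_def PiE_iff)
    have eq: "emeasure (factorial_moment J) (R n) = emeasure (PiM J (\<lambda>_. \<nu>)) (R n)" for n
    proof -
      have m: "A j \<inter> S n \<in> sets \<nu>" if "j \<in> J" for j using A[OF that] S by auto
      have "emeasure \<nu> (A j \<inter> S n) < \<infinity>" if "j \<in> J" for j
      proof -
        have "emeasure \<nu> (A j \<inter> S n) \<le> emeasure \<nu> (S n)" using S by (intro emeasure_mono) auto
        then show ?thesis using S(3)[of n] by (auto simp: top.not_eq_extremum order.strict_trans1)
      qed
      then show ?thesis
        unfolding R_def using m sets_\<nu>
        by (subst factorial_moment_finite_rectangle[OF J]) (auto simp: \<nu>.emeasure_PiM[OF J])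
    qed
    have "emeasure (factorial_moment J) (Pi\<^sub>E J A) = (SUP n. emeasure (factorial_moment J) (R n))"
      unfolding U[symmetric] using Rs s inc by (intro SUP_emeasure_incseq[symmetric]) auto
    also have "\<dots> = (SUP n. emeasure (PiM J (\<lambda>_. \<nu>)) (R n))" by (simp add: eq)
    also have "\<dots> = emeasure (PiM J (\<lambda>_. \<nu>)) (Pi\<^sub>E J A)"
      unfolding U[symmetric] using Rs inc by (intro SUP_emeasure_incseq) auto
    finally show "emeasure (factorial_moment J) (Pi\<^sub>E J A) = (\<Prod>j\<in>J. emeasure \<nu> (A j))"
      using A by (simp add: \<nu>.emeasure_PiM[OF J])
  qed
qed

theorem campbell:
  assumes J: "finite J" and f: "f \<in> borel_measurable (PiM J (\<lambda>_. borel))"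
  shows "(\<integral>\<^sup>+\<beta>. \<integral>\<^sup>+\<omega>. indicator (tuples J \<beta>) \<omega> * f (\<lambda>j\<in>J. X (\<beta> j) \<omega>) \<partial>M \<partial>count_space (J \<rightarrow>\<^sub>E UNIV)) =
    integral\<^sup>N (PiM J (\<lambda>_. \<nu>)) f"
  using nn_integral_factorial_moment[OF assms] factorial_moment_eq_PiM[OF J] by simp

end

section \<open>Weights of glued graphs\<close>

definition block_of :: "(nat \<times> nat) set set \<Rightarrow> nat \<times> nat \<Rightarrow> (nat \<times> nat) set" where
  "block_of \<rho> p = (THE b. b \<in> \<rho> \<and> p \<in> b)"

lemma block_of_eq: "partition_on A \<rho> \<Longrightarrow> b \<in> \<rho> \<Longrightarrow> p \<in> b \<Longrightarrow> block_of \<rho> p = b"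
  unfolding block_of_def by (rule the_equality) (simp, erule conjE, rule partition_on_eqI)

lemma block_of_in:
  assumes "partition_on A \<rho>" "p \<in> A" shows "block_of \<rho> p \<in> \<rho>" "p \<in> block_of \<rho> p"
proof -
  obtain b where "b \<in> \<rho>" "p \<in> b" using assms by (auto simp: partition_on_def)
  then show "block_of \<rho> p \<in> \<rho>" "p \<in> block_of \<rho> p" using block_of_eq[OF assms(1)] by auto
qed

lemma partition_on_mem: "partition_on A P \<Longrightarrow> b \<in> P \<Longrightarrow> p \<in> b \<Longrightarrow> p \<in> A"
  unfolding partition_on_def by blast

text \<open>The value of a symmetric function at an unordered pair: \<open>SOME\<close> chooses an
  ordering, and symmetry makes the choice immaterial. It is needed because edges are sets while
  connection functions take two arguments.\<close>

definition pairval :: "('v \<Rightarrow> 'v \<Rightarrow> 'b) \<Rightarrow> 'v set \<Rightarrow> 'b" where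
  "pairval f e = (let p = SOME p. e = {fst p, snd p} in f (fst p) (snd p))"

lemma pairval_doubleton:
  assumes "\<And>u v. f u v = f v u" shows "pairval f {u, v} = f u v"
proof -
  define p where "p = (SOME p. {u, v} = {fst p, snd p})"
  have "{u, v} = {fst p, snd p}" unfolding p_def by (rule someI[of _ "(u, v)"]) simp
  then have "fst p = u \<and> snd p = v \<or> fst p = v \<and> snd p = u" by (auto simp: doubleton_eq_iff)
  then show ?thesis using assms unfolding pairval_def p_def[symmetric] Let_def by auto
qed

text \<open>The vertex \<open>j\<close> of the \<open>i\<close>-th copy of \<open>G\<close>, as a vertex of the graph of \<open>\<rho>\<close>.\<close>

definition lift_vertex :: "nat \<Rightarrow> (nat \<times> nat) set set \<Rightarrow> nat \<Rightarrow> nat \<Rightarrow> (nat \<times> nat) set + nat" where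
  "lift_vertex r \<rho> i j = (if j \<le> r then Inl (block_of \<rho> (i, j)) else Inr (j - r))"

text \<open>Edges of different copies with the same image are identified, just as the square of the
  indicator of an edge is that indicator. The row set \<open>A\<close> is arbitrary because the
  lower moments in a cumulant see only the rows in one block of a row partition.\<close>

definition glued_edges ::
    "nat \<Rightarrow> nat set set \<Rightarrow> nat set \<Rightarrow> (nat \<times> nat) set set \<Rightarrow> ((nat \<times> nat) set + nat) set set" where
  "glued_edges r E A \<rho> = (\<Union>i\<in>A. (\<lambda>e. lift_vertex r \<rho> i ` e) ` E)"

fun position :: "(nat \<Rightarrow> 'a) \<Rightarrow> ('b \<Rightarrow> 'a) \<Rightarrow> 'b + nat \<Rightarrow> 'a" where
  "position y x (Inl b) = x b"
| "position y x (Inr k) = y k"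

definition edge_weight :: "(nat \<Rightarrow> 'a) \<Rightarrow> ('a \<Rightarrow> 'a \<Rightarrow> real) \<Rightarrow> ('b \<Rightarrow> 'a) \<Rightarrow> ('b + nat) set \<Rightarrow> real" where
  "edge_weight y \<psi> x e = pairval (\<lambda>u v. \<psi> (position y x u) (position y x v)) e"

definition graph_weight ::
    "(nat \<Rightarrow> 'a) \<Rightarrow> ('a \<Rightarrow> 'a \<Rightarrow> real) \<Rightarrow> 'a measure \<Rightarrow> 'b set \<Rightarrow> ('b + nat) set set \<Rightarrow> ennreal" where
  "graph_weight y \<psi> \<nu> V D = (\<integral>\<^sup>+x. (\<Prod>e\<in>D. ennreal (edge_weight y \<psi> x e)) \<partial>PiM V (\<lambda>_. \<nu>))"

lemma edge_weight_doubleton: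
  "(\<And>u v. \<psi> u v = \<psi> v u) \<Longrightarrow> edge_weight y \<psi> x {u, v} = \<psi> (position y x u) (position y x v)"
  unfolding edge_weight_def by (rule pairval_doubleton)

lemma edge_weight_cong:
  assumes "\<And>u v. \<psi> u v = \<psi> v u" and e: "card e = 2"
    and "\<And>b. Inl b \<in> e \<Longrightarrow> x b = x' b"
  shows "edge_weight y \<psi> x e = edge_weight y \<psi> x' e"
proof -
  obtain u v where uv: "e = {u, v}" using e by (auto simp: card_2_iff)
  have "position y x w = position y x' w" if "w \<in> e" for w using assms(3) that by (cases w) auto
  then show ?thesis unfolding uv using uv by (simp add: edge_weight_doubleton[OF assms(1)])
qed

lemma measurable_edge_weight:
  assumes sets_N: "sets N = sets borel"
    and \<psi>: "(\<lambda>(u, v). \<psi> u v) \<in> borel_measurable (borel \<Otimes>\<^sub>M borel)" "\<And>u v. \<psi> u v = \<psi> v u"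
    and e: "card e = 2" "e \<subseteq> Inl ` V \<union> range Inr"
  shows "(\<lambda>x. edge_weight y \<psi> x e) \<in> borel_measurable (PiM V (\<lambda>_. N))"
proof -
  obtain u v where uv: "e = {u, v}" using e by (auto simp: card_2_iff)
  have "(\<lambda>x. position y x w) \<in> measurable (PiM V (\<lambda>_. N)) borel" if w: "w \<in> e" for w
  proof (cases w)
    case (Inl b)
    then have "b \<in> V" using w e(2) by auto
    then have "(\<lambda>x. x b) \<in> measurable (PiM V (\<lambda>_. N)) N" by (rule measurable_component_singleton)
    then show ?thesis
      unfolding Inl using measurable_cong_sets[OF refl sets_N, of "PiM V (\<lambda>_. N)"] by simp
  qed simp
  then have "(\<lambda>x. (position y x u, position y x v)) \<in> measurable (PiM V (\<lambda>_. N)) (borel \<Otimes>\<^sub>M borel)"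
    using uv by (intro measurable_Pair) auto
  from measurable_compose[OF this \<psi>(1)] show ?thesis
    unfolding uv by (simp add: edge_weight_doubleton[OF \<psi>(2)])
qed

section \<open>Copies of the graph glued along a non-flat partition\<close>

locale endpoint_graph =
  fixes r m :: nat and E :: "nat set set"
  assumes r2: "r \<ge> 2"
    and simple_E: "simple_graph {1..r+m} E"
    and conn_r: "connected_graph {1..r} (induced_edges {1..r} E)"
    and endpoints: "\<forall>i\<in>{r+1..r+m}. \<forall>j\<in>{r+1..r+m}. {i, j} \<notin> E"
begin

lemma finite_E: "finite E"
proof -
  have "E \<subseteq> Pow {1..r+m}" using simple_E by (auto simp: simple_graph_def)
  then show ?thesis by (rule finite_subset) simp
qed

lemma edge_cases:
  assumes "e \<in> E"
  obtains (inner) j1 j2 where "e = {j1, j2}" "j1 \<in> {1..r}" "j2 \<in> {1..r}" "j1 \<noteq> j2"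
  | (endpoint) j k where "e = {j, r + k}" "j \<in> {1..r}" "k \<in> {1..m}"
proof -
  have e: "e \<subseteq> {1..r+m}" "card e = 2" using assms simple_E by (auto simp: simple_graph_def)
  then obtain u v where uv: "e = {u, v}" "u \<noteq> v" by (auto simp: card_2_iff)
  have *: thesis if "u \<le> r" "r < v" "e = {u, v}" for u v
    using that e(1) by (intro endpoint[of u "v - r"]) auto
  show thesis
  proof (cases "u \<le> r")
    case True
    show thesis
    proof (cases "v \<le> r")
      case True
      with \<open>u \<le> r\<close> uv e(1) show thesis by (intro inner[of u v]) auto
    qed (use *[of u v] True uv in auto)
  next
    case False
    show thesis
    proof (cases "v \<le> r")
      case True
      with False uv show thesis by (intro *[of v u]) auto
    next
      case False
      have "{u, v} \<notin> E" using endpoints False \<open>\<not> u \<le> r\<close> e(1) uv by auto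
      with assms uv show thesis by simp
    qed
  qed
qed

lemma edge_vertex: "e \<in> E \<Longrightarrow> j \<in> e \<Longrightarrow> j \<in> {1..r+m}"
  using simple_E unfolding simple_graph_def by blast

lemma card_edge: "e \<in> E \<Longrightarrow> card e = 2"
  using simple_E unfolding simple_graph_def by blast

text \<open>Connectedness on \<open>{1..r}\<close> with \<open>r \<ge> 2\<close> gives
  \<open>j\<close> a neighbour. This lets edges control vertices: once all edges of a copy are
  present in the random graph, each of its indices belongs to an actual point.\<close>

lemma vertex_in_edge:
  assumes "j \<in> {1..r}" shows "\<exists>e\<in>E. j \<in> e"
proof -
  define j' :: nat where "j' = (if j = 1 then 2 else 1)"
  have j': "j' \<in> {1..r}" "j' \<noteq> j" using r2 by (auto simp: j'_def)
  then have "(j, j') \<in> {(x, y). {x, y} \<in> induced_edges {1..r} E}\<^sup>*"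
    using conn_r assms by (auto simp: connected_graph_def)
  then obtain z where "{j, z} \<in> induced_edges {1..r} E"
    using j'(2) by (cases rule: converse_rtranclE) auto
  then show ?thesis by (auto simp: induced_edges_def)
qed

lemma lift_in:
  assumes "partition_on (A \<times> {1..r}) \<rho>" "i \<in> A" "j \<in> {1..r+m}"
  shows "lift_vertex r \<rho> i j \<in> Inl ` \<rho> \<union> Inr ` {1..m}"
proof (cases "j \<le> r")
  case True
  then show ?thesis using assms block_of_in(1)[OF assms(1), of "(i, j)"] by (auto simp: lift_vertex_def)
next
  case False
  then have "j - r \<in> {1..m}" using assms by auto
  then show ?thesis using False by (simp add: lift_vertex_def)
qed

text \<open>Non-flatness keeps the vertices of one copy apart, so that the image of an edge is again
  a pair and not a loop.\<close>

lemma inj_on_lift: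
  assumes \<rho>: "\<rho> \<in> NF r A" and i: "i \<in> A"
  shows "inj_on (lift_vertex r \<rho> i) {1..r+m}"
proof (rule inj_onI)
  have P: "partition_on (A \<times> {1..r}) \<rho>" "\<And>b. b \<in> \<rho> \<Longrightarrow> inj_on fst b" using \<rho> by (auto simp: NF_def)
  fix j j' assume j: "j \<in> {1..r+m}" "j' \<in> {1..r+m}" and eq: "lift_vertex r \<rho> i j = lift_vertex r \<rho> i j'"
  show "j = j'"
  proof (cases "j \<le> r")
    case True
    then have j'r: "j' \<le> r" "block_of \<rho> (i, j) = block_of \<rho> (i, j')"
      using eq by (auto simp: lift_vertex_def split: if_splits)
    let ?b = "block_of \<rho> (i, j)"
    have "?b \<in> \<rho>" "(i, j) \<in> ?b" "(i, j') \<in> ?b"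
      using block_of_in[OF P(1), of "(i, j)"] block_of_in[OF P(1), of "(i, j')"] True j'r i j by auto
    then show ?thesis using inj_onD[OF P(2), of ?b "(i, j)" "(i, j')"] by simp
  next
    case False
    then show ?thesis using eq j by (auto simp: lift_vertex_def split: if_splits)
  qed
qed

text \<open>The third claim rests on the absence of edges between endpoints. It is what makes the
  edge sets over different groups of rows disjoint.\<close>

lemma glued_edge:
  assumes \<rho>: "\<rho> \<in> NF r A" and e: "e \<in> glued_edges r E A \<rho>"
  shows "card e = 2" "e \<subseteq> Inl ` \<rho> \<union> Inr ` {1..m}" "\<exists>b\<in>\<rho>. Inl b \<in> e"
proof -
  have P: "partition_on (A \<times> {1..r}) \<rho>" using \<rho> by (auto simp: NF_def)
  obtain i d where d: "i \<in> A" "d \<in> E" "e = lift_vertex r \<rho> i ` d" using e by (auto simp: glued_edges_def)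
  have sub: "d \<subseteq> {1..r+m}" using edge_vertex d by auto
  show "card e = 2"
    using inj_on_subset[OF inj_on_lift[OF \<rho> d(1)] sub] card_edge[OF d(2)] d(3) by (simp add: card_image)
  show "e \<subseteq> Inl ` \<rho> \<union> Inr ` {1..m}" unfolding d(3) using lift_in[OF P d(1)] sub by blast
  obtain j where j: "j \<in> d" "j \<in> {1..r}" using d(2) by (rule edge_cases) auto
  have "lift_vertex r \<rho> i j \<in> e" unfolding d(3) using j(1) by (rule imageI)
  then have "Inl (block_of \<rho> (i, j)) \<in> e" using j(2) by (simp add: lift_vertex_def)
  then show "\<exists>b\<in>\<rho>. Inl b \<in> e"
    using block_of_in(1)[OF P, of "(i, j)"] d(1) j(2) by (intro bexI) auto
qed

lemma measurable_glued_weight: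
  assumes sets_N: "sets N = sets borel"
    and \<psi>: "(\<lambda>(u, v). \<psi> u v) \<in> borel_measurable (borel \<Otimes>\<^sub>M borel)" "\<And>u v. \<psi> u v = \<psi> v u"
    and \<rho>: "\<rho> \<in> NF r A"
  shows "(\<lambda>x. \<Prod>e\<in>glued_edges r E A \<rho>. ennreal (edge_weight y \<psi> x e)) \<in> borel_measurable (PiM \<rho> (\<lambda>_. N))"
proof (rule borel_measurable_prod_ennreal)
  fix e assume e: "e \<in> glued_edges r E A \<rho>"
  have "Inl ` \<rho> \<union> Inr ` {1..m} \<subseteq> Inl ` \<rho> \<union> range Inr" by blast
  then have "e \<subseteq> Inl ` \<rho> \<union> range Inr" using glued_edge(2)[OF \<rho> e] by (rule subset_trans[rotated])
  from measurable_edge_weight[OF sets_N \<psi> glued_edge(1)[OF \<rho> e] this]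
  show "(\<lambda>x. ennreal (edge_weight y \<psi> x e)) \<in> borel_measurable (PiM \<rho> (\<lambda>_. N))"
    by (rule measurable_compose) simp
qed

lemma finite_glued_edges: "finite A \<Longrightarrow> finite (glued_edges r E A \<rho>)"
  unfolding glued_edges_def using finite_E by (intro finite_UN_I finite_imageI)

text \<open>In one direction an edge inside a row has to give two distinct blocks, as the definition
  demands; non-flatness supplies this.\<close>

lemma partition_graph_edges_eq:
  assumes \<rho>: "\<rho> \<in> NF r {1..n}"
  shows "partition_graph_edges n r m E \<rho> = glued_edges r E {1..n} \<rho>"
proof (intro set_eqI iffI)
  have P: "partition_on ({1..n} \<times> {1..r}) \<rho>" "\<And>b. b \<in> \<rho> \<Longrightarrow> inj_on fst b" using \<rho> by (auto simp: NF_def)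
  have in_V: "i \<in> {1..n} \<and> j \<in> {1..r}" if "(i, j) \<in> b" "b \<in> \<rho>" for i j b
    using partition_on_mem[OF P(1) that(2,1)] by simp
  fix d assume "d \<in> partition_graph_edges n r m E \<rho>"
  then show "d \<in> glued_edges r E {1..n} \<rho>"
    unfolding partition_graph_edges_def
  proof (elim UnE CollectE exE conjE bexE)
    fix b b' i j1 j2
    assume "d = {Inl b, Inl b'}" "b \<in> \<rho>" "b' \<in> \<rho>" "i \<in> {1..n}" "(i, j1) \<in> b" "(i, j2) \<in> b'" "{j1, j2} \<in> E"
    then have "d = lift_vertex r \<rho> i ` {j1, j2}"
      using in_V[of i j1 b] in_V[of i j2 b'] block_of_eq[OF P(1)] by (simp add: lift_vertex_def)
    then show ?thesis
      unfolding glued_edges_def using \<open>i \<in> {1..n}\<close> \<open>{j1, j2} \<in> E\<close> by blast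
  next
    fix b k p assume d: "d = {Inl b, Inr k}" "b \<in> \<rho>" "k \<in> {1..m}" "p \<in> b"
      and E: "case p of (i, j) \<Rightarrow> {r + k, j} \<in> E"
    obtain i j where p: "p = (i, j)" by (cases p)
    have ij: "i \<in> {1..n}" "j \<in> {1..r}" using in_V[of i j b] d p by auto
    have "{r + k, j} \<in> E" using E p by simp
    moreover have "d = lift_vertex r \<rho> i ` {r + k, j}"
      using ij d p block_of_eq[OF P(1), of b "(i, j)"] by (auto simp: lift_vertex_def)
    ultimately show ?thesis
      unfolding glued_edges_def using ij(1) by blast
  qed
next
  have P: "partition_on ({1..n} \<times> {1..r}) \<rho>" "\<And>b. b \<in> \<rho> \<Longrightarrow> inj_on fst b" using \<rho> by (auto simp: NF_def)
  fix d assume "d \<in> glued_edges r E {1..n} \<rho>"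
  then obtain i e where e: "i \<in> {1..n}" "e \<in> E" "d = lift_vertex r \<rho> i ` e" by (auto simp: glued_edges_def)
  from e(2) show "d \<in> partition_graph_edges n r m E \<rho>"
  proof (cases rule: edge_cases)
    case (inner j1 j2)
    let ?b = "block_of \<rho> (i, j1)" and ?b' = "block_of \<rho> (i, j2)"
    have d: "d = {Inl ?b, Inl ?b'}" using inner e by (simp add: lift_vertex_def)
    have b: "?b \<in> \<rho>" "?b' \<in> \<rho>" "(i, j1) \<in> ?b" "(i, j2) \<in> ?b'"
      using block_of_in[OF P(1)] inner e by auto
    have "?b \<noteq> ?b'"
    proof
      assume "?b = ?b'"
      then show False using inj_onD[OF P(2)[OF b(1)], of "(i, j1)" "(i, j2)"] b inner by auto
    qed
    moreover have "{j1, j2} \<in> E" using e(2) inner(1) by simp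
    ultimately show ?thesis
      unfolding partition_graph_edges_def using d b e(1)
      by (intro UnI1 CollectI exI[of _ ?b] exI[of _ ?b'] conjI bexI[of _ i] exI[of _ j1] exI[of _ j2])
  next
    case (endpoint j k)
    let ?b = "block_of \<rho> (i, j)"
    have d: "d = {Inl ?b, Inr k}" using endpoint e by (auto simp: lift_vertex_def)
    have b: "?b \<in> \<rho>" "(i, j) \<in> ?b"
      using block_of_in[OF P(1)] endpoint e by auto
    have "{r + k, j} \<in> E" using e endpoint by (simp add: insert_commute)
    then show ?thesis
      unfolding partition_graph_edges_def using d b endpoint(3)
      by (intro UnI2 CollectI exI[of _ ?b] exI[of _ k] conjI bexI[of _ "(i, j)"]) auto
  qed
qed

lemma block_of_UN:
  assumes "partition_on A (\<Union>B\<in>P. f B)" "B \<in> P" "partition_on V (f B)" "p \<in> V"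
  shows "block_of (\<Union>B\<in>P. f B) p = block_of (f B) p"
proof (rule block_of_eq[OF assms(1)])
  show "block_of (f B) p \<in> (\<Union>B\<in>P. f B)"
    using assms(2) block_of_in(1)[OF assms(3,4)] by (rule UN_I)
  show "p \<in> block_of (f B) p" using assms(3,4) by (rule block_of_in(2))
qed

text \<open>Blocks over different members of \<open>P\<close> are different integration variables,
  and every edge contains a block, so neither variables nor edges are shared. Common endpoints do
  not couple the factors, since their positions are fixed.\<close>

lemma graph_weight_UN:
  assumes N: "product_sigma_finite (\<lambda>_ :: (nat \<times> nat) set. N)"
    and sets_N: "sets N = sets borel"
    and \<psi>: "(\<lambda>(u, v). \<psi> u v) \<in> borel_measurable (borel \<Otimes>\<^sub>M borel)" "\<And>u v. \<psi> u v = \<psi> v u"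
    and P: "partition_on {1..n} P" and f: "f \<in> Pi\<^sub>E P (NF r)"
  shows "graph_weight y \<psi> N (\<Union>B\<in>P. f B) (glued_edges r E {1..n} (\<Union>B\<in>P. f B)) =
    (\<Prod>B\<in>P. graph_weight y \<psi> N (f B) (glued_edges r E B (f B)))"
proof -
  interpret product_sigma_finite "\<lambda>_ :: (nat \<times> nat) set. N" by fact
  let ?\<rho> = "\<Union>B\<in>P. f B"
  have \<rho>: "?\<rho> \<in> NF r {1..n}"
    using bij_betw_NF_Union[OF P, of r] f by (auto simp: bij_betw_def)
  have fB: "f B \<in> NF r B" if "B \<in> P" for B using f that by auto
  have PB: "partition_on (B \<times> {1..r}) (f B)" if "B \<in> P" for B using fB[OF that] by (simp add: NF_def)
  have P\<rho>: "partition_on ({1..n} \<times> {1..r}) ?\<rho>" using \<rho> by (simp add: NF_def)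
  have finP: "finite P" using finite_elements[OF _ P] by simp
  have sub: "B \<subseteq> {1..n}" if "B \<in> P" for B using P that by (auto simp: partition_on_def)
  have finB: "finite B" if "B \<in> P" for B using sub[OF that] by (rule finite_subset) simp
  have finf: "finite (f B)" if "B \<in> P" for B
    using finite_elements[OF _ PB[OF that]] finB[OF that] by simp
  have disj: "f B \<inter> f C = {}" if "B \<in> P" "C \<in> P" "B \<noteq> C" for B C
  proof -
    have "False" if "b \<in> f B" "b \<in> f C" for b
    proof -
      have "b \<noteq> {}" "b \<subseteq> B \<times> {1..r}" "b \<subseteq> C \<times> {1..r}"
        using PB[OF \<open>B \<in> P\<close>] PB[OF \<open>C \<in> P\<close>] that by (auto simp: partition_on_def)
      moreover have "B \<inter> C = {}" using P \<open>B \<in> P\<close> \<open>C \<in> P\<close> \<open>B \<noteq> C\<close> by (auto simp: partition_on_def disjoint_def)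
      ultimately show False by blast
    qed
    then show ?thesis by auto
  qed
  have lift: "lift_vertex r ?\<rho> i ` e = lift_vertex r (f B) i ` e" if "B \<in> P" "i \<in> B" "e \<in> E" for B i e
  proof (rule image_cong[OF refl])
    fix j assume "j \<in> e"
    then have "j \<in> {1..r+m}" using edge_vertex that by auto
    then show "lift_vertex r ?\<rho> i j = lift_vertex r (f B) i j"
      using block_of_UN[OF P\<rho> that(1) PB[OF that(1)], of "(i, j)"] that by (auto simp: lift_vertex_def)
  qed
  have "glued_edges r E {1..n} ?\<rho> = (\<Union>B\<in>P. \<Union>i\<in>B. (\<lambda>e. lift_vertex r ?\<rho> i ` e) ` E)"
  proof -
    have "{1..n} = \<Union>P" using P by (simp add: partition_on_def)
    then show ?thesis unfolding glued_edges_def by (simp only: UN_UN_flatten UN_simps)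
  qed
  also have "\<dots> = (\<Union>B\<in>P. glued_edges r E B (f B))"
    unfolding glued_edges_def by (intro SUP_cong refl image_cong[OF refl lift])
  finally have D: "glued_edges r E {1..n} ?\<rho> = (\<Union>B\<in>P. glued_edges r E B (f B))" .
  have disjD: "glued_edges r E B (f B) \<inter> glued_edges r E C (f C) = {}"
    if BC: "B \<in> P" "C \<in> P" "B \<noteq> C" for B C
  proof -
    have "False" if e: "e \<in> glued_edges r E B (f B)" "e \<in> glued_edges r E C (f C)" for e
    proof -
      obtain b where "b \<in> f B" "Inl b \<in> e" using glued_edge(3)[OF fB[OF BC(1)] e(1)] by auto
      moreover have "e \<subseteq> Inl ` f C \<union> Inr ` {1..m}" using glued_edge(2)[OF fB[OF BC(2)] e(2)] .
      ultimately have "b \<in> f B \<inter> f C" by auto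
      then show False using disj[OF BC] by auto
    qed
    then show ?thesis by auto
  qed
  have w: "edge_weight y \<psi> x e = edge_weight y \<psi> (restrict x (f B)) e"
    if "B \<in> P" "e \<in> glued_edges r E B (f B)" for B e and x :: "_ \<Rightarrow> 'a"
    using glued_edge(2)[OF fB[OF that(1)] that(2)] glued_edge(1)[OF fB[OF that(1)] that(2)]
    by (intro edge_weight_cong[OF \<psi>(2)]) auto
  have "(\<Prod>e\<in>(\<Union>B\<in>P. glued_edges r E B (f B)). ennreal (edge_weight y \<psi> x e)) =
    (\<Prod>B\<in>P. \<Prod>e\<in>glued_edges r E B (f B). ennreal (edge_weight y \<psi> (restrict x (f B)) e))"
    for x :: "_ \<Rightarrow> 'a"
  proof -
    have "(\<Prod>e\<in>(\<Union>B\<in>P. glued_edges r E B (f B)). ennreal (edge_weight y \<psi> x e)) =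
      (\<Prod>B\<in>P. \<Prod>e\<in>glued_edges r E B (f B). ennreal (edge_weight y \<psi> x e))"
      by (rule prod.UNION_disjoint) (use finP finB disjD finite_glued_edges in blast)+
    also have "\<dots> = (\<Prod>B\<in>P. \<Prod>e\<in>glued_edges r E B (f B). ennreal (edge_weight y \<psi> (restrict x (f B)) e))"
      by (intro prod.cong refl arg_cong[where f = ennreal] w)
    finally show ?thesis .
  qed
  note split = this
  have "graph_weight y \<psi> N ?\<rho> (glued_edges r E {1..n} ?\<rho>) =
    (\<integral>\<^sup>+x. (\<Prod>B\<in>P. \<Prod>e\<in>glued_edges r E B (f B). ennreal (edge_weight y \<psi> (restrict x (f B)) e))
      \<partial>PiM ?\<rho> (\<lambda>_. N))"
    unfolding graph_weight_def D by (simp only: split)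
  also have "\<dots> = (\<Prod>B\<in>P. graph_weight y \<psi> N (f B) (glued_edges r E B (f B)))"
    unfolding graph_weight_def
  proof (rule product_nn_integral_UN[OF finP finf disj,
        where g = "\<lambda>B x. \<Prod>e\<in>glued_edges r E B (f B). ennreal (edge_weight y \<psi> x e)"])
    fix B assume B: "B \<in> P"
    show "(\<lambda>x. \<Prod>e\<in>glued_edges r E B (f B). ennreal (edge_weight y \<psi> x e)) \<in> borel_measurable (PiM (f B) (\<lambda>_. N))"
      by (rule measurable_glued_weight[OF sets_N \<psi> fB[OF B]])
  qed
  finally show ?thesis .
qed

end

section \<open>Moments and cumulants of the subgraph count\<close>

definition node_vertex :: "nat \<Rightarrow> (nat \<Rightarrow> nat) \<Rightarrow> nat \<Rightarrow> node" where
  "node_vertex r \<alpha> j = (if j \<le> r then Pt (\<alpha> j) else Endpt (j - r))"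

fun relabel :: "('b \<Rightarrow> nat) \<Rightarrow> 'b + nat \<Rightarrow> node" where
  "relabel \<beta> (Inl b) = Pt (\<beta> b)"
| "relabel \<beta> (Inr k) = Endpt k"

definition tuple_of :: "nat \<Rightarrow> nat set \<Rightarrow> (nat \<times> nat) set set \<Rightarrow> ((nat \<times> nat) set \<Rightarrow> nat) \<Rightarrow> nat \<Rightarrow> nat \<Rightarrow> nat" where
  "tuple_of r A \<rho> \<beta> = (\<lambda>i\<in>A. \<lambda>j\<in>{1..r}. \<beta> (block_of \<rho> (i, j)))"

definition coincidences :: "nat \<Rightarrow> nat set \<Rightarrow> (nat \<Rightarrow> nat \<Rightarrow> nat) \<Rightarrow> (nat \<times> nat) set set" where
  "coincidences r A a = (\<lambda>p. {q \<in> A \<times> {1..r}. a (fst q) (snd q) = a (fst p) (snd p)}) ` (A \<times> {1..r})"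

lemma partition_on_coincidences: "partition_on (A \<times> {1..r}) (coincidences r A a)"
proof (rule partition_onI)
  show "disjnt p q" if "p \<in> coincidences r A a" "q \<in> coincidences r A a" "p \<noteq> q" for p q
    using that unfolding coincidences_def disjnt_def by force
qed (auto simp: coincidences_def)

lemma coincidences_NF_iff:
  "coincidences r A a \<in> NF r A \<longleftrightarrow> (\<forall>i\<in>A. inj_on (a i) {1..r})"
proof -
  have "(\<forall>b\<in>coincidences r A a. inj_on fst b) \<longleftrightarrow> (\<forall>i\<in>A. inj_on (a i) {1..r})"
  proof
    assume c: "\<forall>b\<in>coincidences r A a. inj_on fst b"
    show "\<forall>i\<in>A. inj_on (a i) {1..r}"
    proof (intro ballI inj_onI)
      fix i j j' assume i: "i \<in> A" "j \<in> {1..r}" "j' \<in> {1..r}" "a i j = a i j'"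
      let ?b = "{q \<in> A \<times> {1..r}. a (fst q) (snd q) = a i j}"
      have "?b = {q \<in> A \<times> {1..r}. a (fst q) (snd q) = a (fst (i, j)) (snd (i, j))}" by simp
      then have "?b \<in> coincidences r A a"
        unfolding coincidences_def by (rule image_eqI[where x = "(i, j)"]) (use i in auto)
      then have "inj_on fst ?b" using c by blast
      then show "j = j'" using i inj_onD[of fst ?b "(i, j)" "(i, j')"] by auto
    qed
  next
    assume c: "\<forall>i\<in>A. inj_on (a i) {1..r}"
    show "\<forall>b\<in>coincidences r A a. inj_on fst b"
    proof (intro ballI inj_onI)
      fix b p q assume b: "b \<in> coincidences r A a" "p \<in> b" "q \<in> b" "fst p = fst q"
      then obtain p0 where "b = {q \<in> A \<times> {1..r}. a (fst q) (snd q) = a (fst p0) (snd p0)}"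
        unfolding coincidences_def by blast
      then have pq: "p \<in> A \<times> {1..r}" "q \<in> A \<times> {1..r}" "a (fst p) (snd p) = a (fst q) (snd q)"
        using b(2,3) by simp_all
      then have "inj_on (a (fst p)) {1..r}" using c by (simp add: mem_Times_iff)
      then have "snd p = snd q" using pq b(4) by (auto simp: mem_Times_iff dest: inj_onD)
      then show "p = q" using b(4) by (simp add: prod_eq_iff)
    qed
  qed
  then show ?thesis using partition_on_coincidences by (simp add: NF_def)
qed

lemma block_of_coincidences:
  assumes "p \<in> A \<times> {1..r}"
  shows "block_of (coincidences r A a) p = {q \<in> A \<times> {1..r}. a (fst q) (snd q) = a (fst p) (snd p)}"
proof (rule block_of_eq[OF partition_on_coincidences])
  show "{q \<in> A \<times> {1..r}. a (fst q) (snd q) = a (fst p) (snd p)} \<in> coincidences r A a"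
    unfolding coincidences_def using assms by (rule imageI)
qed (use assms in simp)

text \<open>A family of index tuples, one per row, with pattern exactly \<rho> is a labelling of the
  blocks; injectivity says that no further coincidences occur. The inverse reads the label of a
  block at a chosen cell.\<close>

lemma bij_betw_tuple_of:
  assumes \<rho>: "partition_on (A \<times> {1..r}) \<rho>"
  shows "bij_betw (tuple_of r A \<rho>) {\<beta> \<in> \<rho> \<rightarrow>\<^sub>E UNIV. inj_on \<beta> \<rho>}
    {a \<in> A \<rightarrow>\<^sub>E ({1..r} \<rightarrow>\<^sub>E UNIV). coincidences r A a = \<rho>}"
proof -
  have val: "tuple_of r A \<rho> \<beta> (fst p) (snd p) = \<beta> (block_of \<rho> p)" if "p \<in> A \<times> {1..r}" for \<beta> p
    using that by (auto simp: tuple_of_def)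
  note blk = block_of_in[OF \<rho>]
  have ne: "\<exists>p\<in>A \<times> {1..r}. p \<in> b \<and> block_of \<rho> p = b" if "b \<in> \<rho>" for b
  proof -
    have "b \<noteq> {}" using \<rho> that by (auto simp: partition_on_def)
    then obtain p where "p \<in> b" by auto
    then show ?thesis using partition_on_mem[OF \<rho> that] block_of_eq[OF \<rho> that] by blast
  qed
  show ?thesis
    unfolding bij_betw_def
  proof (intro conjI)
    show "inj_on (tuple_of r A \<rho>) {\<beta> \<in> \<rho> \<rightarrow>\<^sub>E UNIV. inj_on \<beta> \<rho>}"
    proof (rule inj_onI)
      fix \<beta> \<beta>' assume \<beta>: "\<beta> \<in> {\<beta> \<in> \<rho> \<rightarrow>\<^sub>E UNIV. inj_on \<beta> \<rho>}" "\<beta>' \<in> {\<beta> \<in> \<rho> \<rightarrow>\<^sub>E UNIV. inj_on \<beta> \<rho>}"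
        and eq: "tuple_of r A \<rho> \<beta> = tuple_of r A \<rho> \<beta>'"
      have "\<beta> b = \<beta>' b" if "b \<in> \<rho>" for b
      proof -
        obtain p where "p \<in> A \<times> {1..r}" "block_of \<rho> p = b" using ne[OF \<open>b \<in> \<rho>\<close>] by auto
        then show ?thesis using val[of p \<beta>] val[of p \<beta>'] eq by simp
      qed
      then show "\<beta> = \<beta>'" using \<beta> by (intro PiE_ext[of \<beta> \<rho> "\<lambda>_. UNIV" \<beta>']) auto
    qed
    show "tuple_of r A \<rho> ` {\<beta> \<in> \<rho> \<rightarrow>\<^sub>E UNIV. inj_on \<beta> \<rho>} =
      {a \<in> A \<rightarrow>\<^sub>E ({1..r} \<rightarrow>\<^sub>E UNIV). coincidences r A a = \<rho>}"
    proof (intro set_eqI iffI)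
      fix a assume "a \<in> tuple_of r A \<rho> ` {\<beta> \<in> \<rho> \<rightarrow>\<^sub>E UNIV. inj_on \<beta> \<rho>}"
      then obtain \<beta> where \<beta>: "a = tuple_of r A \<rho> \<beta>" "inj_on \<beta> \<rho>" by auto
      have cl: "{q \<in> A \<times> {1..r}. a (fst q) (snd q) = a (fst p) (snd p)} = block_of \<rho> p"
        if p: "p \<in> A \<times> {1..r}" for p
      proof -
        have "a (fst q) (snd q) = a (fst p) (snd p) \<longleftrightarrow> q \<in> block_of \<rho> p" if q: "q \<in> A \<times> {1..r}" for q
        proof -
          have "a (fst q) (snd q) = a (fst p) (snd p) \<longleftrightarrow> \<beta> (block_of \<rho> q) = \<beta> (block_of \<rho> p)"
            unfolding \<beta>(1) val[OF p] val[OF q] ..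
          also have "\<dots> \<longleftrightarrow> block_of \<rho> q = block_of \<rho> p"
            using inj_on_eq_iff[OF \<beta>(2) blk(1)[OF q] blk(1)[OF p]] .
          also have "\<dots> \<longleftrightarrow> q \<in> block_of \<rho> p"
            using blk[OF p] blk[OF q] block_of_eq[OF \<rho>] by metis
          finally show ?thesis .
        qed
        moreover have "q \<in> A \<times> {1..r}" if "q \<in> block_of \<rho> p" for q
          using partition_on_mem[OF \<rho> blk(1)[OF p] that] .
        ultimately show ?thesis by blast
      qed
      have "coincidences r A a = block_of \<rho> ` (A \<times> {1..r})"
        unfolding coincidences_def using cl by (intro image_cong) auto
      also have "\<dots> = \<rho>" using blk(1) ne by blast
      finally have "coincidences r A a = \<rho>" .
      then show "a \<in> {a \<in> A \<rightarrow>\<^sub>E ({1..r} \<rightarrow>\<^sub>E UNIV). coincidences r A a = \<rho>}"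
        unfolding \<beta>(1) by (simp add: tuple_of_def)
    next
      fix a assume "a \<in> {a \<in> A \<rightarrow>\<^sub>E ({1..r} \<rightarrow>\<^sub>E UNIV). coincidences r A a = \<rho>}"
      then have a: "a \<in> A \<rightarrow>\<^sub>E ({1..r} \<rightarrow>\<^sub>E UNIV)" "coincidences r A a = \<rho>" by auto
      define pick where "pick b = (SOME p. p \<in> b)" for b :: "(nat \<times> nat) set"
      define \<beta> where "\<beta> = (\<lambda>b\<in>\<rho>. a (fst (pick b)) (snd (pick b)))"
      have \<beta>: "\<beta> (block_of \<rho> p) = a (fst p) (snd p)" if p: "p \<in> A \<times> {1..r}" for p
      proof -
        have "pick (block_of \<rho> p) \<in> block_of \<rho> p"
          unfolding pick_def using blk(2)[OF p] by (rule someI)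
        then show ?thesis
          using blk(1)[OF p] block_of_coincidences[OF p, of a] a(2) by (auto simp: \<beta>_def)
      qed
      have "inj_on \<beta> \<rho>"
      proof (rule inj_onI)
        fix b b' assume b: "b \<in> \<rho>" "b' \<in> \<rho>" "\<beta> b = \<beta> b'"
        obtain p p' where p: "p \<in> A \<times> {1..r}" "block_of \<rho> p = b" "p' \<in> A \<times> {1..r}" "block_of \<rho> p' = b'"
          using ne[OF b(1)] ne[OF b(2)] by auto
        then have "a (fst p) (snd p) = a (fst p') (snd p')" using \<beta>[of p] \<beta>[of p'] b(3) by simp
        then show "b = b'"
          using p block_of_coincidences[of p A r a] block_of_coincidences[of p' A r a] a(2) by simp
      qed
      moreover have "tuple_of r A \<rho> \<beta> = a"
      proof (intro ext)
        fix i j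
        show "tuple_of r A \<rho> \<beta> i j = a i j"
          using \<beta>[of "(i, j)"] a(1) by (auto simp: tuple_of_def PiE_iff extensional_def restrict_def)
      qed
      ultimately show "a \<in> tuple_of r A \<rho> ` {\<beta> \<in> \<rho> \<rightarrow>\<^sub>E UNIV. inj_on \<beta> \<rho>}"
        by (intro image_eqI[of _ _ \<beta>]) (auto simp: \<beta>_def)
    qed
  qed
qed

lemma inj_on_relabel: "inj_on \<beta> V \<Longrightarrow> inj_on (relabel \<beta>) (Inl ` V \<union> range Inr)"
proof (rule inj_onI)
  fix u v assume "inj_on \<beta> V" "u \<in> Inl ` V \<union> range Inr" "v \<in> Inl ` V \<union> range Inr" "relabel \<beta> u = relabel \<beta> v"
  then show "u = v" by (cases u; cases v) (auto dest: inj_onD)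
qed

lemma enn2real_prod: "enn2real (\<Prod>x\<in>S. f x) = (\<Prod>x\<in>S. enn2real (f x))"
  by (induction S rule: infinite_finite_induct) (auto simp: enn2real_mult)

lemma prod_of_bool: "finite S \<Longrightarrow> (\<Prod>x\<in>S. of_bool (P x)) = (of_bool (\<forall>x\<in>S. P x) :: real)"
  by (induction S rule: finite_induct) auto

section \<open>Moments in the random-connection model\<close>

locale rcm = poisson_points M \<tau> X \<nu> + endpoint_graph r m E
  for M :: "'w measure" and \<tau> and X :: "nat \<Rightarrow> 'w \<Rightarrow> 'a::topological_space" and \<nu> and r m E +
  fixes \<psi> :: "'a \<Rightarrow> 'a \<Rightarrow> real" and y :: "nat \<Rightarrow> 'a" and F :: "'w \<Rightarrow> node set set"
  assumes \<psi>01: "\<And>u v. 0 \<le> \<psi> u v" "\<And>u v. \<psi> u v \<le> 1"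
    and \<psi>_sym: "\<And>u v. \<psi> u v = \<psi> v u"
    and \<psi>_meas: "(\<lambda>(u, v). \<psi> u v) \<in> borel_measurable (borel \<Otimes>\<^sub>M borel)"
    and rcg: "random_connection_graph M \<psi> m y \<tau> X F"
begin

definition node_weight :: "'w \<Rightarrow> node set \<Rightarrow> real" where
  "node_weight \<omega> d = pairval (\<lambda>v w. \<psi> (location y X \<omega> v) (location y X \<omega> w)) d"

lemma node_weight_doubleton:
  "node_weight \<omega> {v, w} = \<psi> (location y X \<omega> v) (location y X \<omega> w)"
  unfolding node_weight_def by (rule pairval_doubleton) (rule \<psi>_sym)

lemma measurable_node_weight:
  assumes "card d = 2" shows "(\<lambda>\<omega>. node_weight \<omega> d) \<in> borel_measurable M"
proof -
  obtain v w where d: "d = {v, w}" using assms by (auto simp: card_2_iff)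
  have "(\<lambda>\<omega>. location y X \<omega> u) \<in> measurable M borel" for u by (cases u) auto
  then have "(\<lambda>\<omega>. (location y X \<omega> v, location y X \<omega> w)) \<in> measurable M (borel \<Otimes>\<^sub>M borel)"
    by (intro measurable_Pair)
  from measurable_compose[OF this \<psi>_meas] show ?thesis
    unfolding d node_weight_doubleton by simp
qed

lemma node_weight_01: "card d = 2 \<Longrightarrow> 0 \<le> node_weight \<omega> d \<and> node_weight \<omega> d \<le> 1"
  using \<psi>01 by (auto simp: card_2_iff node_weight_doubleton)

lemma sets_edge: "card d = 2 \<Longrightarrow> {\<omega> \<in> space M. d \<in> F \<omega>} \<in> sets M"
proof -
  assume "card d = 2"
  then obtain v w where d: "d = {v, w}" by (auto simp: card_2_iff)
  have "\<forall>v w. {\<omega> \<in> space M. {v, w} \<in> F \<omega>} \<in> sets M"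
    using rcg unfolding random_connection_graph_def by (elim conjE)
  then show ?thesis unfolding d by blast
qed

lemma F_subset_nodes:
  assumes "\<omega> \<in> space M" "d \<in> F \<omega>" shows "d \<subseteq> graph_nodes m \<tau> \<omega>"
proof -
  have "F \<omega> \<subseteq> {{v, w} | v w. v \<in> graph_nodes m \<tau> \<omega> \<and> w \<in> graph_nodes m \<tau> \<omega> \<and> v \<noteq> w}"
    using rcg assms(1) unfolding random_connection_graph_def by (elim conjE) (rule bspec)
  then show ?thesis using assms(2) by blast
qed

lemma sets_nodes: "{\<omega> \<in> space M. K \<subseteq> graph_nodes m \<tau> \<omega>} \<in> sets M"
proof -
  have "{\<omega> \<in> space M. K \<subseteq> graph_nodes m \<tau> \<omega>} =
    \<tau> -` {t. K \<subseteq> Pt ` point_indices t \<union> Endpt ` {1..m}} \<inter> space M"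
    by (auto simp: graph_nodes_def)
  also have "\<dots> \<in> sets M" by (rule measurable_sets[OF measurable_\<tau>]) simp
  finally show ?thesis .
qed

lemma sets_edges: "finite D \<Longrightarrow> (\<And>d. d \<in> D \<Longrightarrow> card d = 2) \<Longrightarrow> {\<omega> \<in> space M. D \<subseteq> F \<omega>} \<in> sets M"
proof -
  assume D: "finite D" "\<And>d. d \<in> D \<Longrightarrow> card d = 2"
  have "{\<omega> \<in> space M. \<forall>d\<in>D. d \<in> F \<omega>} \<in> sets M"
    using D sets_edge by (intro sets.sets_Collect_finite_All) auto
  then show ?thesis by (simp add: subset_eq)
qed

text \<open>The edge law with the trivial event \<open>C = UNIV\<close>. A present edge forces its
  ends to be nodes, so the restriction to nodes disappears on the left; on the right it stays, since
  \<open>X i\<close> is defined also for indices beyond \<tau>.\<close>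

lemma emeasure_edges:
  assumes D: "finite D" "\<And>d. d \<in> D \<Longrightarrow> card d = 2"
  shows "emeasure M {\<omega> \<in> space M. D \<subseteq> F \<omega>} =
    (\<integral>\<^sup>+\<omega>. indicator {\<omega> \<in> space M. \<Union>D \<subseteq> graph_nodes m \<tau> \<omega>} \<omega> * (\<Prod>d\<in>D. ennreal (node_weight \<omega> d)) \<partial>M)"
proof -
  \<comment> \<open>The edge law expects ordered pairs, each unordered pair at most once;
    \<open>pick\<close> fixes an orientation.\<close>
  define pick :: "node set \<Rightarrow> node \<times> node" where "pick d = (SOME p. d = {fst p, snd p})" for d
  have pick: "d = {fst (pick d), snd (pick d)}" if d: "d \<in> D" for d
  proof -
    obtain v w where "d = {v, w}" using D(2)[OF d] by (auto simp: card_2_iff)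
    then have "d = {fst (v, w), snd (v, w)}" by simp
    then show ?thesis unfolding pick_def by (rule someI)
  qed
  have ne: "fst (pick d) \<noteq> snd (pick d)" if d: "d \<in> D" for d
  proof
    assume "fst (pick d) = snd (pick d)"
    then have "d = {fst (pick d)}" using pick[OF d] by simp
    then have "card d = 1" by (metis card_1_singleton_iff One_nat_def)
    then show False using D(2)[OF d] by simp
  qed
  define S where "S = pick ` D"
  have pq: "{v, w} \<in> D" "pick {v, w} = (v, w)" if vw: "(v, w) \<in> S" for v w
  proof -
    obtain d where d: "d \<in> D" "(v, w) = pick d" using vw by (auto simp: S_def)
    then have "d = {v, w}" using pick[OF d(1)] by (metis fst_conv snd_conv)
    then show "{v, w} \<in> D" "pick {v, w} = (v, w)" using d by auto
  qed
  have S: "finite S" "\<forall>(v, w)\<in>S. v \<noteq> w" "inj_on (\<lambda>(v, w). {v, w}) S"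
  proof -
    show "finite S" using D by (simp add: S_def)
    have "v \<noteq> w" if "(v, w) \<in> S" for v w
      using ne[OF pq(1)[OF that]] unfolding pq(2)[OF that] by simp
    then show "\<forall>(v, w)\<in>S. v \<noteq> w" by blast
    show "inj_on (\<lambda>(v, w). {v, w}) S"
    proof (rule inj_onI, clarify)
      fix v w v' w' assume a: "(v, w) \<in> S" "(v', w') \<in> S" "{v, w} = {v', w'}"
      have "(v, w) = pick {v, w}" by (rule pq(2)[OF a(1), symmetric])
      also have "\<dots> = (v', w')" unfolding a(3) by (rule pq(2)[OF a(2)])
      finally have "(v, w) = (v', w')" .
      then show "v = v' \<and> w = w'" by simp
    qed
  qed
  have nodes: "fst ` S \<union> snd ` S = \<Union>D"
  proof -
    have "\<Union>D = (\<Union>d\<in>D. {fst (pick d), snd (pick d)})" using pick by blast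
    then show ?thesis by (auto simp: S_def)
  qed
  have all: "(\<forall>(v, w)\<in>S. {v, w} \<in> F \<omega>) \<longleftrightarrow> D \<subseteq> F \<omega>" for \<omega>
  proof
    assume s: "\<forall>(v, w)\<in>S. {v, w} \<in> F \<omega>"
    show "D \<subseteq> F \<omega>"
    proof
      fix d assume d: "d \<in> D"
      then have "(fst (pick d), snd (pick d)) \<in> S" by (simp add: S_def)
      then show "d \<in> F \<omega>" using s pick[OF d] by auto
    qed
  next
    assume "D \<subseteq> F \<omega>"
    then show "\<forall>(v, w)\<in>S. {v, w} \<in> F \<omega>" using pq(1) by auto
  qed
  define A where "A = {\<omega> \<in> space M. \<Union>D \<subseteq> graph_nodes m \<tau> \<omega>}"
  have A[measurable]: "A \<in> sets M" unfolding A_def by (rule sets_nodes)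
  have U: "(UNIV :: (enat \<times> (nat \<Rightarrow> 'a)) set) \<in> sets (count_space UNIV \<Otimes>\<^sub>M (\<Pi>\<^sub>M i\<in>UNIV. borel))"
    using sets.top[of "count_space (UNIV :: enat set) \<Otimes>\<^sub>M (\<Pi>\<^sub>M i\<in>(UNIV :: nat set). (borel :: 'a measure))"]
    by (simp add: space_pair_measure space_PiM PiE_UNIV_domain)
  have "\<forall>C. finite S \<and> (\<forall>(v, w)\<in>S. v \<noteq> w) \<and> inj_on (\<lambda>(v, w). {v, w}) S \<and>
         C \<in> sets (count_space UNIV \<Otimes>\<^sub>M (\<Pi>\<^sub>M i\<in>UNIV. borel)) \<longrightarrow>
       (let A = {\<omega> \<in> space M. (\<tau> \<omega>, \<lambda>i. X i \<omega>) \<in> C \<and> fst ` S \<union> snd ` S \<subseteq> graph_nodes m \<tau> \<omega>} in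
        measure M {\<omega> \<in> A. \<forall>(v, w)\<in>S. {v, w} \<in> F \<omega>} =
        (\<integral>\<omega>. indicator A \<omega> * (\<Prod>(v, w)\<in>S. \<psi> (location y X \<omega> v) (location y X \<omega> w)) \<partial>M))"
    using rcg unfolding random_connection_graph_def by (elim conjE) (rule spec)
  from this[rule_format, OF conjI[OF S(1) conjI[OF S(2) conjI[OF S(3) U]]]]
  have m: "measure M {\<omega> \<in> A. \<forall>(v, w)\<in>S. {v, w} \<in> F \<omega>} =
        (\<integral>\<omega>. indicator A \<omega> * (\<Prod>(v, w)\<in>S. \<psi> (location y X \<omega> v) (location y X \<omega> w)) \<partial>M)"
    unfolding nodes Let_def by (simp add: A_def)
  have prod: "(\<Prod>(v, w)\<in>S. \<psi> (location y X \<omega> v) (location y X \<omega> w)) = (\<Prod>d\<in>D. node_weight \<omega> d)" for \<omega>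
  proof (rule prod.reindex_bij_witness[where i = pick and j = "\<lambda>(v, w). {v, w}"])
    fix a assume a: "a \<in> S"
    obtain v w where vw: "a = (v, w)" by (cases a)
    show "pick (case a of (v, w) \<Rightarrow> {v, w}) = a" "(case a of (v, w) \<Rightarrow> {v, w}) \<in> D"
      using pq[of v w] a vw by auto
    show "node_weight \<omega> (case a of (v, w) \<Rightarrow> {v, w}) = (case a of (v, w) \<Rightarrow> \<psi> (location y X \<omega> v) (location y X \<omega> w))"
      by (simp add: vw node_weight_doubleton)
  next
    fix d assume d: "d \<in> D"
    show "(case pick d of (v, w) \<Rightarrow> {v, w}) = d" using pick[OF d] by (simp add: case_prod_unfold)
    show "pick d \<in> S" using d by (simp add: S_def)
  qed
  have set_eq: "{\<omega> \<in> A. \<forall>(v, w)\<in>S. {v, w} \<in> F \<omega>} = {\<omega> \<in> space M. D \<subseteq> F \<omega>}"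
  proof -
    have "\<Union>D \<subseteq> graph_nodes m \<tau> \<omega>" if "\<omega> \<in> space M" "D \<subseteq> F \<omega>" for \<omega>
      using F_subset_nodes[OF that(1)] that(2) by blast
    then show ?thesis unfolding all A_def by blast
  qed
  let ?g = "\<lambda>\<omega>. indicator A \<omega> * (\<Prod>d\<in>D. node_weight \<omega> d)"
  have meas: "?g \<in> borel_measurable M"
    using D(2) by (intro borel_measurable_times borel_measurable_prod measurable_node_weight) auto
  have g01: "0 \<le> ?g \<omega> \<and> ?g \<omega> \<le> 1" for \<omega>
    using D(2) node_weight_01 by (auto simp: indicator_def intro!: prod_nonneg prod_le_1)
  have int: "integrable M ?g"
    using g01 by (intro integrable_const_bound[of _ 1] meas) (auto simp: abs_le_iff)
  have "emeasure M {\<omega> \<in> space M. D \<subseteq> F \<omega>} = ennreal (\<integral>\<omega>. ?g \<omega> \<partial>M)"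
    using m unfolding set_eq prod by (simp add: emeasure_eq_measure)
  also have "\<dots> = (\<integral>\<^sup>+\<omega>. ennreal (?g \<omega>) \<partial>M)"
    using nn_integral_eq_integral[OF int] g01 by simp
  also have "\<dots> = (\<integral>\<^sup>+\<omega>. indicator A \<omega> * (\<Prod>d\<in>D. ennreal (node_weight \<omega> d)) \<partial>M)"
    using D(2) node_weight_01 by (intro nn_integral_cong)
      (simp add: ennreal_mult' prod_ennreal indicator_def)
  finally show ?thesis unfolding A_def .
qed

text \<open>An injective labelling sends distinct glued edges to distinct edges of the random graph,
  so each gives one factor. Every block lies on a glued edge; hence the ends of the edges are nodes
  exactly when all labels are indices of points, which is the event
  \<open>tuples \<rho> \<beta>\<close>.\<close>

lemma emeasure_glued_edges:
  assumes A: "finite A" and \<rho>: "\<rho> \<in> NF r A" and \<beta>: "inj_on \<beta> \<rho>"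
  defines "D \<equiv> (\<lambda>e. relabel \<beta> ` e) ` glued_edges r E A \<rho>"
  shows "emeasure M {\<omega> \<in> space M. D \<subseteq> F \<omega>} = (\<integral>\<^sup>+\<omega>. indicator (tuples \<rho> \<beta>) \<omega> *
    (\<Prod>e\<in>glued_edges r E A \<rho>. ennreal (edge_weight y \<psi> (\<lambda>b\<in>\<rho>. X (\<beta> b) \<omega>) e)) \<partial>M)"
proof -
  let ?G = "glued_edges r E A \<rho>"
  have P: "partition_on (A \<times> {1..r}) \<rho>" using \<rho> by (simp add: NF_def)
  have inj: "inj_on (relabel \<beta>) (Inl ` \<rho> \<union> range Inr)" using inj_on_relabel[OF \<beta>] .
  have sub: "e \<subseteq> Inl ` \<rho> \<union> range Inr" if "e \<in> ?G" for e
    using glued_edge(2)[OF \<rho> that] by blast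
  have card: "card (relabel \<beta> ` e) = 2" if e: "e \<in> ?G" for e
    using inj_on_subset[OF inj sub[OF e]] glued_edge(1)[OF \<rho> e] by (simp add: card_image)
  have inj': "inj_on (\<lambda>e. relabel \<beta> ` e) ?G"
    using inj_on_image[of "relabel \<beta>" ?G] inj_on_subset[OF inj] sub by (metis Union_least)
  have finG: "finite ?G" using A by (rule finite_glued_edges)
  have w: "node_weight \<omega> (relabel \<beta> ` e) = edge_weight y \<psi> (\<lambda>b\<in>\<rho>. X (\<beta> b) \<omega>) e" if e: "e \<in> ?G" for e \<omega>
  proof -
    obtain u v where uv: "e = {u, v}" using glued_edge(1)[OF \<rho> e] by (auto simp: card_2_iff)
    have loc: "location y X \<omega> (relabel \<beta> z) = position y (\<lambda>b\<in>\<rho>. X (\<beta> b) \<omega>) z" if "z \<in> e" for z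
      using sub[OF e] that by (cases z) auto
    have "relabel \<beta> ` e = {relabel \<beta> u, relabel \<beta> v}" unfolding uv by simp
    then have "node_weight \<omega> (relabel \<beta> ` e) = \<psi> (location y X \<omega> (relabel \<beta> u)) (location y X \<omega> (relabel \<beta> v))"
      by (simp only: node_weight_doubleton)
    also have "\<dots> = edge_weight y \<psi> (\<lambda>b\<in>\<rho>. X (\<beta> b) \<omega>) {u, v}"
      unfolding edge_weight_doubleton[OF \<psi>_sym] using loc[of u] loc[of v] uv by simp
    finally show ?thesis unfolding uv .
  qed
  have "\<Union>D \<subseteq> graph_nodes m \<tau> \<omega> \<longleftrightarrow> \<beta> ` \<rho> \<subseteq> point_indices (\<tau> \<omega>)" for \<omega>
  proof
    assume a: "\<Union>D \<subseteq> graph_nodes m \<tau> \<omega>"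
    show "\<beta> ` \<rho> \<subseteq> point_indices (\<tau> \<omega>)"
    proof (rule image_subsetI)
      fix b assume b: "b \<in> \<rho>"
      then have "b \<noteq> {}" using P by (auto simp: partition_on_def)
      then obtain i j where ij: "(i, j) \<in> b" by fast
      then have A: "i \<in> A" "j \<in> {1..r}" using partition_on_mem[OF P b] by auto
      then obtain e where e: "e \<in> E" "j \<in> e" using vertex_in_edge by blast
      have "Inl b \<in> lift_vertex r \<rho> i ` e"
        using block_of_eq[OF P b ij] A(2) by (intro image_eqI[OF _ e(2)]) (simp add: lift_vertex_def)
      then have "Pt (\<beta> b) \<in> relabel \<beta> ` lift_vertex r \<rho> i ` e"
        by (metis imageI relabel.simps(1))
      moreover have "lift_vertex r \<rho> i ` e \<in> ?G" using e A unfolding glued_edges_def by blast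
      ultimately have "Pt (\<beta> b) \<in> \<Union>D" unfolding D_def by blast
      then have "Pt (\<beta> b) \<in> graph_nodes m \<tau> \<omega>" using a by blast
      then show "\<beta> b \<in> point_indices (\<tau> \<omega>)" by (auto simp: graph_nodes_def)
    qed
  next
    assume a: "\<beta> ` \<rho> \<subseteq> point_indices (\<tau> \<omega>)"
    have "relabel \<beta> z \<in> graph_nodes m \<tau> \<omega>" if "z \<in> Inl ` \<rho> \<union> Inr ` {1..m}" for z
      using that a by (auto simp: graph_nodes_def)
    then show "\<Union>D \<subseteq> graph_nodes m \<tau> \<omega>"
      unfolding D_def using glued_edge(2)[OF \<rho>] by blast
  qed
  then have "{\<omega> \<in> space M. \<Union>D \<subseteq> graph_nodes m \<tau> \<omega>} = tuples \<rho> \<beta>"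
    using \<beta> by (simp add: tuples_def)
  moreover have "(\<Prod>d\<in>D. ennreal (node_weight \<omega> d)) =
    (\<Prod>e\<in>?G. ennreal (edge_weight y \<psi> (\<lambda>b\<in>\<rho>. X (\<beta> b) \<omega>) e))" for \<omega>
    unfolding D_def by (subst prod.reindex[OF inj']) (simp add: w cong: prod.cong)
  moreover have "finite D" "\<And>d. d \<in> D \<Longrightarrow> card d = 2" using finG card by (auto simp: D_def)
  ultimately show ?thesis using emeasure_edges[of D] by simp
qed


text \<open>The indices range over all of \<open>nat\<close>; presence of the edges forces them into
  \<open>point_indices\<close>, see \<open>copies_indices\<close>. An index set that does not depend
  on \<omega> allows sums and expectations to be exchanged.\<close>

definition copies :: "'w \<Rightarrow> (nat \<Rightarrow> nat) set" where
  "copies \<omega> = {\<alpha> \<in> {1..r} \<rightarrow>\<^sub>E UNIV. inj_on \<alpha> {1..r} \<and> (\<forall>e\<in>E. node_vertex r \<alpha> ` e \<in> F \<omega>)}"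

lemma copies_indices:
  assumes "\<omega> \<in> space M" "\<alpha> \<in> copies \<omega>" "j \<in> {1..r}" shows "\<alpha> j \<in> point_indices (\<tau> \<omega>)"
proof -
  obtain e where e: "e \<in> E" "j \<in> e" using vertex_in_edge[OF assms(3)] by blast
  have "node_vertex r \<alpha> ` e \<in> F \<omega>" using assms(2) e(1) by (simp add: copies_def)
  then have "node_vertex r \<alpha> ` e \<subseteq> graph_nodes m \<tau> \<omega>" by (rule F_subset_nodes[OF assms(1)])
  then have "node_vertex r \<alpha> j \<in> graph_nodes m \<tau> \<omega>" using e(2) by blast
  then show ?thesis using assms(3) by (auto simp: node_vertex_def graph_nodes_def)
qed

lemma edges_iff:
  "(\<forall>e\<in>induced_edges {1..r} E. (\<lambda>i. Pt (\<alpha> i)) ` e \<in> F \<omega>) \<and>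
   (\<forall>p\<in>{(i, j). i \<in> {1..r} \<and> j \<in> {1..m} \<and> {r + j, i} \<in> E}. {Endpt (snd p), Pt (\<alpha> (fst p))} \<in> F \<omega>) \<longleftrightarrow>
   (\<forall>e\<in>E. node_vertex r \<alpha> ` e \<in> F \<omega>)"
proof (intro iffI conjI ballI)
  fix e assume e: "e \<in> E" and a: "(\<forall>e\<in>induced_edges {1..r} E. (\<lambda>i. Pt (\<alpha> i)) ` e \<in> F \<omega>) \<and>
   (\<forall>p\<in>{(i, j). i \<in> {1..r} \<and> j \<in> {1..m} \<and> {r + j, i} \<in> E}. {Endpt (snd p), Pt (\<alpha> (fst p))} \<in> F \<omega>)"
  from e show "node_vertex r \<alpha> ` e \<in> F \<omega>"
  proof (cases rule: edge_cases)
    case (inner j1 j2)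
    then have "e \<in> induced_edges {1..r} E" using e by (simp add: induced_edges_def)
    then have "(\<lambda>i. Pt (\<alpha> i)) ` e \<in> F \<omega>" using a by blast
    then show ?thesis using inner by (simp add: node_vertex_def)
  next
    case (endpoint j k)
    then have "{r + k, j} \<in> E" using e by (simp add: insert_commute)
    then have "(j, k) \<in> {(i, j). i \<in> {1..r} \<and> j \<in> {1..m} \<and> {r + j, i} \<in> E}" using endpoint by simp
    then have "{Endpt k, Pt (\<alpha> j)} \<in> F \<omega>" using a by fastforce
    then show ?thesis using endpoint by (simp add: node_vertex_def insert_commute)
  qed
next
  fix e assume a: "\<forall>e\<in>E. node_vertex r \<alpha> ` e \<in> F \<omega>" and e: "e \<in> induced_edges {1..r} E"
  then have "node_vertex r \<alpha> ` e \<in> F \<omega>" by (simp add: induced_edges_def)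
  moreover have "node_vertex r \<alpha> ` e = (\<lambda>i. Pt (\<alpha> i)) ` e"
    using e by (intro image_cong) (auto simp: induced_edges_def node_vertex_def)
  ultimately show "(\<lambda>i. Pt (\<alpha> i)) ` e \<in> F \<omega>" by (simp only:)
next
  fix p assume a: "\<forall>e\<in>E. node_vertex r \<alpha> ` e \<in> F \<omega>"
    and p: "p \<in> {(i, j). i \<in> {1..r} \<and> j \<in> {1..m} \<and> {r + j, i} \<in> E}"
  obtain i j where ij: "p = (i, j)" by (cases p)
  then have "node_vertex r \<alpha> ` {r + j, i} \<in> F \<omega>" "i \<le> r" "j \<ge> 1" using a p by auto
  then show "{Endpt (snd p), Pt (\<alpha> (fst p))} \<in> F \<omega>" by (simp add: ij node_vertex_def)
qed

lemma subgraph_count_eq: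
  assumes \<omega>: "\<omega> \<in> space M" shows "subgraph_count r m E \<tau> F \<omega> = real (card (copies \<omega>))"
proof -
  let ?A = "{\<alpha> \<in> {1..r} \<rightarrow>\<^sub>E point_indices (\<tau> \<omega>). inj_on \<alpha> {1..r}}"
  let ?Q = "{(i, j). i \<in> {1..r} \<and> j \<in> {1..m} \<and> {r + j, i} \<in> E}"
  have finQ: "finite ?Q" by (rule finite_subset[of _ "{1..r} \<times> {1..m}"]) auto
  have finI: "finite (induced_edges {1..r} E)" using finite_E by (simp add: induced_edges_def)
  have factors: "(\<Prod>e\<in>induced_edges {1..r} E. of_bool ((\<lambda>i. Pt (\<alpha> i)) ` e \<in> F \<omega>)) *
        (\<Prod>(i, j)\<in>?Q. of_bool ({Endpt j, Pt (\<alpha> i)} \<in> F \<omega>)) =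
        (of_bool (\<forall>e\<in>E. node_vertex r \<alpha> ` e \<in> F \<omega>) :: real)" for \<alpha>
    unfolding case_prod_unfold prod_of_bool[OF finI] prod_of_bool[OF finQ[unfolded case_prod_unfold]] of_bool_conj[symmetric]
    using edges_iff[of \<alpha> \<omega>] by (simp add: case_prod_unfold)
  have sub: "copies \<omega> \<subseteq> ?A"
    using copies_indices[OF \<omega>] by (auto simp: copies_def PiE_iff)
  have "subgraph_count r m E \<tau> F \<omega> = infsum (\<lambda>\<alpha>. of_bool (\<forall>e\<in>E. node_vertex r \<alpha> ` e \<in> F \<omega>)) ?A"
    unfolding subgraph_count_def factors ..
  also have "\<dots> = infsum (\<lambda>_. 1 :: real) (copies \<omega>)"
    using sub by (intro infsum_cong_neutral) (auto simp: copies_def)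
  \<comment> \<open>If there are infinitely many copies, both sides take the default value
    0.\<close>
  also have "\<dots> = real (card (copies \<omega>))"
    using infsum_diverge_constant[of "copies \<omega>" "1 :: real"]
    by (cases "finite (copies \<omega>)") (auto simp: infsum_not_exists)
  finally show ?thesis .
qed

definition copy_event :: "(nat \<Rightarrow> nat) \<Rightarrow> 'w set" where
  "copy_event \<alpha> = {\<omega> \<in> space M. inj_on \<alpha> {1..r} \<and> (\<forall>e\<in>E. node_vertex r \<alpha> ` e \<in> F \<omega>)}"

lemma sets_copy_event[measurable]: "copy_event \<alpha> \<in> sets M"
proof (cases "inj_on \<alpha> {1..r}")
  case True
  have inj: "inj_on (node_vertex r \<alpha>) {1..r+m}"
  proof (rule inj_onI)
    fix i j assume "i \<in> {1..r+m}" "j \<in> {1..r+m}" "node_vertex r \<alpha> i = node_vertex r \<alpha> j"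
    then show "i = j"
      using inj_onD[OF True, of i j] by (cases "i \<le> r"; cases "j \<le> r") (simp_all add: node_vertex_def)
  qed
  have "card d = 2" if "d \<in> (\<lambda>e. node_vertex r \<alpha> ` e) ` E" for d
  proof -
    obtain e where e: "e \<in> E" "d = node_vertex r \<alpha> ` e" using \<open>d \<in> _\<close> by auto
    have "e \<subseteq> {1..r+m}" using edge_vertex[OF e(1)] by blast
    then show ?thesis using inj_on_subset[OF inj] card_edge[OF e(1)] e(2) by (simp add: card_image)
  qed
  then have "{\<omega> \<in> space M. (\<lambda>e. node_vertex r \<alpha> ` e) ` E \<subseteq> F \<omega>} \<in> sets M"
    using finite_E by (intro sets_edges) auto
  then show ?thesis using True by (simp add: copy_event_def image_subset_iff)
qed (simp add: copy_event_def)

text \<open>The count in \<open>ennreal\<close>, which keeps the value \<infinity> where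
  \<open>subgraph_count\<close> falls back to 0. Its moments can be computed before integrability is
  known.\<close>

definition copies_number :: "'w \<Rightarrow> ennreal" where
  "copies_number \<omega> = (\<integral>\<^sup>+\<alpha>. indicator (copy_event \<alpha>) \<omega> \<partial>count_space ({1..r} \<rightarrow>\<^sub>E UNIV))"

lemma copies_number_eq:
  assumes "\<omega> \<in> space M" shows "copies_number \<omega> = emeasure (count_space UNIV) (copies \<omega>)"
proof -
  have "copies_number \<omega> = (\<integral>\<^sup>+\<alpha>. indicator (copies \<omega>) \<alpha> \<partial>count_space ({1..r} \<rightarrow>\<^sub>E UNIV))"
    unfolding copies_number_def using assms
    by (intro nn_integral_cong) (auto simp: copies_def copy_event_def indicator_def)
  also have "\<dots> = emeasure (count_space ({1..r} \<rightarrow>\<^sub>E UNIV)) (copies \<omega>)"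
    by (rule nn_integral_indicator) (auto simp: copies_def)
  also have "\<dots> = emeasure (count_space UNIV) (copies \<omega>)"
    by (subst (1 2) emeasure_count_space) (auto simp: copies_def)
  finally show ?thesis .
qed

lemma countable_tuples: "countable ({1..r} \<rightarrow>\<^sub>E (UNIV :: nat set))"
  by (intro countable_PiE) auto

lemma measurable_copies_number[measurable]: "copies_number \<in> borel_measurable M"
proof -
  have "(\<lambda>p. indicator (copy_event (fst p)) (snd p) :: ennreal)
    \<in> borel_measurable (count_space ({1..r} \<rightarrow>\<^sub>E UNIV) \<Otimes>\<^sub>M M)"
    by (rule measurable_pair_measure_countable1[OF countable_tuples]) simp
  then have "(\<lambda>(\<omega>, \<alpha>). indicator (copy_event \<alpha>) \<omega> :: ennreal)
    \<in> borel_measurable (M \<Otimes>\<^sub>M count_space ({1..r} \<rightarrow>\<^sub>E UNIV))"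
    by (subst measurable_pair_swap_iff) (simp add: case_prod_unfold)
  then show ?thesis
    unfolding copies_number_def
    by (intro sigma_finite_measure.borel_measurable_nn_integral
      sigma_finite_measure_count_space_countable countable_tuples)
qed

text \<open>The power of the count is a sum over families of \<open>card A\<close> index tuples.
  Families with a repeated index inside a row contribute 0; the others are classified by their
  pattern \<rho>, and the sum over the injective labellings of the blocks of \<rho> is the one in
  Campbell's formula.\<close>

lemma moment_graph_weight:
  assumes A: "finite A"
  shows "(\<integral>\<^sup>+\<omega>. copies_number \<omega> ^ card A \<partial>M) =
    (\<Sum>\<rho>\<in>NF r A. graph_weight y \<psi> \<nu> \<rho> (glued_edges r E A \<rho>))"
proof -
  let ?S = "{1..r} \<rightarrow>\<^sub>E (UNIV :: nat set)"
  let ?T = "A \<rightarrow>\<^sub>E ?S"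
  \<comment> \<open>A power of a sum becomes a sum over families through the finite product of the
    counting measure on tuples; by countability this product is again a counting measure.\<close>
  interpret S: product_sigma_finite "\<lambda>_ :: nat. count_space ?S"
    by (intro product_sigma_finite.intro sigma_finite_measure_count_space_countable countable_tuples)
  have cT: "countable ?T" using A countable_tuples by (intro countable_PiE) auto
  define wt where "wt a = emeasure M {\<omega> \<in> space M. \<forall>i\<in>A. \<omega> \<in> copy_event (a i)}" for a
  have wt: "(\<integral>\<^sup>+\<omega>. (\<Prod>i\<in>A. indicator (copy_event (a i)) \<omega>) \<partial>M) = wt a" for a
  proof -
    have "(\<Prod>i\<in>A. indicator (copy_event (a i)) \<omega>) = (indicator {\<omega> \<in> space M. \<forall>i\<in>A. \<omega> \<in> copy_event (a i)} \<omega> :: ennreal)"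
      if "\<omega> \<in> space M" for \<omega>
      using A that by (induction A rule: finite_induct) (auto simp: indicator_def)
    then have "(\<integral>\<^sup>+\<omega>. (\<Prod>i\<in>A. indicator (copy_event (a i)) \<omega>) \<partial>M) =
      (\<integral>\<^sup>+\<omega>. indicator {\<omega> \<in> space M. \<forall>i\<in>A. \<omega> \<in> copy_event (a i)} \<omega> \<partial>M)"
      by (rule nn_integral_cong)
    also have "\<dots> = wt a"
      unfolding wt_def
      by (intro nn_integral_indicator sets.sets_Collect_finite_All A) (simp add: Collect_conj_eq[symmetric])
    finally show ?thesis .
  qed
  have "(\<integral>\<^sup>+\<omega>. copies_number \<omega> ^ card A \<partial>M) =
    (\<integral>\<^sup>+\<omega>. \<integral>\<^sup>+a. (\<Prod>i\<in>A. indicator (copy_event (a i)) \<omega>) \<partial>count_space ?T \<partial>M)"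
  proof (rule nn_integral_cong)
    fix \<omega>
    have "copies_number \<omega> ^ card A = (\<Prod>i\<in>A. \<integral>\<^sup>+\<alpha>. indicator (copy_event \<alpha>) \<omega> \<partial>count_space ?S)"
      by (simp add: copies_number_def)
    also have "\<dots> = (\<integral>\<^sup>+a. (\<Prod>i\<in>A. indicator (copy_event (a i)) \<omega>) \<partial>PiM A (\<lambda>_. count_space ?S))"
      by (rule S.product_nn_integral_prod[OF A, symmetric]) simp
    also have "PiM A (\<lambda>_. count_space ?S) = count_space ?T"
      by (rule count_space_PiM_finite[OF A countable_tuples])
    finally show "copies_number \<omega> ^ card A =
      (\<integral>\<^sup>+a. (\<Prod>i\<in>A. indicator (copy_event (a i)) \<omega>) \<partial>count_space ?T)" .
  qed
  also have "\<dots> = (\<integral>\<^sup>+a. wt a \<partial>count_space ?T)"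
    unfolding wt[symmetric]
    by (intro nn_integral_count_space_nn_integral[OF cT] borel_measurable_prod_ennreal borel_measurable_indicator sets_copy_event)
  also have "\<dots> = (\<integral>\<^sup>+a. (\<Sum>\<rho>\<in>NF r A. wt a * indicator {a. coincidences r A a = \<rho>} a) \<partial>count_space ?T)"
  proof (rule nn_integral_cong)
    fix a
    have finNF: "finite (NF r A)" using A by (rule finite_NF)
    show "wt a = (\<Sum>\<rho>\<in>NF r A. wt a * indicator {a. coincidences r A a = \<rho>} a)"
    proof (cases "coincidences r A a \<in> NF r A")
      case True
      have "(\<Sum>\<rho>\<in>NF r A. wt a * indicator {a. coincidences r A a = \<rho>} a) =
        (\<Sum>\<rho>\<in>NF r A. if \<rho> = coincidences r A a then wt a else 0)"
        by (intro sum.cong) (auto simp: indicator_def)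
      then show ?thesis using True finNF by (simp add: sum.delta)
    next
      case False
      then obtain i where i: "i \<in> A" "\<not> inj_on (a i) {1..r}" using coincidences_NF_iff by blast
      then have "{\<omega> \<in> space M. \<forall>i\<in>A. \<omega> \<in> copy_event (a i)} = {}" by (auto simp: copy_event_def)
      then have "wt a = 0" unfolding wt_def by (simp only: emeasure_empty)
      then show ?thesis by simp
    qed
  qed
  also have "\<dots> = (\<Sum>\<rho>\<in>NF r A. \<integral>\<^sup>+a. wt a * indicator {a. coincidences r A a = \<rho>} a \<partial>count_space ?T)"
    by (rule nn_integral_sum) simp
  also have "\<dots> = (\<Sum>\<rho>\<in>NF r A. graph_weight y \<psi> \<nu> \<rho> (glued_edges r E A \<rho>))"
  proof (rule sum.cong[OF refl])
    fix \<rho> assume \<rho>: "\<rho> \<in> NF r A"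
    then have P: "partition_on (A \<times> {1..r}) \<rho>" by (simp add: NF_def)
    have fin\<rho>: "finite \<rho>" using finite_elements[OF _ P] A by simp
    let ?B = "{\<beta> \<in> \<rho> \<rightarrow>\<^sub>E (UNIV :: nat set). inj_on \<beta> \<rho>}"
    let ?f = "\<lambda>x. \<Prod>e\<in>glued_edges r E A \<rho>. ennreal (edge_weight y \<psi> x e)"
    have "(\<integral>\<^sup>+a. wt a * indicator {a. coincidences r A a = \<rho>} a \<partial>count_space ?T) =
      (\<integral>\<^sup>+a. wt a * indicator {a. coincidences r A a = \<rho>} a \<partial>count_space {a \<in> ?T. coincidences r A a = \<rho>})"
      by (rule nn_integral_count_space_eq) auto
    also have "\<dots> = (\<integral>\<^sup>+a. wt a \<partial>count_space {a \<in> ?T. coincidences r A a = \<rho>})"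
      by (rule nn_integral_cong) simp
    also have "\<dots> = (\<integral>\<^sup>+\<beta>. wt (tuple_of r A \<rho> \<beta>) \<partial>count_space ?B)"
      by (rule nn_integral_bij_count_space[OF bij_betw_tuple_of[OF P], symmetric])
    also have "\<dots> = (\<integral>\<^sup>+\<beta>. \<integral>\<^sup>+\<omega>. indicator (tuples \<rho> \<beta>) \<omega> * ?f (\<lambda>b\<in>\<rho>. X (\<beta> b) \<omega>) \<partial>M \<partial>count_space ?B)"
    proof (rule nn_integral_cong)
      fix \<beta> assume "\<beta> \<in> space (count_space ?B)"
      then have \<beta>: "inj_on \<beta> \<rho>" "\<beta> \<in> ?B" by auto
      let ?a = "tuple_of r A \<rho> \<beta>"
      have "?a \<in> {a \<in> ?T. coincidences r A a = \<rho>}"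
        using bij_betw_apply[OF bij_betw_tuple_of[OF P] \<beta>(2)] .
      then have inj: "\<forall>i\<in>A. inj_on (?a i) {1..r}" using coincidences_NF_iff[of r A ?a] \<rho> by simp
      have nv: "node_vertex r (?a i) ` e = relabel \<beta> ` lift_vertex r \<rho> i ` e" if "i \<in> A" "e \<in> E" for i e
        unfolding image_image
      proof (rule image_cong[OF refl])
        fix j assume "j \<in> e"
        then have "j \<in> {1..r+m}" using edge_vertex[OF that(2)] by blast
        then show "node_vertex r (?a i) j = relabel \<beta> (lift_vertex r \<rho> i j)"
          using that(1) by (auto simp: node_vertex_def lift_vertex_def tuple_of_def)
      qed
      have "(\<forall>i\<in>A. \<omega> \<in> copy_event (?a i)) \<longleftrightarrow> (\<lambda>e. relabel \<beta> ` e) ` glued_edges r E A \<rho> \<subseteq> F \<omega>"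
        if "\<omega> \<in> space M" for \<omega>
      proof -
        have "(\<forall>i\<in>A. \<omega> \<in> copy_event (?a i)) \<longleftrightarrow> (\<forall>i\<in>A. \<forall>e\<in>E. relabel \<beta> ` lift_vertex r \<rho> i ` e \<in> F \<omega>)"
          using inj that nv by (simp add: copy_event_def)
        then show ?thesis by (simp add: glued_edges_def image_subset_iff)
      qed
      then have "{\<omega> \<in> space M. \<forall>i\<in>A. \<omega> \<in> copy_event (?a i)} =
        {\<omega> \<in> space M. (\<lambda>e. relabel \<beta> ` e) ` glued_edges r E A \<rho> \<subseteq> F \<omega>}" by blast
      then show "wt ?a = (\<integral>\<^sup>+\<omega>. indicator (tuples \<rho> \<beta>) \<omega> * ?f (\<lambda>b\<in>\<rho>. X (\<beta> b) \<omega>) \<partial>M)"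
        unfolding wt_def using emeasure_glued_edges[OF A \<rho> \<beta>(1)] by simp
    qed
    \<comment> \<open>\<open>tuples \<rho> \<beta>\<close> is empty for a non-injective \<beta>, so
      the labellings added here contribute 0.\<close>
    also have "\<dots> = (\<integral>\<^sup>+\<beta>. \<integral>\<^sup>+\<omega>. indicator (tuples \<rho> \<beta>) \<omega> * ?f (\<lambda>b\<in>\<rho>. X (\<beta> b) \<omega>) \<partial>M \<partial>count_space (\<rho> \<rightarrow>\<^sub>E UNIV))"
      by (rule nn_integral_count_space_eq) (auto simp: tuples_def)
    also have "\<dots> = integral\<^sup>N (PiM \<rho> (\<lambda>_. \<nu>)) ?f"
      by (rule campbell[OF fin\<rho>]) (rule measurable_glued_weight[OF refl \<psi>_meas \<psi>_sym \<rho>])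
    finally show "(\<integral>\<^sup>+a. wt a * indicator {a. coincidences r A a = \<rho>} a \<partial>count_space ?T) =
      graph_weight y \<psi> \<nu> \<rho> (glued_edges r E A \<rho>)" by (simp add: graph_weight_def)
  qed
  finally show ?thesis .
qed

theorem cumulant_eq_sum_CNF:
  assumes n: "n \<ge> 1"
    and fin: "\<And>B \<rho>. B \<subseteq> {1..n} \<Longrightarrow> \<rho> \<in> NF r B \<Longrightarrow> graph_weight y \<psi> \<nu> \<rho> (glued_edges r E B \<rho>) < \<infinity>"
  shows "cumulant M (subgraph_count r m E \<tau> F) n =
    (\<Sum>\<rho>\<in>CNF n r. enn2real (graph_weight y \<psi> \<nu> \<rho> (glued_edges r E {1..n} \<rho>)))"
proof -
  \<comment> \<open>\<open>moments_to_cumulant\<close> takes one weight function for all row sets,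
    so the rows are recovered from \<rho> by projection; this works because \<open>{1..r}\<close> is
    nonempty.\<close>
  define w where "w \<rho> = graph_weight y \<psi> \<nu> \<rho> (glued_edges r E (fst ` \<Union>\<rho>) \<rho>)" for \<rho>
  have rows: "fst ` \<Union>\<rho> = B" if "\<rho> \<in> NF r B" for \<rho> B
  proof -
    have "\<Union>\<rho> = B \<times> {1..r}" using that by (simp add: NF_def partition_on_def)
    then show ?thesis using r2 by simp
  qed
  have w: "w \<rho> = graph_weight y \<psi> \<nu> \<rho> (glued_edges r E B \<rho>)" if "\<rho> \<in> NF r B" for \<rho> B
    unfolding w_def rows[OF that] ..
  have moment: "(\<integral>\<omega>. subgraph_count r m E \<tau> F \<omega> ^ card B \<partial>M) = (\<Sum>\<rho>\<in>NF r B. enn2real (w \<rho>))"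
    if B: "B \<subseteq> {1..n}" "B \<noteq> {}" for B
  proof -
    have finB: "finite B" using B(1) by (rule finite_subset) simp
    have cB: "card B \<noteq> 0" using finB B by simp
    have mom: "(\<integral>\<^sup>+\<omega>. copies_number \<omega> ^ card B \<partial>M) = (\<Sum>\<rho>\<in>NF r B. w \<rho>)"
      unfolding moment_graph_weight[OF finB] by (intro sum.cong refl w[symmetric])
    have wfin: "w \<rho> < \<infinity>" if "\<rho> \<in> NF r B" for \<rho> using fin[OF B(1) that] w[OF that] by simp
    have less: "(\<Sum>\<rho>\<in>NF r B. w \<rho>) < \<infinity>" using wfin finite_NF[OF finB] by simp
    have "AE \<omega> in M. copies_number \<omega> ^ card B \<noteq> \<infinity>"
      using less mom by (intro nn_integral_PInf_AE) auto
    \<comment> \<open>A finite moment of positive order excludes infinitely many copies almost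
      surely, so the default value 0 of \<open>subgraph_count\<close> matters only on a null
      set.\<close>
    then have fin_copies: "AE \<omega> in M. finite (copies \<omega>)"
      using AE_space
    proof eventually_elim
      case (elim \<omega>)
      show ?case
      proof (rule ccontr)
        assume "infinite (copies \<omega>)"
        then have "copies_number \<omega> = \<infinity>" using copies_number_eq[OF elim(2)] by simp
        then show False using elim(1) cB by (simp add: top_power_ennreal)
      qed
    qed
    have cnt: "subgraph_count r m E \<tau> F \<omega> = enn2real (copies_number \<omega>)" if "\<omega> \<in> space M" for \<omega>
      using subgraph_count_eq[OF that] copies_number_eq[OF that]
      by (cases "finite (copies \<omega>)") auto
    have meas: "(\<lambda>\<omega>. subgraph_count r m E \<tau> F \<omega> ^ card B) \<in> borel_measurable M"
      using cnt by (subst measurable_cong[where g = "\<lambda>\<omega>. enn2real (copies_number \<omega>) ^ card B"]) auto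
    have "(\<integral>\<omega>. subgraph_count r m E \<tau> F \<omega> ^ card B \<partial>M) =
      enn2real (\<integral>\<^sup>+\<omega>. ennreal (subgraph_count r m E \<tau> F \<omega> ^ card B) \<partial>M)"
      using cnt by (intro integral_eq_nn_integral meas AE_I2) (simp add: enn2real_nonneg)
    also have "(\<integral>\<^sup>+\<omega>. ennreal (subgraph_count r m E \<tau> F \<omega> ^ card B) \<partial>M) = (\<integral>\<^sup>+\<omega>. copies_number \<omega> ^ card B \<partial>M)"
    proof (rule nn_integral_cong_AE)
      show "AE \<omega> in M. ennreal (subgraph_count r m E \<tau> F \<omega> ^ card B) = copies_number \<omega> ^ card B"
        using fin_copies AE_space
        by eventually_elim (simp add: subgraph_count_eq copies_number_eq ennreal_of_nat_eq_real_of_nat ennreal_power)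
    qed
    also have "enn2real \<dots> = (\<Sum>\<rho>\<in>NF r B. enn2real (w \<rho>))"
      unfolding mom using wfin by (subst enn2real_sum) (auto simp: o_def)
    finally show ?thesis .
  qed
  have N: "product_sigma_finite (\<lambda>_ :: (nat \<times> nat) set. \<nu>)"
    using sigma_finite_\<nu> by (simp add: product_sigma_finite_def)
  have mult: "enn2real (w (\<Union>B\<in>P. f B)) = (\<Prod>B\<in>P. enn2real (w (f B)))"
    if P: "partition_on {1..n} P" and f: "f \<in> Pi\<^sub>E P (NF r)" for P f
  proof -
    have "(\<Union>B\<in>P. f B) \<in> NF r {1..n}"
      using bij_betw_apply[OF bij_betw_NF_Union[OF P, of r] f] by simp
    from w[OF this] have "w (\<Union>B\<in>P. f B) = (\<Prod>B\<in>P. graph_weight y \<psi> \<nu> (f B) (glued_edges r E B (f B)))"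
      using graph_weight_UN[OF N sets_\<nu> \<psi>_meas \<psi>_sym P f, of y] by (rule trans)
    also have "\<dots> = (\<Prod>B\<in>P. w (f B))"
      using f by (intro prod.cong refl w[symmetric]) auto
    finally show ?thesis by (simp add: enn2real_prod)
  qed
  have "cumulant M (subgraph_count r m E \<tau> F) n =
    (\<Sum>P | partition_on {1..n} P. moebius_weight (card P) * (\<Prod>B\<in>P. \<Sum>\<rho>\<in>NF r B. enn2real (w \<rho>)))"
    unfolding cumulant_def moebius_weight_def
  proof (intro sum.cong refl arg_cong2[where f = "(*)"] prod.cong)
    fix P B assume "P \<in> {P. partition_on {1..n} P}" "B \<in> P"
    then show "(\<integral>\<omega>. subgraph_count r m E \<tau> F \<omega> ^ card B \<partial>M) = (\<Sum>\<rho>\<in>NF r B. enn2real (w \<rho>))"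
      by (intro moment) (auto simp: partition_on_def)
  qed
  also have "\<dots> = (\<Sum>\<rho>\<in>CNF n r. enn2real (w \<rho>))"
    using n r2 by (intro moments_to_cumulant mult) auto
  also have "\<dots> = (\<Sum>\<rho>\<in>CNF n r. enn2real (graph_weight y \<psi> \<nu> \<rho> (glued_edges r E {1..n} \<rho>)))"
    by (intro sum.cong refl arg_cong[where f = enn2real] w) (auto simp: CNF_eq)
  finally show ?thesis .
qed

end

section \<open>Bounds for the weights\<close>

lemma prod_le_prod_subset:
  fixes f :: "'a \<Rightarrow> real"
  assumes "finite B" "A \<subseteq> B" "\<And>x. x \<in> B \<Longrightarrow> 0 \<le> f x \<and> f x \<le> 1"
  shows "prod f B \<le> prod f A"
proof -
  have "prod f B = prod f (B - A) * prod f A" using assms by (intro prod.subset_diff)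
  also have "\<dots> \<le> 1 * prod f A"
    using assms by (intro mult_right_mono prod_le_1 prod_nonneg) auto
  finally show ?thesis by simp
qed

text \<open>Factors in \<open>[0, 1]\<close> that \<open>g\<close> merges occur repeatedly on the
  left and once on the right. This is the effect of identifying edges.\<close>

lemma prod_le_prod_image:
  fixes f :: "'b \<Rightarrow> real"
  assumes "finite S" "\<And>y. y \<in> g ` S \<Longrightarrow> 0 \<le> f y \<and> f y \<le> 1"
  shows "(\<Prod>s\<in>S. f (g s)) \<le> prod f (g ` S)"
  using assms
proof (induction S)
  case (insert s S)
  have IH: "(\<Prod>s\<in>S. f (g s)) \<le> prod f (g ` S)" using insert by simp
  have nn: "0 \<le> (\<Prod>s\<in>S. f (g s))" using insert.prems by (intro prod_nonneg) auto
  show ?case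
  proof (cases "g s \<in> g ` S")
    case True
    have "f (g s) * (\<Prod>s\<in>S. f (g s)) \<le> 1 * (\<Prod>s\<in>S. f (g s))"
      using insert.prems nn by (intro mult_right_mono) auto
    then show ?thesis using True insert.hyps IH by (simp add: insert_absorb)
  next
    case False
    then show ?thesis using insert.hyps insert.prems IH by (simp add: mult_left_mono)
  qed
qed simp

text \<open>Where the power vanishes, the function vanishes. The lower bounds ask only for
  positivity, so this replaces a moment inequality, and \<open>N\<close> may have infinite
  mass.\<close>

lemma nn_integral_power_pos:
  fixes f :: "'a \<Rightarrow> ennreal"
  assumes f: "f \<in> borel_measurable N" and pos: "0 < (\<integral>\<^sup>+x. f x \<partial>N)"
  shows "0 < (\<integral>\<^sup>+x. f x ^ n \<partial>N)"
proof (rule ccontr)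
  assume "\<not> 0 < (\<integral>\<^sup>+x. f x ^ n \<partial>N)"
  then have "(\<integral>\<^sup>+x. f x ^ n \<partial>N) = 0" by (simp add: not_less)
  then have "AE x in N. f x ^ n = 0" using f by (subst (asm) nn_integral_0_iff_AE) auto
  then have "AE x in N. f x = 0" by eventually_elim (auto simp: power_eq_0_iff split: if_splits)
  then have "(\<integral>\<^sup>+x. f x \<partial>N) = 0" using nn_integral_0_iff_AE[OF f] by simp
  then show False using pos by simp
qed

lemma rtrancl_exit:
  assumes "(a, b) \<in> R\<^sup>*" "P a" "\<not> P b"
  obtains u v where "(u, v) \<in> R" "P u" "\<not> P v"
proof -
  have "P b \<or> (\<exists>u v. (u, v) \<in> R \<and> P u \<and> \<not> P v)"
    using assms(1) by (induction rule: rtrancl_induct) (use assms(2) in auto)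
  then show ?thesis using assms(3) that by blast
qed

section \<open>Scaling and finiteness of the weights\<close>

locale weighted_graph = endpoint_graph r m E
  for r m E +
  fixes \<phi> :: "'a::topological_space \<Rightarrow> 'a \<Rightarrow> real" and \<mu> :: "'a measure" and y :: "nat \<Rightarrow> 'a"
  assumes \<phi>01: "\<And>u v. 0 \<le> \<phi> u v" "\<And>u v. \<phi> u v \<le> 1"
    and \<phi>_sym: "\<And>u v. \<phi> u v = \<phi> v u"
    and \<phi>_meas: "(\<lambda>(u, v). \<phi> u v) \<in> borel_measurable (borel \<Otimes>\<^sub>M borel)"
    and sets_\<mu>: "sets \<mu> = sets borel"
    and sigma_finite_\<mu>: "sigma_finite_measure \<mu>"
begin

sublocale \<mu>: product_sigma_finite "\<lambda>_ :: 'b. \<mu>"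
  using sigma_finite_\<mu> by (simp add: product_sigma_finite_def)

lemma edge_weight_01: "card e = 2 \<Longrightarrow> 0 \<le> edge_weight y \<phi> x e \<and> edge_weight y \<phi> x e \<le> 1"
  using \<phi>01 by (auto simp: card_2_iff edge_weight_doubleton[OF \<phi>_sym])

lemma graph_weight_scale:
  assumes A: "finite A" and \<rho>: "\<rho> \<in> NF r A" and t: "t \<ge> 0" and c: "c \<ge> 0"
  shows "graph_weight y (\<lambda>u v. c * \<phi> u v) (scale_measure (ennreal t) \<mu>) \<rho> (glued_edges r E A \<rho>) =
    ennreal (t ^ card \<rho> * c ^ card (glued_edges r E A \<rho>)) * graph_weight y \<phi> \<mu> \<rho> (glued_edges r E A \<rho>)"
proof -
  let ?D = "glued_edges r E A \<rho>"
  have P: "partition_on (A \<times> {1..r}) \<rho>" using \<rho> by (simp add: NF_def)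
  have fin: "finite \<rho>" using finite_elements[OF _ P] A by simp
  have w: "ennreal (edge_weight y (\<lambda>u v. c * \<phi> u v) x e) = ennreal c * ennreal (edge_weight y \<phi> x e)"
    if eD: "e \<in> ?D" for e x
  proof -
    obtain u v where e: "e = {u, v}" using glued_edge(1)[OF \<rho> eD] by (auto simp: card_2_iff)
    have sym: "\<And>u v. c * \<phi> u v = c * \<phi> v u" using \<phi>_sym by simp
    show ?thesis unfolding e edge_weight_doubleton[OF \<phi>_sym] edge_weight_doubleton[of "\<lambda>u v. c * \<phi> u v", OF sym]
      using c by (simp add: ennreal_mult')
  qed
  have meas: "(\<lambda>x. \<Prod>e\<in>?D. ennreal (edge_weight y \<phi> x e)) \<in> borel_measurable (PiM \<rho> (\<lambda>_. \<mu>))"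
    by (rule measurable_glued_weight[OF sets_\<mu> \<phi>_meas \<phi>_sym \<rho>])
  have "graph_weight y (\<lambda>u v. c * \<phi> u v) (scale_measure (ennreal t) \<mu>) \<rho> ?D =
    (\<integral>\<^sup>+x. ennreal c ^ card ?D * (\<Prod>e\<in>?D. ennreal (edge_weight y \<phi> x e)) \<partial>scale_measure (ennreal t ^ card \<rho>) (PiM \<rho> (\<lambda>_. \<mu>)))"
    unfolding graph_weight_def PiM_scale_measure[OF sigma_finite_\<mu> ennreal_less_top[of t, folded infinity_ennreal_def] fin]
    by (intro nn_integral_cong) (simp add: w prod.distrib)
  also have "\<dots> = ennreal t ^ card \<rho> * (ennreal c ^ card ?D * graph_weight y \<phi> \<mu> \<rho> ?D)"
    using meas by (simp add: nn_integral_scale_measure nn_integral_cmult graph_weight_def mult_ac)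
  finally show ?thesis
    using t c by (simp add: ennreal_mult' ennreal_power mult.assoc)
qed

text \<open>The integrand is at most 1, so the weight is at most the total mass to the power
  \<open>card \<rho>\<close>.\<close>

lemma graph_weight_finite_measure:
  assumes \<mu>: "finite_measure \<mu>" and A: "finite A" and \<rho>: "\<rho> \<in> NF r A"
  shows "graph_weight y \<phi> \<mu> \<rho> (glued_edges r E A \<rho>) < \<infinity>"
proof -
  let ?D = "glued_edges r E A \<rho>"
  have fin: "finite \<rho>" using finite_elements[of "A \<times> {1..r}" \<rho>] A \<rho> by (simp add: NF_def)
  have "(\<Prod>e\<in>?D. ennreal (edge_weight y \<phi> x e)) \<le> 1" for x
  proof -
    have "(\<Prod>e\<in>?D. ennreal (edge_weight y \<phi> x e)) = ennreal (\<Prod>e\<in>?D. edge_weight y \<phi> x e)"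
      using edge_weight_01[OF glued_edge(1)[OF \<rho>]] by (intro prod_ennreal) auto
    also have "\<dots> \<le> ennreal 1"
      using edge_weight_01[OF glued_edge(1)[OF \<rho>]] by (intro ennreal_leI prod_le_1) auto
    finally show ?thesis by simp
  qed
  then have "graph_weight y \<phi> \<mu> \<rho> ?D \<le> (\<integral>\<^sup>+x. 1 \<partial>PiM \<rho> (\<lambda>_. \<mu>))"
    unfolding graph_weight_def by (intro nn_integral_mono)
  also have "\<dots> = (\<Prod>b\<in>\<rho>. emeasure \<mu> (space \<mu>))"
    using \<mu>.emeasure_PiM[OF fin, of "\<lambda>_. space \<mu>"] by (simp add: space_PiM)
  also have "\<dots> < \<infinity>"
    using finite_measure.emeasure_finite[OF \<mu>, of "space \<mu>"] by (simp add: power_less_top_ennreal less_top)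
  finally show ?thesis .
qed

text \<open>From a cell of a block outside \<open>U\<close> a path leads to the endpoint
  \<open>r + 1\<close>. Lifted to the row of that cell it starts outside \<open>U\<close> and ends
  at a terminal node, so one of its edges leaves the complement of \<open>U\<close>.\<close>

lemma crossing_edge:
  assumes conn: "connected_graph {1..r+m} E" and m: "m \<ge> 1"
    and \<rho>: "\<rho> \<in> NF r A" and U: "U \<subseteq> \<rho>" "U \<noteq> \<rho>"
  obtains b z where "b \<in> \<rho> - U" "z \<in> Inl ` U \<union> range Inr" "{Inl b, z} \<in> glued_edges r E A \<rho>"
proof -
  have P: "partition_on (A \<times> {1..r}) \<rho>" using \<rho> by (simp add: NF_def)
  obtain b where b: "b \<in> \<rho>" "b \<notin> U" using U by blast
  then have "b \<noteq> {}" using P by (auto simp: partition_on_def)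
  then obtain i j where ij: "(i, j) \<in> b" by fast
  then have iA: "i \<in> A" "j \<in> {1..r}" using partition_on_mem[OF P b(1)] by auto
  let ?P = "\<lambda>j. j \<in> {1..r+m} \<and> lift_vertex r \<rho> i j \<in> Inl ` (\<rho> - U)"
  have "(j, r + 1) \<in> {(x, y). {x, y} \<in> E}\<^sup>*"
    using conn iA m by (auto simp: connected_graph_def)
  moreover have "?P j" using b iA block_of_eq[OF P b(1) ij] by (auto simp: lift_vertex_def)
  moreover have "\<not> ?P (r + 1)" by (auto simp: lift_vertex_def)
  ultimately obtain u v where uv: "(u, v) \<in> {(x, y). {x, y} \<in> E}" "?P u" "\<not> ?P v"
    by (rule rtrancl_exit)
  then have E: "{u, v} \<in> E" by simp
  have v: "v \<in> {1..r+m}" using edge_vertex[OF E] by simp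
  from uv(2) obtain b' where b': "b' \<in> \<rho> - U" "lift_vertex r \<rho> i u = Inl b'" by auto
  have "lift_vertex r \<rho> i v \<in> Inl ` \<rho> \<union> Inr ` {1..m}" by (rule lift_in[OF P iA(1) v])
  then have z: "lift_vertex r \<rho> i v \<in> Inl ` U \<union> range Inr" using uv(3) v by blast
  have "lift_vertex r \<rho> i ` {u, v} \<in> glued_edges r E A \<rho>"
    unfolding glued_edges_def using iA(1) E by blast
  then show thesis using that[OF b'(1) z] b'(2) by simp
qed

text \<open>Integrating out the vertices one by one, each along an edge that leads to a vertex already
  present or to an endpoint.\<close>

lemma graph_weight_finite_endpoints:
  assumes conn: "connected_graph {1..r+m} E" and m: "m \<ge> 1"
    and K: "(SUP u. \<integral>\<^sup>+v. ennreal (\<phi> u v) \<partial>\<mu>) < \<infinity>"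
    and A: "finite A" and \<rho>: "\<rho> \<in> NF r A"
  shows "graph_weight y \<phi> \<mu> \<rho> (glued_edges r E A \<rho>) < \<infinity>"
proof -
  define K where "K = (SUP u. \<integral>\<^sup>+v. ennreal (\<phi> u v) \<partial>\<mu>)"
  let ?G = "glued_edges r E A \<rho>"
  define D where "D U = {e \<in> ?G. e \<subseteq> Inl ` U \<union> range Inr}" for U
  let ?f = "\<lambda>U x. \<Prod>e\<in>D U. ennreal (edge_weight y \<phi> x e)"
  have P: "partition_on (A \<times> {1..r}) \<rho>" using \<rho> by (simp add: NF_def)
  have fin: "finite \<rho>" using finite_elements[OF _ P] A by simp
  have finG: "finite ?G" using A by (rule finite_glued_edges)
  have meas: "?f U \<in> borel_measurable (PiM V (\<lambda>_. \<mu>))" if "U \<subseteq> V" for U V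
  proof (rule borel_measurable_prod_ennreal)
    fix e assume e: "e \<in> D U"
    then have "e \<subseteq> Inl ` U \<union> range Inr" by (simp add: D_def)
    also have "\<dots> \<subseteq> Inl ` V \<union> range Inr" using that by blast
    finally have "e \<subseteq> Inl ` V \<union> range Inr" .
    moreover have "card e = 2" using e glued_edge(1)[OF \<rho>] by (simp add: D_def)
    ultimately have "(\<lambda>x. edge_weight y \<phi> x e) \<in> borel_measurable (PiM V (\<lambda>_. \<mu>))"
      by (intro measurable_edge_weight[OF sets_\<mu> \<phi>_meas \<phi>_sym])
    then show "(\<lambda>x. ennreal (edge_weight y \<phi> x e)) \<in> borel_measurable (PiM V (\<lambda>_. \<mu>))"
      by (rule measurable_compose) simp
  qed
  \<comment> \<open>Each new block must be adjacent to a block already chosen or to an endpoint, so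
    the order of integration is not prescribed: the induction only claims that a suitable set of
    each size exists.\<close>
  have "\<exists>U\<subseteq>\<rho>. card U = k \<and> graph_weight y \<phi> \<mu> U (D U) \<le> K ^ k" if "k \<le> card \<rho>" for k
    using that
  proof (induction k)
    case 0
    have "D {} = {}" using glued_edge(3)[OF \<rho>] by (auto simp: D_def)
    then have "graph_weight y \<phi> \<mu> {} (D {}) = 1" by (simp add: graph_weight_def PiM_empty)
    then show ?case by (intro exI[of _ "{}"]) auto
  next
    case (Suc k)
    then obtain U where U: "U \<subseteq> \<rho>" "card U = k" "graph_weight y \<phi> \<mu> U (D U) \<le> K ^ k" by auto
    then have "U \<noteq> \<rho>" using Suc.prems by auto
    then obtain b z where b: "b \<in> \<rho> - U" "z \<in> Inl ` U \<union> range Inr" "{Inl b, z} \<in> ?G"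
      using crossing_edge[OF conn m \<rho> U(1)] by blast
    let ?e = "{Inl b, z}" and ?V = "insert b U"
    have finU: "finite U" using U(1) fin finite_subset by blast
    have eV: "?e \<in> D ?V" "?e \<notin> D U" using b by (auto simp: D_def)
    have finD: "finite (D V)" for V using finG by (simp add: D_def)
    have sub: "insert ?e (D U) \<subseteq> D ?V" using eV by (auto simp: D_def)
    have w01: "0 \<le> edge_weight y \<phi> x e \<and> edge_weight y \<phi> x e \<le> 1" if "e \<in> D V" for e V x
    proof (rule edge_weight_01)
      show "card e = 2" using glued_edge(1)[OF \<rho>, of e] that by (simp add: D_def)
    qed
    \<comment> \<open>Of the edges that the new block brings in only \<open>?e\<close> is kept; the
      others have weight at most 1.\<close>
    have le: "?f ?V x \<le> ?f U x * ennreal (edge_weight y \<phi> x ?e)" for x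
    proof -
      have "?f ?V x = ennreal (\<Prod>e\<in>D ?V. edge_weight y \<phi> x e)" using w01 by (intro prod_ennreal) auto
      also have "\<dots> \<le> ennreal (\<Prod>e\<in>insert ?e (D U). edge_weight y \<phi> x e)"
        by (intro ennreal_leI prod_le_prod_subset finD sub w01)
      also have "\<dots> = (\<Prod>e\<in>insert ?e (D U). ennreal (edge_weight y \<phi> x e))"
        using w01 eV(1) by (intro prod_ennreal[symmetric]) blast
      finally show ?thesis using eV(2) finD by (simp add: mult.commute)
    qed
    have me: "(\<lambda>x. ennreal (edge_weight y \<phi> x ?e)) \<in> borel_measurable (PiM ?V (\<lambda>_. \<mu>))"
      by (rule measurable_compose[OF measurable_edge_weight[OF sets_\<mu> \<phi>_meas \<phi>_sym]])
        (use eV(1) glued_edge(1)[OF \<rho> b(3)] in \<open>auto simp: D_def\<close>)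
    have mU: "?f U \<in> borel_measurable (PiM ?V (\<lambda>_. \<mu>))" by (rule meas) blast
    have "graph_weight y \<phi> \<mu> ?V (D ?V) \<le> (\<integral>\<^sup>+x. ?f U x * ennreal (edge_weight y \<phi> x ?e) \<partial>PiM ?V (\<lambda>_. \<mu>))"
      unfolding graph_weight_def by (intro nn_integral_mono le)
    also have "\<dots> = (\<integral>\<^sup>+x. \<integral>\<^sup>+v. ?f U (x(b := v)) * ennreal (edge_weight y \<phi> (x(b := v)) ?e) \<partial>\<mu> \<partial>PiM U (\<lambda>_. \<mu>))"
      using b(1) by (intro \<mu>.product_nn_integral_insert finU borel_measurable_times_ennreal mU me) auto
    \<comment> \<open>Only \<open>?e\<close> depends on the new variable, and its integral is
      bounded by \<open>K\<close> whatever the position of its other end.\<close>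
    also have "\<dots> = (\<integral>\<^sup>+x. ?f U x * (\<integral>\<^sup>+v. ennreal (\<phi> (position y x z) v) \<partial>\<mu>) \<partial>PiM U (\<lambda>_. \<mu>))"
    proof (rule nn_integral_cong)
      fix x
      have "?f U (x(b := v)) = ?f U x" for v
      proof (intro prod.cong refl arg_cong[where f = ennreal] edge_weight_cong[OF \<phi>_sym])
        fix e assume e: "e \<in> D U"
        then show "card e = 2" using glued_edge(1)[OF \<rho>] by (simp add: D_def)
        fix b' assume "Inl b' \<in> e"
        then show "(x(b := v)) b' = x b'" using e b(1) by (auto simp: D_def)
      qed
      moreover have "edge_weight y \<phi> (x(b := v)) ?e = \<phi> (position y x z) v" for v
      proof -
        have "position y (x(b := v)) z = position y x z" using b by (cases z) auto
        then show ?thesis by (simp add: edge_weight_doubleton[OF \<phi>_sym] \<phi>_sym[of v])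
      qed
      moreover have "(\<lambda>v. \<phi> u v) \<in> borel_measurable \<mu>" for u
      proof -
        have "(\<lambda>v. (u, v)) \<in> measurable borel (borel \<Otimes>\<^sub>M borel)" by simp
        from measurable_compose[OF this \<phi>_meas] show ?thesis
          by (subst measurable_cong_sets[OF sets_\<mu> refl]) simp
      qed
      ultimately show "(\<integral>\<^sup>+v. ?f U (x(b := v)) * ennreal (edge_weight y \<phi> (x(b := v)) ?e) \<partial>\<mu>) =
        ?f U x * (\<integral>\<^sup>+v. ennreal (\<phi> (position y x z) v) \<partial>\<mu>)"
        by (simp add: nn_integral_cmult)
    qed
    also have "\<dots> \<le> (\<integral>\<^sup>+x. ?f U x * K \<partial>PiM U (\<lambda>_. \<mu>))"
      unfolding K_def by (intro nn_integral_mono mult_left_mono SUP_upper) auto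
    also have "\<dots> = graph_weight y \<phi> \<mu> U (D U) * K"
      unfolding graph_weight_def by (intro nn_integral_multc meas) simp
    also have "\<dots> \<le> K ^ Suc k"
      using U(3) by (simp add: mult.commute mult_left_mono)
    finally have "graph_weight y \<phi> \<mu> ?V (D ?V) \<le> K ^ Suc k" .
    moreover have "card ?V = Suc k" "?V \<subseteq> \<rho>" using U b(1) finU by auto
    ultimately show ?case by blast
  qed
  then obtain U where U: "U \<subseteq> \<rho>" "card U = card \<rho>" "graph_weight y \<phi> \<mu> U (D U) \<le> K ^ card \<rho>" by blast
  then have "U = \<rho>" using fin card_subset_eq by blast
  moreover have "D \<rho> = ?G"
  proof -
    have "Inl ` \<rho> \<union> Inr ` {1..m} \<subseteq> Inl ` \<rho> \<union> range Inr" by blast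
    then have "e \<subseteq> Inl ` \<rho> \<union> range Inr" if "e \<in> ?G" for e
      using glued_edge(2)[OF \<rho> that] by (rule subset_trans[rotated])
    then show ?thesis unfolding D_def by blast
  qed
  ultimately have "graph_weight y \<phi> \<mu> \<rho> ?G \<le> K ^ card \<rho>" using U by simp
  also have "\<dots> < \<infinity>" using K by (simp add: K_def power_less_top_ennreal)
  finally show ?thesis .
qed

section \<open>Positivity of the integrals of the two extremal partitions\<close>

definition copy_weight :: "(nat \<Rightarrow> 'a) \<Rightarrow> real" where
  "copy_weight z = (\<Prod>d\<in>E. edge_weight y \<phi> z ((\<lambda>j. if j \<le> r then Inl j else Inr (j - r)) ` d))"

lemma card_plain_edge:
  assumes "d \<in> E" shows "card ((\<lambda>j. if j \<le> r then Inl j else Inr (j - r) :: nat + nat) ` d) = 2"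
proof -
  have "inj_on (\<lambda>j. if j \<le> r then Inl j else Inr (j - r) :: nat + nat) d"
    by (intro inj_onI) (auto split: if_splits)
  from card_image[OF this] show ?thesis using card_edge[OF assms] by (simp only:)
qed

lemma measurable_copy_weight: "(\<lambda>z. ennreal (copy_weight z)) \<in> borel_measurable (PiM {1..r} (\<lambda>_. \<mu>))"
proof -
  have "(\<lambda>z. edge_weight y \<phi> z ((\<lambda>j. if j \<le> r then Inl j else Inr (j - r)) ` d)) \<in> borel_measurable (PiM {1..r} (\<lambda>_. \<mu>))"
    if d: "d \<in> E" for d
  proof (rule measurable_edge_weight[OF sets_\<mu> \<phi>_meas \<phi>_sym card_plain_edge[OF d]])
    show "(\<lambda>j. if j \<le> r then Inl j else Inr (j - r) :: nat + nat) ` d \<subseteq> Inl ` {1..r} \<union> range Inr"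
      using edge_vertex[OF d] by auto
  qed
  then have "copy_weight \<in> borel_measurable (PiM {1..r} (\<lambda>_. \<mu>))"
    unfolding copy_weight_def[abs_def] by (rule borel_measurable_prod)
  then show ?thesis by (rule measurable_compose) simp
qed

text \<open>The index pairs in \<open>subgraph_integral\<close> enumerate \<open>E\<close>.
  Positivity is transferred in this direction only, so the bound for merged factors avoids showing
  that each edge is enumerated once.\<close>

lemma subgraph_integral_le: "subgraph_integral \<mu> \<phi> r m E y \<le> (\<integral>\<^sup>+z. ennreal (copy_weight z) \<partial>PiM {1..r} (\<lambda>_. \<mu>))"
  unfolding subgraph_integral_def
proof (intro nn_integral_mono ennreal_leI)
  fix x :: "nat \<Rightarrow> 'a"
  let ?Q1 = "{(i, j). i \<in> {1..r} \<and> j \<in> {1..r} \<and> i < j \<and> {i, j} \<in> E}"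
  let ?Q2 = "{(i, j). i \<in> {1..r} \<and> j \<in> {1..m} \<and> {r + j, i} \<in> E}"
  let ?l = "\<lambda>j. if j \<le> r then Inl j else Inr (j - r) :: nat + nat"
  let ?g = "case_sum (\<lambda>(i, j). {i, j}) (\<lambda>(i, j). {r + j, i})"
  let ?w = "\<lambda>d. edge_weight y \<phi> x (?l ` d)"
  have fin: "finite ?Q1" "finite ?Q2"
    by (rule finite_subset[of _ "{1..r} \<times> {1..r}"], auto) (rule finite_subset[of _ "{1..r} \<times> {1..m}"], auto)
  have E: "?g ` (?Q1 <+> ?Q2) = E"
  proof (intro subset_antisym subsetI)
    fix d assume d: "d \<in> E"
    then show "d \<in> ?g ` (?Q1 <+> ?Q2)"
    proof (cases rule: edge_cases)
      case (inner j1 j2)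
      have "\<exists>i j. (i, j) \<in> ?Q1 \<and> d = {i, j}"
      proof (cases "j1 < j2")
        case True
        then show ?thesis using inner d by (intro exI[of _ j1] exI[of _ j2]) auto
      next
        case False
        then show ?thesis using inner d by (intro exI[of _ j2] exI[of _ j1]) (auto simp: insert_commute)
      qed
      then obtain i j where "(i, j) \<in> ?Q1" "d = {i, j}" by blast
      then show ?thesis by (intro image_eqI[of _ _ "Inl (i, j)"]) auto
    next
      case (endpoint j k)
      then have "(j, k) \<in> ?Q2" using d by (simp add: insert_commute)
      then show ?thesis using endpoint by (intro image_eqI[of _ _ "Inr (j, k)"]) auto
    qed
  qed auto
  have "(\<Prod>(i, j)\<in>?Q1. \<phi> (x i) (x j)) * (\<Prod>(i, j)\<in>?Q2. \<phi> (y j) (x i)) =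
    (\<Prod>p\<in>?Q1. ?w (?g (Inl p))) * (\<Prod>p\<in>?Q2. ?w (?g (Inr p)))"
    by (intro arg_cong2[where f = "(*)"] prod.cong refl) (auto simp: edge_weight_doubleton[OF \<phi>_sym])
  also have "\<dots> = (\<Prod>s\<in>?Q1 <+> ?Q2. ?w (?g s))"
    using fin by (subst prod.Plus) (simp_all add: o_def)
  also have "\<dots> \<le> prod ?w (?g ` (?Q1 <+> ?Q2))"
  proof (rule prod_le_prod_image)
    show "finite (?Q1 <+> ?Q2)" using fin by (rule finite_Plus)
    show "0 \<le> ?w d \<and> ?w d \<le> 1" if "d \<in> ?g ` (?Q1 <+> ?Q2)" for d
      using that unfolding E by (intro edge_weight_01 card_plain_edge)
  qed
  also have "\<dots> = copy_weight x" unfolding E copy_weight_def ..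
  finally show "(\<Prod>(i, j)\<in>?Q1. \<phi> (x i) (x j)) * (\<Prod>(i, j)\<in>?Q2. \<phi> (y j) (x i)) \<le> copy_weight x" .
qed

text \<open>An edge shared by several copies is counted once per copy on the left and once on the
  right, and all weights are at most 1. The gain is that the left side is a product over the
  rows.\<close>

lemma glued_weight_ge:
  assumes A: "finite A" and \<rho>: "\<rho> \<in> NF r A"
  shows "(\<Prod>i\<in>A. copy_weight (\<lambda>j\<in>{1..r}. x (block_of \<rho> (i, j)))) \<le> (\<Prod>e\<in>glued_edges r E A \<rho>. edge_weight y \<phi> x e)"
proof -
  let ?g = "\<lambda>(i, d). lift_vertex r \<rho> i ` d"
  have img: "?g ` (A \<times> E) = glued_edges r E A \<rho>" by (auto simp: glued_edges_def)
  have "(\<Prod>i\<in>A. copy_weight (\<lambda>j\<in>{1..r}. x (block_of \<rho> (i, j)))) =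
    (\<Prod>i\<in>A. \<Prod>d\<in>E. edge_weight y \<phi> x (lift_vertex r \<rho> i ` d))"
    unfolding copy_weight_def
  proof (intro prod.cong refl)
    fix i d assume i: "i \<in> A" and d: "d \<in> E"
    obtain u v where uv: "d = {u, v}" using card_edge[OF d] by (auto simp: card_2_iff)
    have "position y (\<lambda>j\<in>{1..r}. x (block_of \<rho> (i, j))) (if j \<le> r then Inl j else Inr (j - r)) =
      position y x (lift_vertex r \<rho> i j)" if "j \<in> d" for j
      using edge_vertex[OF d that] by (auto simp: lift_vertex_def)
    then show "edge_weight y \<phi> (\<lambda>j\<in>{1..r}. x (block_of \<rho> (i, j))) ((\<lambda>j. if j \<le> r then Inl j else Inr (j - r)) ` d) =
      edge_weight y \<phi> x (lift_vertex r \<rho> i ` d)"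
      unfolding uv image_insert image_empty edge_weight_doubleton[OF \<phi>_sym] by simp
  qed
  also have "\<dots> = (\<Prod>p\<in>A \<times> E. edge_weight y \<phi> x (?g p))"
    by (simp add: prod.cartesian_product case_prod_unfold)
  also have "\<dots> \<le> prod (edge_weight y \<phi> x) (?g ` (A \<times> E))"
  proof (rule prod_le_prod_image)
    show "0 \<le> edge_weight y \<phi> x e \<and> edge_weight y \<phi> x e \<le> 1" if "e \<in> ?g ` (A \<times> E)" for e
      using that unfolding img by (intro edge_weight_01 glued_edge(1)[OF \<rho>])
  qed (use A finite_E in simp)
  finally show ?thesis unfolding img .
qed

lemma copy_weight_nonneg: "0 \<le> copy_weight z"
  unfolding copy_weight_def using edge_weight_01[OF card_plain_edge] by (intro prod_nonneg) blast

lemma graph_weight_ge: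
  assumes A: "finite A" and \<rho>: "\<rho> \<in> NF r A"
  shows "(\<integral>\<^sup>+x. (\<Prod>i\<in>A. ennreal (copy_weight (\<lambda>j\<in>{1..r}. x (block_of \<rho> (i, j))))) \<partial>PiM \<rho> (\<lambda>_. \<mu>)) \<le>
    graph_weight y \<phi> \<mu> \<rho> (glued_edges r E A \<rho>)"
  unfolding graph_weight_def
proof (rule nn_integral_mono)
  fix x
  have "(\<Prod>i\<in>A. ennreal (copy_weight (\<lambda>j\<in>{1..r}. x (block_of \<rho> (i, j))))) =
    ennreal (\<Prod>i\<in>A. copy_weight (\<lambda>j\<in>{1..r}. x (block_of \<rho> (i, j))))"
    using copy_weight_nonneg by (intro prod_ennreal) auto
  also have "\<dots> \<le> ennreal (\<Prod>e\<in>glued_edges r E A \<rho>. edge_weight y \<phi> x e)"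
    by (intro ennreal_leI glued_weight_ge[OF A \<rho>])
  also have "\<dots> = (\<Prod>e\<in>glued_edges r E A \<rho>. ennreal (edge_weight y \<phi> x e))"
    using edge_weight_01[OF glued_edge(1)[OF \<rho>]] by (intro prod_ennreal[symmetric]) auto
  finally show "(\<Prod>i\<in>A. ennreal (copy_weight (\<lambda>j\<in>{1..r}. x (block_of \<rho> (i, j))))) \<le>
    (\<Prod>e\<in>glued_edges r E A \<rho>. ennreal (edge_weight y \<phi> x e))" .
qed


text \<open>A block that is a whole column links all rows directly.\<close>

lemma CNF_I:
  assumes \<rho>: "\<rho> \<in> NF r {1..n}" and v: "v \<in> {1..r}" "{1..n} \<times> {v} \<in> \<rho>" and n: "n \<ge> 1"
  shows "\<rho> \<in> CNF n r"
proof -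
  have P: "partition_on ({1..n} \<times> {1..r}) \<rho>" using \<rho> by (simp add: NF_def)
  have "((i, 1), (i', 1)) \<in> links n r \<rho>" if i: "i \<in> {1..n}" "i' \<in> {1..n}" for i i'
  proof -
    have row: "((i, j), (i, j')) \<in> links n r \<rho>" if "i \<in> {1..n}" "j \<in> {1..r}" "j' \<in> {1..r}" for i j j'
      using that unfolding links_def rows_def by (intro r_into_trancl) auto
    have "((i, v), (i', v)) \<in> links n r \<rho>"
      unfolding links_def using i v(2) by (intro r_into_trancl UN_I[of "{1..n} \<times> {v}"]) auto
    moreover have "((i, 1), (i, v)) \<in> links n r \<rho>" "((i', v), (i', 1)) \<in> links n r \<rho>"
      using i v(1) r2 by (auto intro!: row)
    ultimately show ?thesis unfolding links_def by (meson trancl_trans)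
  qed
  then show ?thesis using \<rho> partition_join_full_iff[OF P n] r2 by (simp add: CNF_eq)
qed

definition columns :: "nat \<Rightarrow> (nat \<times> nat) set set" where
  "columns n = (\<lambda>j. {1..n} \<times> {j}) ` {1..r}"

lemma columns_NF: "n \<ge> 1 \<Longrightarrow> columns n \<in> NF r {1..n}"
proof -
  assume n: "n \<ge> 1"
  have "{1..n} \<times> {j} \<noteq> {}" for j :: nat
  proof -
    have "(1, j) \<in> {1..n} \<times> {j}" using n by simp
    then show ?thesis by blast
  qed
  then have ne: "{} \<notin> columns n" unfolding columns_def by (intro notI) (erule imageE, blast)
  show ?thesis
    unfolding NF_def
  proof (intro CollectI conjI partition_onI ballI ne)
    show "\<Union>(columns n) = {1..n} \<times> {1..r}" by (auto simp: columns_def)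
    show "disjnt p q" if "p \<in> columns n" "q \<in> columns n" "p \<noteq> q" for p q
      using that by (auto simp: columns_def disjnt_def)
    show "inj_on fst b" if "b \<in> columns n" for b
      using that by (auto simp: columns_def inj_on_def)
  qed
qed

text \<open>All rows carry the same vertices, so the product over the rows in
  \<open>graph_weight_ge\<close> is the power \<open>n\<close> of one \<open>copy_weight\<close>,
  whose integral is positive with that of \<open>copy_weight\<close>. For the edges an upper bound
  is enough, as \<open>c t < 1\<close> later on.\<close>

lemma
  assumes n: "n \<ge> 1"
  shows columns_CNF: "columns n \<in> CNF n r"
    and card_columns: "card (columns n) = r"
    and card_glued_columns: "card (glued_edges r E {1..n} (columns n)) \<le> card E"
    and graph_weight_columns: "subgraph_integral \<mu> \<phi> r m E y > 0 \<Longrightarrow>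
      graph_weight y \<phi> \<mu> (columns n) (glued_edges r E {1..n} (columns n)) > 0"
proof -
  let ?\<rho> = "columns n"
  have \<rho>: "?\<rho> \<in> NF r {1..n}" by (rule columns_NF[OF n])
  then have P: "partition_on ({1..n} \<times> {1..r}) ?\<rho>" by (simp add: NF_def)
  show "?\<rho> \<in> CNF n r" using r2 by (intro CNF_I[OF \<rho> _ _ n, of 1]) (auto simp: columns_def)
  have inj: "inj_on (\<lambda>j. {1..n} \<times> {j}) {1..r}" using n by (auto simp: inj_on_def)
  then show "card ?\<rho> = r" by (simp add: columns_def card_image)
  have blk: "block_of ?\<rho> (i, j) = {1..n} \<times> {j}" if "i \<in> {1..n}" "j \<in> {1..r}" for i j
    using that by (intro block_of_eq[OF P]) (auto simp: columns_def)
  have "lift_vertex r ?\<rho> i ` e = lift_vertex r ?\<rho> 1 ` e" if "i \<in> {1..n}" "e \<in> E" for i e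
  proof (rule image_cong[OF refl])
    fix j assume "j \<in> e"
    then have "j \<in> {1..r+m}" by (rule edge_vertex[OF that(2)])
    then show "lift_vertex r ?\<rho> i j = lift_vertex r ?\<rho> 1 j"
      using blk[of i j] blk[of 1 j] that n by (simp add: lift_vertex_def)
  qed
  then have sub: "glued_edges r E {1..n} ?\<rho> \<subseteq> (\<lambda>e. lift_vertex r ?\<rho> 1 ` e) ` E"
    unfolding glued_edges_def by blast
  have fin: "finite (glued_edges r E {1..n} ?\<rho>)" by (rule finite_glued_edges) simp
  show "card (glued_edges r E {1..n} ?\<rho>) \<le> card E"
    using card_mono[OF _ sub] card_image_le[OF finite_E, of "\<lambda>e. lift_vertex r ?\<rho> 1 ` e"] finite_E by auto
  assume pos: "subgraph_integral \<mu> \<phi> r m E y > 0"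
  let ?row = "\<lambda>x :: (nat \<times> nat) set \<Rightarrow> 'a. \<lambda>j\<in>{1..r}. x ({1..n} \<times> {j})"
  have R: "integral\<^sup>N (PiM {1..r} (\<lambda>_. \<mu>)) (\<lambda>z. ennreal (copy_weight z)) =
    (\<integral>\<^sup>+x. ennreal (copy_weight (?row x)) \<partial>PiM ?\<rho> (\<lambda>_. \<mu>))"
    using inj by (intro nn_integral_PiM_reindex[symmetric] \<mu>.product_sigma_finite_axioms measurable_copy_weight)
      (auto simp: bij_betw_def columns_def)
  have mrow: "(\<lambda>x. ennreal (copy_weight (?row x))) \<in> borel_measurable (PiM ?\<rho> (\<lambda>_. \<mu>))"
    by (rule measurable_compose[OF measurable_restrict measurable_copy_weight])
      (auto simp: columns_def intro!: measurable_component_singleton)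
  have "0 < (\<integral>\<^sup>+x. ennreal (copy_weight (?row x)) \<partial>PiM ?\<rho> (\<lambda>_. \<mu>))"
    using pos subgraph_integral_le unfolding R by (rule order.strict_trans2)
  then have "0 < (\<integral>\<^sup>+x. ennreal (copy_weight (?row x)) ^ n \<partial>PiM ?\<rho> (\<lambda>_. \<mu>))"
    using mrow n by (intro nn_integral_power_pos) auto
  also have "\<dots> = (\<integral>\<^sup>+x. (\<Prod>i\<in>{1..n}. ennreal (copy_weight (\<lambda>j\<in>{1..r}. x (block_of ?\<rho> (i, j))))) \<partial>PiM ?\<rho> (\<lambda>_. \<mu>))"
  proof (rule nn_integral_cong)
    fix x :: "(nat \<times> nat) set \<Rightarrow> 'a"
    have "(\<lambda>j\<in>{1..r}. x (block_of ?\<rho> (i, j))) = ?row x" if "i \<in> {1..n}" for i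
      using blk[OF that] by (intro restrict_ext) simp
    then show "ennreal (copy_weight (?row x)) ^ n =
      (\<Prod>i\<in>{1..n}. ennreal (copy_weight (\<lambda>j\<in>{1..r}. x (block_of ?\<rho> (i, j)))))" by simp
  qed
  also have "\<dots> \<le> graph_weight y \<phi> \<mu> ?\<rho> (glued_edges r E {1..n} ?\<rho>)"
    by (rule graph_weight_ge[OF _ \<rho>]) simp
  finally show "0 < graph_weight y \<phi> \<mu> ?\<rho> (glued_edges r E {1..n} ?\<rho>)" .
qed

text \<open>For \<open>v\<close> with the most endpoint neighbours this partition yields the left
  end of the segment: it saves \<open>n - 1\<close> vertices, and the edges from \<open>v\<close> to
  endpoints in all rows but one.\<close>

definition star :: "nat \<Rightarrow> nat \<Rightarrow> (nat \<times> nat) set set" where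
  "star n v = insert ({1..n} \<times> {v}) ((\<lambda>p. {p}) ` ({1..n} \<times> ({1..r} - {v})))"

text \<open>The edges from \<open>v\<close> to endpoints coincide in all rows, which gives the edge
  count. For the integral fix the position \<open>u\<close> of \<open>v\<close>: the other vertices
  of different rows are separate variables, so the product over the rows integrates to
  \<open>H u ^ n\<close>, with \<open>H u\<close> the integral of one copy having \<open>v\<close>
  at \<open>u\<close>. As \<open>H\<close> has positive integral, so has its power.\<close>

lemma
  assumes n: "n \<ge> 1" and v: "v \<in> {1..r}"
  shows star_NF: "star n v \<in> NF r {1..n}"
    and star_CNF: "star n v \<in> CNF n r"
    and card_star: "card (star n v) = 1 + (r - 1) * n"
    and card_glued_star: "card (glued_edges r E {1..n} (star n v)) \<le>
      n * (card E - card {j \<in> {r+1..r+m}. {v, j} \<in> E}) + card {j \<in> {r+1..r+m}. {v, j} \<in> E}"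
    and graph_weight_star: "subgraph_integral \<mu> \<phi> r m E y > 0 \<Longrightarrow>
      graph_weight y \<phi> \<mu> (star n v) (glued_edges r E {1..n} (star n v)) > 0"
proof -
  let ?\<rho> = "star n v" and ?b = "{1..n} \<times> {v}" and ?R = "{1..r} - {v}"
  show \<rho>: "?\<rho> \<in> NF r {1..n}"
    unfolding NF_def
  proof (intro CollectI conjI partition_onI)
    show "\<Union>?\<rho> = {1..n} \<times> {1..r}" using v by (auto simp: star_def)
    have "(1, v) \<in> ?b" using n by simp
    then have "?b \<noteq> {}" by blast
    then show "{} \<notin> ?\<rho>" unfolding star_def by blast
    show "disjnt p q" if "p \<in> ?\<rho>" "q \<in> ?\<rho>" "p \<noteq> q" for p q
      using that by (auto simp: star_def disjnt_def)
    show "\<forall>b\<in>?\<rho>. inj_on fst b" by (auto simp: star_def inj_on_def)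
  qed
  then have P: "partition_on ({1..n} \<times> {1..r}) ?\<rho>" by (simp add: NF_def)
  show "?\<rho> \<in> CNF n r" by (rule CNF_I[OF \<rho> v _ n]) (simp add: star_def)
  have b: "?b \<notin> (\<lambda>p. {p}) ` ({1..n} \<times> ?R)" using n by auto
  show "card ?\<rho> = 1 + (r - 1) * n"
    using b v by (simp add: star_def card_image card_cartesian_product mult.commute)
  have blk: "block_of ?\<rho> (i, j) = (if j = v then ?b else {(i, j)})" if "i \<in> {1..n}" "j \<in> {1..r}" for i j
    using that by (intro block_of_eq[OF P]) (auto simp: star_def)
  show "card (glued_edges r E {1..n} ?\<rho>) \<le>
    n * (card E - card {j \<in> {r+1..r+m}. {v, j} \<in> E}) + card {j \<in> {r+1..r+m}. {v, j} \<in> E}"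
  proof -
    let ?J = "{j \<in> {r+1..r+m}. {v, j} \<in> E}"
    define Ev where "Ev = (\<lambda>j. {v, j}) ` ?J"
    have cEv: "card Ev = card ?J"
      unfolding Ev_def using v by (intro card_image) (auto simp: inj_on_def doubleton_eq_iff)
    have sEv: "Ev \<subseteq> E" by (auto simp: Ev_def)
    have finEv: "finite Ev" using sEv finite_E finite_subset by blast
    let ?l = "\<lambda>i e. lift_vertex r ?\<rho> i ` e"
    have const: "?l i e = ?l 1 e" if i: "i \<in> {1..n}" and e: "e \<in> Ev" for i e
    proof -
      obtain j where j: "e = {v, j}" "j \<in> {r+1..r+m}" using e by (auto simp: Ev_def)
      have "1 \<in> {1..n}" using n by simp
      then show ?thesis using j v blk[OF i v] blk[of 1 v] by (simp add: lift_vertex_def)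
    qed
    have "glued_edges r E {1..n} ?\<rho> \<subseteq> (\<Union>i\<in>{1..n}. ?l i ` (E - Ev)) \<union> ?l 1 ` Ev"
    proof
      fix d assume "d \<in> glued_edges r E {1..n} ?\<rho>"
      then obtain i e where ie: "i \<in> {1..n}" "e \<in> E" "d = ?l i e" unfolding glued_edges_def by blast
      show "d \<in> (\<Union>i\<in>{1..n}. ?l i ` (E - Ev)) \<union> ?l 1 ` Ev"
      proof (cases "e \<in> Ev")
        case True
        then show ?thesis using const[OF ie(1) True] ie(3) by blast
      qed (use ie in blast)
    qed
    then have "card (glued_edges r E {1..n} ?\<rho>) \<le> card ((\<Union>i\<in>{1..n}. ?l i ` (E - Ev)) \<union> ?l 1 ` Ev)"
      using finite_E finEv by (intro card_mono) auto
    also have "\<dots> \<le> card (\<Union>i\<in>{1..n}. ?l i ` (E - Ev)) + card (?l 1 ` Ev)" by (rule card_Un_le)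
    also have "\<dots> \<le> (\<Sum>i\<in>{1..n}. card (?l i ` (E - Ev))) + card Ev"
      using finEv by (intro add_mono card_UN_le card_image_le) auto
    also have "\<dots> \<le> (\<Sum>i\<in>{1..n}. card (E - Ev)) + card Ev"
      using finite_E by (intro add_mono sum_mono card_image_le) auto
    also have "\<dots> = n * (card E - card ?J) + card ?J"
      using sEv finEv cEv by (simp add: card_Diff_subset)
    finally show ?thesis .
  qed
  assume pos: "subgraph_integral \<mu> \<phi> r m E y > 0"
  \<comment> \<open>The singleton blocks of row \<open>i\<close>; the sets \<open>K i\<close> sort
    the coordinates other than the common block by rows.\<close>
  define K where "K i = (\<lambda>j. {(i, j)}) ` ?R" for i :: nat
  let ?U = "\<Union>i\<in>{1..n}. K i"
  have U: "?\<rho> = insert ?b ?U" "?b \<notin> ?U" "finite ?U"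
    using b by (auto simp: star_def K_def)
  have bijK: "bij_betw (\<lambda>j. {(i, j)}) ?R (K i)" for i by (auto simp: bij_betw_def K_def inj_on_def)
  let ?f = "\<lambda>z. ennreal (copy_weight z)"
  have insR: "insert v ?R = {1..r}" using v by auto
  define H where "H u = (\<integral>\<^sup>+z. ?f (z(v := u)) \<partial>PiM ?R (\<lambda>_. \<mu>))" for u
  have mupd: "(\<lambda>(u, z). ?f (z(v := u))) \<in> borel_measurable (\<mu> \<Otimes>\<^sub>M PiM ?R (\<lambda>_. \<mu>))"
  proof -
    have "(\<lambda>(z, u). z(v := u)) \<in> measurable (PiM ?R (\<lambda>_. \<mu>) \<Otimes>\<^sub>M \<mu>) (PiM (insert v ?R) (\<lambda>_. \<mu>))"
      by (rule measurable_add_dim)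
    then have "(\<lambda>(u, z). z(v := u)) \<in> measurable (\<mu> \<Otimes>\<^sub>M PiM ?R (\<lambda>_. \<mu>)) (PiM {1..r} (\<lambda>_. \<mu>))"
      unfolding insR by (subst measurable_pair_swap_iff) (simp add: case_prod_unfold)
    from measurable_compose[OF this measurable_copy_weight] show ?thesis by (simp add: case_prod_unfold)
  qed
  have mH: "H \<in> borel_measurable \<mu>"
    unfolding H_def by (rule sigma_finite_measure.borel_measurable_nn_integral[OF \<mu>.sigma_finite mupd]) simp
  have mfu: "(\<lambda>z. ?f (z(v := u))) \<in> borel_measurable (PiM ?R (\<lambda>_. \<mu>))" if "u \<in> space \<mu>" for u
    using measurable_Pair2[OF mupd that] by simp
  have IH: "integral\<^sup>N (PiM {1..r} (\<lambda>_. \<mu>)) ?f = (\<integral>\<^sup>+u. H u \<partial>\<mu>)"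
  proof -
    have "?f \<in> borel_measurable (PiM (insert v ?R) (\<lambda>_. \<mu>))" unfolding insR by (rule measurable_copy_weight)
    from \<mu>.product_nn_integral_insert_rev[OF _ _ this] show ?thesis
      unfolding H_def insR by simp
  qed
  have "0 < (\<integral>\<^sup>+u. H u \<partial>\<mu>)"
    using pos subgraph_integral_le unfolding IH by (rule order.strict_trans2)
  then have "0 < (\<integral>\<^sup>+u. H u ^ n \<partial>\<mu>)" using mH n by (intro nn_integral_power_pos) auto
  also have "(\<integral>\<^sup>+u. H u ^ n \<partial>\<mu>) =
    (\<integral>\<^sup>+u. \<integral>\<^sup>+x. (\<Prod>i\<in>{1..n}. ?f (\<lambda>j\<in>{1..r}. (x(?b := u)) (block_of ?\<rho> (i, j)))) \<partial>PiM ?U (\<lambda>_. \<mu>) \<partial>\<mu>)"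
  proof (rule nn_integral_cong)
    fix u assume u: "u \<in> space \<mu>"
    let ?g = "\<lambda>i z. ?f ((\<lambda>j\<in>?R. z {(i, j)})(v := u))"
    have mg: "?g i \<in> borel_measurable (PiM (K i) (\<lambda>_. \<mu>))" for i
      by (rule measurable_compose[OF measurable_restrict mfu[OF u]])
        (auto simp: K_def intro!: measurable_component_singleton)
    have "H u = integral\<^sup>N (PiM (K i) (\<lambda>_. \<mu>)) (?g i)" for i
      unfolding H_def
      by (rule nn_integral_PiM_reindex[OF _ _ bijK _ mfu[OF u], symmetric])
        (auto intro: \<mu>.product_sigma_finite_axioms)
    then have "H u ^ n = (\<Prod>i\<in>{1..n}. integral\<^sup>N (PiM (K i) (\<lambda>_. \<mu>)) (?g i))" by simp
    also have "\<dots> = (\<integral>\<^sup>+x. (\<Prod>i\<in>{1..n}. ?g i (restrict x (K i))) \<partial>PiM ?U (\<lambda>_. \<mu>))"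
    proof (rule \<mu>.product_nn_integral_UN[where g = ?g, symmetric])
      show "?g i \<in> borel_measurable (PiM (K i) (\<lambda>_. \<mu>))" for i by (rule mg)
    qed (auto simp: K_def)
    also have "\<dots> = (\<integral>\<^sup>+x. (\<Prod>i\<in>{1..n}. ?f (\<lambda>j\<in>{1..r}. (x(?b := u)) (block_of ?\<rho> (i, j)))) \<partial>PiM ?U (\<lambda>_. \<mu>))"
    proof (intro nn_integral_cong prod.cong refl arg_cong[where f = ?f] ext)
      fix x i j assume i: "i \<in> {1..n}"
      have "{(i, j)} \<noteq> ?b" if "j \<noteq> v" using that n by auto
      then show "((\<lambda>j\<in>?R. restrict x (K i) {(i, j)})(v := u)) j =
        (\<lambda>j\<in>{1..r}. (x(?b := u)) (block_of ?\<rho> (i, j))) j"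
        using blk[OF i, of j] v by (auto simp: K_def)
    qed
    finally show "H u ^ n = (\<integral>\<^sup>+x. (\<Prod>i\<in>{1..n}. ?f (\<lambda>j\<in>{1..r}. (x(?b := u)) (block_of ?\<rho> (i, j)))) \<partial>PiM ?U (\<lambda>_. \<mu>))" .
  qed
  also have "\<dots> = (\<integral>\<^sup>+x. (\<Prod>i\<in>{1..n}. ?f (\<lambda>j\<in>{1..r}. x (block_of ?\<rho> (i, j)))) \<partial>PiM ?\<rho> (\<lambda>_. \<mu>))"
    unfolding U(1)
  proof (rule \<mu>.product_nn_integral_insert_rev[OF U(3,2), symmetric], unfold U(1)[symmetric])
    show "(\<lambda>x. \<Prod>i\<in>{1..n}. ?f (\<lambda>j\<in>{1..r}. x (block_of ?\<rho> (i, j)))) \<in> borel_measurable (PiM ?\<rho> (\<lambda>_. \<mu>))"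
    proof (rule borel_measurable_prod_ennreal)
      fix i assume i: "i \<in> {1..n}"
      show "(\<lambda>x. ?f (\<lambda>j\<in>{1..r}. x (block_of ?\<rho> (i, j)))) \<in> borel_measurable (PiM ?\<rho> (\<lambda>_. \<mu>))"
      proof (rule measurable_compose[OF measurable_restrict measurable_copy_weight])
        fix j assume "j \<in> {1..r}"
        then have "block_of ?\<rho> (i, j) \<in> ?\<rho>" using i by (intro block_of_in(1)[OF P]) simp
        then show "(\<lambda>x. x (block_of ?\<rho> (i, j))) \<in> measurable (PiM ?\<rho> (\<lambda>_. \<mu>)) \<mu>"
          by (rule measurable_component_singleton)
      qed
    qed
  qed
  also have "\<dots> \<le> graph_weight y \<phi> \<mu> ?\<rho> (glued_edges r E {1..n} ?\<rho>)"
    by (rule graph_weight_ge[OF _ \<rho>]) simp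
  finally show "0 < graph_weight y \<phi> \<mu> ?\<rho> (glued_edges r E {1..n} ?\<rho>)" .
qed

end

section \<open>Asymptotics\<close>

lemma lesssimI: "eventually (\<lambda>t. f t / g t \<le> C) at_top \<Longrightarrow> f \<lesssim>\<^sub>\<infinity> g"
  unfolding asymp_lesssim_def
proof -
  assume "eventually (\<lambda>t. f t / g t \<le> C) at_top"
  then have "Limsup at_top (\<lambda>t. ereal (f t / g t)) \<le> ereal C" by (intro Limsup_bounded) simp
  then show "Limsup at_top (\<lambda>t. ereal (f t / g t)) < \<infinity>" by (rule order.strict_trans1) simp
qed

lemma gtrsimI: "C > 0 \<Longrightarrow> eventually (\<lambda>t. C \<le> f t / g t) at_top \<Longrightarrow> f \<greatersim>\<^sub>\<infinity> g"
  unfolding asymp_gtrsim_def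
proof -
  assume C: "C > 0" "eventually (\<lambda>t. C \<le> f t / g t) at_top"
  have "ereal C \<le> Liminf at_top (\<lambda>t. ereal (f t / g t))" using C(2) by (intro Liminf_bounded) simp
  then show "0 < Liminf at_top (\<lambda>t. ereal (f t / g t))" by (rule order.strict_trans2[rotated]) (use C in simp)
qed

lemma lesssimE:
  assumes "f \<lesssim>\<^sub>\<infinity> g" obtains C where "C > 0" "eventually (\<lambda>t. f t / g t \<le> C) at_top"
proof -
  obtain C where C: "Limsup at_top (\<lambda>t. ereal (f t / g t)) < ereal C"
    using assms ereal_dense2[of "Limsup at_top (\<lambda>t. ereal (f t / g t))" \<infinity>] unfolding asymp_lesssim_def by auto
  then have "eventually (\<lambda>t. ereal (f t / g t) < ereal C) at_top" by (rule Limsup_lessD)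
  then have "eventually (\<lambda>t. f t / g t \<le> max C 1) at_top" by eventually_elim auto
  then show thesis by (intro that[of "max C 1"]) auto
qed

lemma gtrsimE:
  assumes "f \<greatersim>\<^sub>\<infinity> g" obtains C where "C > 0" "eventually (\<lambda>t. C \<le> f t / g t) at_top"
proof -
  obtain C where C: "0 < ereal C" "ereal C < Liminf at_top (\<lambda>t. ereal (f t / g t))"
    using assms ereal_dense2[of 0 "Liminf at_top (\<lambda>t. ereal (f t / g t))"] unfolding asymp_gtrsim_def by auto
  then have "eventually (\<lambda>t. ereal C < ereal (f t / g t)) at_top" by (intro less_LiminfD)
  then have "eventually (\<lambda>t. C \<le> f t / g t) at_top" by eventually_elim auto
  then show thesis using C(1) by (intro that[of C]) auto
qed

text \<open>The hull of a finite set is compact, so its vertical slice through \<open>(p, q)\<close>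
  has a highest point. That point belongs to the upper boundary, hence to the segment, and is not
  below \<open>(p, q)\<close>.\<close>

lemma upper_boundary_segment:
  assumes fin: "finite S" and seg: "upper_boundary S = closed_segment P Q" and x: "(p, q) \<in> S"
  obtains u where "0 \<le> u" "u \<le> 1" "p = (1 - u) * fst P + u * fst Q" "q \<le> (1 - u) * snd P + u * snd Q"
proof -
  let ?H = "convex hull S \<inter> (fst -` {p})"
  have "compact (convex hull S)" using fin by (rule finite_imp_compact_convex_hull)
  moreover have "closed (fst -` {p} :: (real \<times> real) set)"
    by (intro continuous_closed_vimage) (auto intro: continuous_intros)
  ultimately have "compact ?H" by (rule compact_Int_closed)
  moreover have xH: "(p, q) \<in> ?H" using x hull_inc by fastforce
  then have "?H \<noteq> {}" by blast
  ultimately obtain z where z: "z \<in> ?H" "\<And>w. w \<in> ?H \<Longrightarrow> snd w \<le> snd z"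
    using continuous_attains_sup[of ?H snd] continuous_on_snd[OF continuous_on_id] by blast
  have zp: "z = (p, snd z)" using z(1) by (auto simp: prod_eq_iff)
  have "(p, snd z) \<in> upper_boundary S"
    unfolding upper_boundary_def using z zp by (auto simp del: Product_Type.split_paired_All)
  then obtain u where u: "0 \<le> u" "u \<le> 1" "(p, snd z) = (1 - u) *\<^sub>R P + u *\<^sub>R Q"
    unfolding seg closed_segment_def by blast
  have "p = (1 - u) * fst P + u * fst Q" "snd z = (1 - u) * snd P + u * snd Q"
    using arg_cong[OF u(3), of fst] arg_cong[OF u(3), of snd] by simp_all
  then show thesis using that[OF u(1,2)] z(2)[OF xH] by simp
qed

text \<open>The asymptotic problem without probability: \<open>p i\<close> and \<open>q i\<close>
  are the exponents of the intensity and of \<open>c\<close> in a monomial, and \<open>hull\<close>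
  puts the point \<open>(n * r - p i, n * e - q i)\<close> on or below the segment. In
  \<open>left\<close> and \<open>right\<close> a bound on \<open>q i\<close> suffices because
  \<open>c t < 1\<close>.\<close>

locale two_regimes =
  fixes I :: "'i set" and p q :: "'i \<Rightarrow> nat" and K :: "'i \<Rightarrow> real" and c :: "real \<Rightarrow> real"
    and n r e a :: nat and \<kappa> :: "real \<Rightarrow> real"
  assumes finI: "finite I" and K0: "\<And>i. i \<in> I \<Longrightarrow> 0 \<le> K i"
    and c01: "\<And>t. t > 0 \<Longrightarrow> 0 < c t \<and> c t < 1"
    and n1: "n \<ge> 1" and r1: "r \<ge> 2" and ae: "a < e"
    and \<kappa>: "\<And>t. t > 0 \<Longrightarrow> \<kappa> t = (\<Sum>i\<in>I. t ^ p i * c t ^ q i * K i)"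
    and hull: "\<And>i. i \<in> I \<Longrightarrow> \<exists>u. 0 \<le> u \<and> u \<le> 1 \<and>
      real (n * r) - real (p i) = (1 - u) * real (n - 1) + u * real ((n - 1) * r) \<and>
      real (n * e) - real (q i) \<le> (1 - u) * real ((n - 1) * a) + u * real ((n - 1) * e)"
    and left: "\<exists>i\<in>I. p i = 1 + (r - 1) * n \<and> q i \<le> n * (e - a) + a \<and> K i > 0"
    and right: "\<exists>i\<in>I. p i = r \<and> q i \<le> e \<and> K i > 0"
begin

text \<open>With \<open>s\<close> the slope of the segment, a partition at horizontal distance \<open>z\<close> from its left end
  contributes at most \<open>w powr (- z)\<close> times the term of that end, and the threshold is where \<open>w\<close> has
  order 1.\<close>

definition s :: real where "s = (real e - real a) / real (r - 1)"
definition w :: "real \<Rightarrow> real" where "w t = t * c t powr s"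
definition Z :: real where "Z = real (n - 1) * real (r - 1)"

abbreviation "gleft t \<equiv> t ^ (1 + (r - 1) * n) * c t powr (real (n * e) - real ((n - 1) * a))"
abbreviation "gright t \<equiv> t ^ r * c t ^ e"

lemma s_pos: "s > 0" using ae r1 by (simp add: s_def)

lemma w_pos: "t > 0 \<Longrightarrow> w t > 0" using c01[of t] by (simp add: w_def)

lemma g_pos: "t > 0 \<Longrightarrow> gleft t > 0" "t > 0 \<Longrightarrow> gright t > 0"
  using c01[of t] by simp_all

text \<open>\<open>Z\<close> is the horizontal length of the segment, so passing from its left to
  its right end multiplies the term by \<open>w t powr (- Z)\<close>.\<close>

lemma gright_eq: "t > 0 \<Longrightarrow> gright t = gleft t * w t powr (- Z)"
proof -
  assume t: "t > 0"
  have ct: "c t > 0" using c01[OF t] by simp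
  have sr: "s * real (r - 1) = real e - real a" using r1 by (simp add: s_def)
  have "gleft t * w t powr (- Z) = t powr real (1 + (r - 1) * n) * c t powr (real (n * e) - real ((n - 1) * a)) *
    (t powr (- Z) * c t powr (s * (- Z)))"
    using t ct by (simp add: w_def powr_mult powr_powr powr_realpow del: of_nat_add of_nat_mult of_nat_Suc)
  also have "\<dots> = t powr (real (1 + (r - 1) * n) - Z) * c t powr (real (n * e) - real ((n - 1) * a) - s * Z)"
    by (simp add: powr_add[symmetric] mult_ac powr_diff powr_minus divide_simps)
  also have "real (1 + (r - 1) * n) - Z = real r"
    using n1 r1 by (simp add: Z_def of_nat_diff algebra_simps)
  also have "real (n * e) - real ((n - 1) * a) - s * Z = real e"
  proof -
    have "s * Z = real (n - 1) * (s * real (r - 1))" by (simp add: Z_def)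
    also have "\<dots> = real (n - 1) * (real e - real a)" by (simp only: sr)
    finally show ?thesis using n1 by (simp add: of_nat_diff algebra_simps)
  qed
  finally show ?thesis using t ct by (simp add: powr_realpow)
qed

text \<open>For \<open>z = u * Z\<close> the exponent of \<open>t\<close> is exactly that of the
  point of the segment at distance \<open>z\<close>, and the exponent of \<open>c\<close> is at
  least that of this point. Since \<open>c t < 1\<close>, the monomial is at most the term belonging
  to the point of the segment.\<close>

lemma term_bound:
  assumes i: "i \<in> I"
  obtains z where "0 \<le> z" "z \<le> Z" "\<And>t. t > 0 \<Longrightarrow> t ^ p i * c t ^ q i \<le> gleft t * w t powr (- z)"
proof -
  obtain u where u: "0 \<le> u" "u \<le> 1"
    "real (n * r) - real (p i) = (1 - u) * real (n - 1) + u * real ((n - 1) * r)"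
    "real (n * e) - real (q i) \<le> (1 - u) * real ((n - 1) * a) + u * real ((n - 1) * e)"
    using hull[OF i] by blast
  let ?z = "u * Z"
  have sr: "s * real (r - 1) = real e - real a" using r1 by (simp add: s_def)
  have Z0: "0 \<le> Z" by (simp add: Z_def)
  have p: "real (p i) = real (1 + (r - 1) * n) - ?z"
    using u(3) n1 r1 by (simp add: Z_def of_nat_diff algebra_simps)
  have "s * ?z = u * real (n - 1) * (s * real (r - 1))" by (simp add: Z_def)
  then have sz: "s * ?z = u * real (n - 1) * (real e - real a)" by (simp only: sr)
  have q: "real (n * e) - real ((n - 1) * a) - s * ?z \<le> real (q i)"
    using u(4) unfolding sz of_nat_mult by (simp add: algebra_simps del: of_nat_diff)
  show thesis
  proof (rule that[of ?z])
    show "0 \<le> ?z" using u Z0 by simp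
    show "?z \<le> Z" using u Z0 mult_right_mono[of u 1 Z] by simp
    fix t :: real assume t: "t > 0"
    have ct: "0 < c t" "c t < 1" using c01[OF t] by auto
    have "t ^ p i * c t ^ q i = t powr real (p i) * c t powr real (q i)"
      using t ct by (simp add: powr_realpow)
    also have "\<dots> \<le> t powr real (p i) * c t powr (real (n * e) - real ((n - 1) * a) - s * ?z)"
      using q ct by (intro mult_left_mono powr_mono') auto
    also have "\<dots> = t powr (real (1 + (r - 1) * n) - ?z) * c t powr (real (n * e) - real ((n - 1) * a) - s * ?z)"
      by (simp only: p)
    also have "\<dots> = t powr real (1 + (r - 1) * n) * t powr (- ?z) *
        (c t powr (real (n * e) - real ((n - 1) * a)) * c t powr (- (s * ?z)))"
      unfolding powr_add[symmetric] by simp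
    also have "\<dots> = t powr real (1 + (r - 1) * n) * c t powr (real (n * e) - real ((n - 1) * a)) *
        (t powr (- ?z) * c t powr (- (s * ?z)))" by (simp only: mult_ac)
    also have "t powr (- ?z) * c t powr (- (s * ?z)) = w t powr (- ?z)"
      using t ct by (simp add: w_def powr_mult powr_powr)
    also have "t powr real (1 + (r - 1) * n) = t ^ (1 + (r - 1) * n)"
      using t by (rule powr_realpow)
    finally show "t ^ p i * c t ^ q i \<le> gleft t * w t powr (- ?z)" .
  qed
qed

text \<open>No term of the sum is negative, so each one is a lower bound, and \<open>c t < 1\<close>
  allows its exponent to be raised to \<open>k\<close>.\<close>

lemma lower_bound:
  assumes i: "i \<in> I" "q i \<le> k" "K i > 0"
  shows "\<exists>C>0. \<forall>t>0. C \<le> \<kappa> t / (t ^ p i * c t ^ k)"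
proof -
  have "K i \<le> \<kappa> t / (t ^ p i * c t ^ k)" if t: "t > 0" for t
  proof -
    have ct: "0 < c t" "c t < 1" using c01[OF t] by auto
    have "t ^ p i * c t ^ k * K i \<le> t ^ p i * c t ^ q i * K i"
      using t ct i(2,3) by (intro mult_right_mono mult_left_mono power_decreasing) auto
    also have "\<dots> \<le> \<kappa> t"
      unfolding \<kappa>[OF t] using t ct K0
      by (intro member_le_sum[OF i(1), of "\<lambda>i. t ^ p i * c t ^ q i * K i"] finI) auto
    finally show ?thesis using t ct by (simp add: pos_le_divide_eq mult.commute)
  qed
  then show ?thesis using i(3) by blast
qed

lemma lower_left: "\<exists>C>0. \<forall>t>0. C \<le> \<kappa> t / gleft t"
proof -
  obtain i where i: "i \<in> I" "p i = 1 + (r - 1) * n" "q i \<le> n * (e - a) + a" "K i > 0" using left by blast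
  \<comment> \<open>The real exponent in \<open>gleft\<close> is a natural number, so
    \<open>lower_bound\<close> with its natural powers applies.\<close>
  have "real (n * e) - real ((n - 1) * a) = real (n * (e - a) + a)"
  proof -
    have "real (e - a) = real e - real a" "real (n - 1) = real n - 1" using ae n1 by auto
    then show ?thesis unfolding of_nat_add of_nat_mult by (simp only:) (simp add: algebra_simps)
  qed
  then have "gleft t = t ^ p i * c t ^ (n * (e - a) + a)" if "t > 0" for t
    unfolding i(2) using c01[OF that] by (simp only: powr_realpow)
  then show ?thesis using lower_bound[OF i(1,3,4)] by simp
qed

lemma lower_right: "\<exists>C>0. \<forall>t>0. C \<le> \<kappa> t / gright t"
  using right lower_bound by metis

text \<open>The constants may differ from term to term: the index set is finite, and the sum of all
  \<open>C i * K i\<close> serves for \<kappa>.\<close>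

lemma upper_bound:
  assumes terms: "\<And>i. i \<in> I \<Longrightarrow> \<exists>C. \<forall>t>0. Q t \<longrightarrow> t ^ p i * c t ^ q i \<le> g t * C"
    and g: "\<And>t. t > 0 \<Longrightarrow> g t > 0"
  shows "\<exists>C. \<forall>t>0. Q t \<longrightarrow> \<kappa> t / g t \<le> C"
proof -
  obtain C where C: "\<And>i t. i \<in> I \<Longrightarrow> t > 0 \<Longrightarrow> Q t \<Longrightarrow> t ^ p i * c t ^ q i \<le> g t * C i"
    using terms by metis
  have "\<kappa> t / g t \<le> (\<Sum>i\<in>I. C i * K i)" if t: "t > 0" "Q t" for t
  proof -
    have "\<kappa> t \<le> (\<Sum>i\<in>I. g t * C i * K i)"
      unfolding \<kappa>[OF t(1)] by (intro sum_mono mult_right_mono C t K0)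
    also have "\<dots> = (\<Sum>i\<in>I. C i * K i) * g t" by (subst sum_distrib_right) (simp only: mult_ac)
    finally show ?thesis using g[OF t(1)] by (simp only: pos_divide_le_eq)
  qed
  then show ?thesis by blast
qed

lemma upper_left:
  assumes "\<delta> > 0" shows "\<exists>C. \<forall>t>0. \<delta> \<le> w t \<longrightarrow> \<kappa> t / gleft t \<le> C"
proof (rule upper_bound)
  fix i assume "i \<in> I"
  then obtain z where z: "0 \<le> z" "z \<le> Z" "\<And>t. t > 0 \<Longrightarrow> t ^ p i * c t ^ q i \<le> gleft t * w t powr (- z)"
    using term_bound by blast
  have "t ^ p i * c t ^ q i \<le> gleft t * \<delta> powr (- z)" if t: "t > 0" "\<delta> \<le> w t" for t
  proof -
    have "t ^ p i * c t ^ q i \<le> gleft t * w t powr (- z)" by (rule z(3)[OF t(1)])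
    also have "\<dots> \<le> gleft t * \<delta> powr (- z)"
      using t assms z(1) g_pos(1)[OF t(1)] by (intro mult_left_mono powr_mono2') auto
    finally show ?thesis .
  qed
  then show "\<exists>C. \<forall>t>0. \<delta> \<le> w t \<longrightarrow> t ^ p i * c t ^ q i \<le> gleft t * C" by blast
qed (rule g_pos(1))

text \<open>Measured from the right end the excess is \<open>w t powr (Z - z)\<close> with a
  nonnegative exponent, so it stays bounded when \<open>w\<close> does. In \<open>upper_left\<close>
  the exponent is \<open>- z\<close>, and \<open>w\<close> has to stay away from 0.\<close>

lemma upper_right:
  assumes "W > 0" shows "\<exists>C. \<forall>t>0. w t \<le> W \<longrightarrow> \<kappa> t / gright t \<le> C"
proof (rule upper_bound)
  fix i assume "i \<in> I"
  then obtain z where z: "0 \<le> z" "z \<le> Z" "\<And>t. t > 0 \<Longrightarrow> t ^ p i * c t ^ q i \<le> gleft t * w t powr (- z)"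
    using term_bound by blast
  have "t ^ p i * c t ^ q i \<le> gright t * W powr (Z - z)" if t: "t > 0" "w t \<le> W" for t
  proof -
    have "t ^ p i * c t ^ q i \<le> gleft t * w t powr (- z)" by (rule z(3)[OF t(1)])
    also have "w t powr (- z) = w t powr (- Z) * w t powr (Z - z)"
      by (simp add: powr_add[symmetric])
    also have "gleft t * (w t powr (- Z) * w t powr (Z - z)) = gright t * w t powr (Z - z)"
      unfolding gright_eq[OF t(1)] by (simp only: mult.assoc)
    also have "\<dots> \<le> gright t * W powr (Z - z)"
      using t z(2) g_pos(2)[OF t(1)] w_pos[OF t(1)] by (intro mult_left_mono powr_mono2) auto
    finally show ?thesis .
  qed
  then show "\<exists>C. \<forall>t>0. w t \<le> W \<longrightarrow> t ^ p i * c t ^ q i \<le> gright t * C" by blast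
qed (rule g_pos(2))

definition threshold :: "real \<Rightarrow> real" where
  "threshold t = t powr (- (real (r - 1) / (real e - real a)))"

text \<open>The threshold is \<open>t powr (- 1 / s)\<close>, so \<open>w\<close> is the power
  \<open>s\<close> of the ratio of \<open>c\<close> to it. Bounds on that ratio thus become bounds
  on \<open>w\<close>.\<close>

lemma w_eq: "t > 0 \<Longrightarrow> w t = (c t / threshold t) powr s"
proof -
  assume t: "t > 0"
  have ct: "c t > 0" using c01[OF t] by simp
  let ?x = "real (r - 1) / (real e - real a)"
  have xs: "?x * s = 1" using r1 ae by (simp add: s_def)
  have "(c t / threshold t) powr s = (c t * t powr ?x) powr s"
    by (simp add: threshold_def powr_minus divide_inverse)
  also have "\<dots> = c t powr s * t powr (?x * s)"
    using t ct by (simp only: powr_mult powr_powr)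
  also have "\<dots> = w t" unfolding xs using t by (simp add: w_def)
  finally show ?thesis by simp
qed

text \<open>By \<open>s * (r - 1) = e - a\<close> the term \<open>t * c t ^ a\<close> differs from
  the right end only by a power of \<open>w\<close>, which is of order 1 at the threshold.\<close>

lemma ratio_eq: "t > 0 \<Longrightarrow> t * c t ^ a * w t powr real (r - 1) = gright t"
proof -
  assume t: "t > 0"
  have ct: "c t > 0" using c01[OF t] by simp
  have sr: "s * real (r - 1) = real (e - a)" using r1 ae by (simp add: s_def of_nat_diff)
  have "w t powr real (r - 1) = t ^ (r - 1) * c t ^ (e - a)"
    using t ct unfolding w_def by (simp only: powr_mult powr_powr sr powr_realpow)
  moreover have "t * t ^ (r - 1) = t ^ r" using r1 by (cases r) auto
  moreover have "c t ^ a * c t ^ (e - a) = c t ^ e" using ae by (simp add: power_add[symmetric])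
  ultimately show ?thesis by (metis (no_types, lifting) mult.assoc mult.left_commute)
qed

lemma w_lower:
  assumes "c \<greatersim>\<^sub>\<infinity> threshold" obtains \<delta> where "\<delta> > 0" "eventually (\<lambda>t. t > 0 \<and> \<delta> \<le> w t) at_top"
proof -
  obtain C where C: "C > 0" "eventually (\<lambda>t. C \<le> c t / threshold t) at_top" using assms by (rule gtrsimE)
  have "eventually (\<lambda>t. t > 0 \<and> C powr s \<le> w t) at_top"
    using C(2) eventually_gt_at_top[of 0]
    by eventually_elim (use C(1) s_pos in \<open>auto simp: w_eq intro!: powr_mono2\<close>)
  then show thesis using that[of "C powr s"] C(1) by simp
qed

lemma w_upper:
  assumes "c \<lesssim>\<^sub>\<infinity> threshold" obtains W where "W > 0" "eventually (\<lambda>t. t > 0 \<and> w t \<le> W) at_top"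
proof -
  obtain C where C: "C > 0" "eventually (\<lambda>t. c t / threshold t \<le> C) at_top" using assms by (rule lesssimE)
  have "eventually (\<lambda>t. t > 0 \<and> w t \<le> C powr s) at_top"
    using C(2) eventually_gt_at_top[of 0]
  proof eventually_elim
    case (elim t)
    have "0 \<le> c t / threshold t" using c01[OF elim(2)] by (simp add: threshold_def)
    then show ?case using elim s_pos by (auto simp: w_eq intro!: powr_mono2)
  qed
  then show thesis using that[of "C powr s"] C(1) by simp
qed

theorem regime_left:
  assumes "c \<greatersim>\<^sub>\<infinity> threshold" shows "\<kappa> \<asymp>\<^sub>\<infinity> (\<lambda>t. gleft t)"
  unfolding asymp_same_order_def
proof
  obtain \<delta> where \<delta>: "\<delta> > 0" "eventually (\<lambda>t. t > 0 \<and> \<delta> \<le> w t) at_top" using w_lower[OF assms] .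
  obtain C where C: "\<forall>t>0. \<delta> \<le> w t \<longrightarrow> \<kappa> t / gleft t \<le> C" using upper_left[OF \<delta>(1)] by blast
  show "\<kappa> \<lesssim>\<^sub>\<infinity> (\<lambda>t. gleft t)"
    by (rule lesssimI[of _ _ C]) (use \<delta>(2) C in \<open>auto elim: eventually_mono\<close>)
  obtain B where B: "B > 0" "\<forall>t>0. B \<le> \<kappa> t / gleft t" using lower_left by blast
  show "\<kappa> \<greatersim>\<^sub>\<infinity> (\<lambda>t. gleft t)"
    by (rule gtrsimI[OF B(1)], rule eventually_mono[OF eventually_gt_at_top[of 0]]) (use B(2) in blast)
qed

theorem regime_right:
  assumes "c \<lesssim>\<^sub>\<infinity> threshold" shows "\<kappa> \<asymp>\<^sub>\<infinity> (\<lambda>t. gright t)"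
  unfolding asymp_same_order_def
proof
  obtain W where W: "W > 0" "eventually (\<lambda>t. t > 0 \<and> w t \<le> W) at_top" using w_upper[OF assms] .
  obtain C where C: "\<forall>t>0. w t \<le> W \<longrightarrow> \<kappa> t / gright t \<le> C" using upper_right[OF W(1)] by blast
  show "\<kappa> \<lesssim>\<^sub>\<infinity> (\<lambda>t. gright t)"
    by (rule lesssimI[of _ _ C]) (use W(2) C in \<open>auto elim: eventually_mono\<close>)
  obtain B where B: "B > 0" "\<forall>t>0. B \<le> \<kappa> t / gright t" using lower_right by blast
  show "\<kappa> \<greatersim>\<^sub>\<infinity> (\<lambda>t. gright t)"
    by (rule gtrsimI[OF B(1)], rule eventually_mono[OF eventually_gt_at_top[of 0]]) (use B(2) in blast)
qed

theorem regime_threshold: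
  assumes "c \<asymp>\<^sub>\<infinity> threshold" shows "\<kappa> \<asymp>\<^sub>\<infinity> (\<lambda>t. t * c t ^ a)"
proof -
  have th: "c \<lesssim>\<^sub>\<infinity> threshold" "c \<greatersim>\<^sub>\<infinity> threshold" using assms by (auto simp: asymp_same_order_def)
  obtain W where W: "W > 0" "eventually (\<lambda>t. t > 0 \<and> w t \<le> W) at_top" using w_upper[OF th(1)] .
  obtain \<delta> where \<delta>: "\<delta> > 0" "eventually (\<lambda>t. t > 0 \<and> \<delta> \<le> w t) at_top" using w_lower[OF th(2)] .
  obtain C where C: "\<forall>t>0. w t \<le> W \<longrightarrow> \<kappa> t / gright t \<le> C" using upper_right[OF W(1)] by blast
  obtain B where B: "B > 0" "\<forall>t>0. B \<le> \<kappa> t / gright t" using lower_right by blast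
  let ?k = "real (r - 1)"
  have ratio: "\<kappa> t / (t * c t ^ a) = \<kappa> t / gright t * w t powr ?k" if t: "t > 0" for t
    unfolding ratio_eq[OF t, symmetric] using w_pos[OF t] by simp
  have up: "eventually (\<lambda>t. \<kappa> t / (t * c t ^ a) \<le> C * W powr ?k) at_top"
    using W(2)
  proof eventually_elim
    case (elim t)
    have "0 \<le> \<kappa> t / gright t" using B elim by (meson less_imp_le order_trans)
    then show ?case
      unfolding ratio[OF conjunct1[OF elim]]
      using C elim w_pos[of t] by (intro mult_mono powr_mono2) auto
  qed
  have low: "eventually (\<lambda>t. B * \<delta> powr ?k \<le> \<kappa> t / (t * c t ^ a)) at_top"
    using \<delta>(2)
  proof eventually_elim
    case (elim t)
    have "0 \<le> \<kappa> t / gright t" using B elim by (meson less_imp_le order_trans)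
    then show ?case
      unfolding ratio[OF conjunct1[OF elim]]
      using B elim \<delta>(1) by (intro mult_mono powr_mono2) auto
  qed
  show ?thesis
    unfolding asymp_same_order_def
    using lesssimI[OF up] gtrsimI[OF _ low] B(1) \<delta>(1) by simp
qed

end

section \<open>From the model to the comparison of monomials\<close>

theorem proposition7p1:
  fixes r m n :: nat
    and E :: "nat set set"
    and \<mu> :: "(real ^ 'd) measure"
    and \<phi> :: "real ^ 'd \<Rightarrow> real ^ 'd \<Rightarrow> real"
    and y :: "nat \<Rightarrow> real ^ 'd"
    and c :: "real \<Rightarrow> real"
    and M :: "real \<Rightarrow> 'w measure"
    and \<tau> :: "real \<Rightarrow> 'w \<Rightarrow> enat"
    and X :: "real \<Rightarrow> nat \<Rightarrow> 'w \<Rightarrow> real ^ 'd"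
    and F :: "real \<Rightarrow> 'w \<Rightarrow> node set set"
  assumes r: "r \<ge> 2"
    and graph: "simple_graph {1..r+m} E"
    and connected_G: "connected_graph {1..r+m} E"
    and connected_induced: "connected_graph {1..r} (induced_edges {1..r} E)"
    and endpoints_nonadjacent: "\<forall>i\<in>{r+1..r+m}. \<forall>j\<in>{r+1..r+m}. {i, j} \<notin> E"
    and y_distinct: "inj_on y {1..m}"
    and sets_mu: "sets \<mu> = sets borel"
    and diffuse_mu: "diffuse \<mu>"
    and phi_range: "\<forall>u v. 0 \<le> \<phi> u v \<and> \<phi> u v \<le> 1"
    and phi_sym: "\<forall>u v. \<phi> u v = \<phi> v u"
    and phi_measurable: "(\<lambda>(u, v). \<phi> u v) \<in> borel_measurable (borel \<Otimes>\<^sub>M borel)"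
    and no_endpoints: "m = 0 \<Longrightarrow> finite_measure \<mu>"
    and with_endpoints:
      "m \<ge> 1 \<Longrightarrow> sigma_finite_measure \<mu> \<and> (SUP u. \<integral>\<^sup>+ v. ennreal (\<phi> u v) \<partial>\<mu>) < \<infinity>"
    and nondegenerate: "subgraph_integral \<mu> \<phi> r m E y > 0"
    and c: "\<forall>t>0. 0 < c t \<and> c t < 1"
    and model: "\<forall>t>0. random_connection_model (M t) (scale_measure (ennreal t) \<mu>)
                        (\<lambda>u v. c t * \<phi> u v) m y (\<tau> t) (X t) (F t)"
    and n: "n \<ge> 2"
    and boundary: "upper_boundary (Sigma_set n r m E) =
      closed_segment (real (n - 1), real ((n - 1) * max_endpoint_degree r m E))
                     (real ((n - 1) * r), real ((n - 1) * card E))"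
  shows "let a = max_endpoint_degree r m E;
             \<kappa> = (\<lambda>t. cumulant (M t) (subgraph_count r m E (\<tau> t) (F t)) n);
             threshold = (\<lambda>t. t powr (- (real (r - 1) / (real (card E) - real a))))
         in ((\<lambda>_. 1) \<greatersim>\<^sub>\<infinity> c \<and> c \<greatersim>\<^sub>\<infinity> threshold \<longrightarrow>
               \<kappa> \<asymp>\<^sub>\<infinity> (\<lambda>t. t ^ (1 + (r - 1) * n) *
                            c t powr (real (n * card E) - real ((n - 1) * a)))) \<and>
            (c \<asymp>\<^sub>\<infinity> threshold \<longrightarrow> \<kappa> \<asymp>\<^sub>\<infinity> (\<lambda>t. t * c t ^ a)) \<and>
            (c \<lesssim>\<^sub>\<infinity> threshold \<longrightarrow> \<kappa> \<asymp>\<^sub>\<infinity> (\<lambda>t. t ^ r * c t ^ card E))"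
proof -
  have sigma_finite: "sigma_finite_measure \<mu>"
  proof (cases "m = 0")
    case True
    then show ?thesis using no_endpoints finite_measure.axioms(1) by blast
  qed (use with_endpoints in simp)
  interpret G: weighted_graph r m E \<phi> \<mu> y
    by (intro weighted_graph.intro endpoint_graph.intro weighted_graph_axioms.intro r graph connected_induced
      endpoints_nonadjacent phi_range[rule_format, THEN conjunct1] phi_range[rule_format, THEN conjunct2]
      phi_sym[rule_format] phi_measurable sets_mu sigma_finite)
  define a where "a = max_endpoint_degree r m E"
  define \<kappa> where "\<kappa> t = cumulant (M t) (subgraph_count r m E (\<tau> t) (F t)) n" for t
  define D where "D \<rho> = glued_edges r E {1..n} \<rho>" for \<rho>
  define K where "K \<rho> = enn2real (graph_weight y \<phi> \<mu> \<rho> (D \<rho>))" for \<rho>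
  have n1: "n \<ge> 1" using n by simp
  have NF: "\<rho> \<in> NF r {1..n}" if "\<rho> \<in> CNF n r" for \<rho> using that by (simp add: CNF_eq)
  have finCNF: "finite (CNF n r)" by (simp add: CNF_eq finite_NF)
  \<comment> \<open>Without endpoints finiteness comes from the finite total mass, with endpoints
    from the uniform bound on the integrals of \<phi>.\<close>
  have fin: "graph_weight y \<phi> \<mu> \<rho> (glued_edges r E B \<rho>) < \<infinity>" if B: "finite B" "\<rho> \<in> NF r B" for B \<rho>
  proof (cases "m = 0")
    case True
    then show ?thesis using G.graph_weight_finite_measure[OF no_endpoints B] by simp
  next
    case False
    then show ?thesis using G.graph_weight_finite_endpoints[OF connected_G _ _ B] with_endpoints by simp
  qed
  \<comment> \<open>The probability spaces for different \<open>t\<close> are unrelated, so the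
    formula is derived for each \<open>t\<close> separately; the coefficients
    \<open>K \<rho>\<close> are nevertheless common to all.\<close>
  have \<kappa>_eq: "\<kappa> t = (\<Sum>\<rho>\<in>CNF n r. t ^ card \<rho> * c t ^ card (D \<rho>) * K \<rho>)" if t: "t > 0" for t
  proof -
    have ct: "0 < c t" "c t < 1" using c t by auto
    interpret R: rcm "M t" "\<tau> t" "X t" "scale_measure (ennreal t) \<mu>" r m E "\<lambda>u v. c t * \<phi> u v" y "F t"
    proof -
      have mod: "random_connection_model (M t) (scale_measure (ennreal t) \<mu>)
                        (\<lambda>u v. c t * \<phi> u v) m y (\<tau> t) (X t) (F t)" using model t by blast
      have pts: "poisson_points (M t) (\<tau> t) (X t) (scale_measure (ennreal t) \<mu>)"
      proof (intro poisson_points.intro poisson_points_axioms.intro)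
        show "sets (scale_measure (ennreal t) \<mu>) = sets borel" by (simp add: sets_mu)
        show "sigma_finite_measure (scale_measure (ennreal t) \<mu>)"
          by (rule sigma_finite_scale_measure[OF sigma_finite]) simp
      qed (use mod in \<open>simp_all add: random_connection_model_def\<close>)
      have meas: "(\<lambda>(u, v). c t * \<phi> u v) \<in> borel_measurable (borel \<Otimes>\<^sub>M borel)"
        using borel_measurable_times[OF borel_measurable_const phi_measurable, of "c t"]
        by (simp add: case_prod_unfold)
      have "0 \<le> c t * \<phi> u v" "c t * \<phi> u v \<le> 1" for u v
        using ct phi_range by (auto intro!: mult_le_one)
      moreover have "c t * \<phi> u v = c t * \<phi> v u" for u v
        using phi_sym by simp
      moreover have "random_connection_graph (M t) (\<lambda>u v. c t * \<phi> u v) m y (\<tau> t) (X t) (F t)"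
        using mod by (simp add: random_connection_model_def)
      ultimately show "rcm (M t) (\<tau> t) (X t) (scale_measure (ennreal t) \<mu>) r m E (\<lambda>u v. c t * \<phi> u v) y (F t)"
        by (intro rcm.intro rcm_axioms.intro pts G.endpoint_graph_axioms meas)
    qed
    have scale: "graph_weight y (\<lambda>u v. c t * \<phi> u v) (scale_measure (ennreal t) \<mu>) \<rho> (glued_edges r E B \<rho>) =
      ennreal (t ^ card \<rho> * c t ^ card (glued_edges r E B \<rho>)) * graph_weight y \<phi> \<mu> \<rho> (glued_edges r E B \<rho>)"
      if "finite B" "\<rho> \<in> NF r B" for B \<rho>
      using that t ct by (intro G.graph_weight_scale) auto
    have "\<kappa> t = (\<Sum>\<rho>\<in>CNF n r. enn2real (graph_weight y (\<lambda>u v. c t * \<phi> u v) (scale_measure (ennreal t) \<mu>) \<rho> (glued_edges r E {1..n} \<rho>)))"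
      unfolding \<kappa>_def
    proof (rule R.cumulant_eq_sum_CNF[OF n1])
      fix B \<rho> assume B: "B \<subseteq> {1..n}" "\<rho> \<in> NF r B"
      have "finite B" using B(1) by (rule finite_subset) simp
      then show "graph_weight y (\<lambda>u v. c t * \<phi> u v) (scale_measure (ennreal t) \<mu>) \<rho> (glued_edges r E B \<rho>) < \<infinity>"
        using fin[OF _ B(2)] scale[OF _ B(2)] by (simp add: ennreal_mult_less_top)
    qed
    also have "\<dots> = (\<Sum>\<rho>\<in>CNF n r. t ^ card \<rho> * c t ^ card (D \<rho>) * K \<rho>)"
    proof (rule sum.cong[OF refl])
      fix \<rho> assume "\<rho> \<in> CNF n r"
      then have "\<rho> \<in> NF r {1..n}" by (rule NF)
      from scale[OF _ this] show "enn2real (graph_weight y (\<lambda>u v. c t * \<phi> u v) (scale_measure (ennreal t) \<mu>) \<rho> (glued_edges r E {1..n} \<rho>)) =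
        t ^ card \<rho> * c t ^ card (D \<rho>) * K \<rho>"
        using t ct by (simp add: enn2real_mult K_def D_def)
    qed
    finally show ?thesis .
  qed
  obtain v where v: "v \<in> {1..r}" "card {j \<in> {r+1..r+m}. {v, j} \<in> E} = a"
  proof -
    have "a \<in> (\<lambda>i. card {j \<in> {r+1..r+m}. {i, j} \<in> E}) ` {1..r}"
      unfolding a_def max_endpoint_degree_def using r by (intro Max_in) auto
    then show thesis using that by auto
  qed
  \<comment> \<open>The edges from \<open>v\<close> to endpoints do not include those inside
    \<open>{1..r}\<close>, of which there is at least one. This makes the slope of the segment
    positive.\<close>
  have a_less: "a < card E"
  proof -
    let ?J = "{j \<in> {r+1..r+m}. {v, j} \<in> E}"
    have "1 \<noteq> (2::nat)" "1 \<in> {1..r}" "2 \<in> {1..r}" using r by auto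
    then have "(1, 2) \<in> {(x, y). {x, y} \<in> induced_edges {1..r} E}\<^sup>*"
      using connected_induced unfolding connected_graph_def by blast
    then obtain z where z: "{1, z} \<in> induced_edges {1..r} E"
      by (cases rule: converse_rtranclE) auto
    have "(\<lambda>j. {v, j}) ` ?J \<subset> E"
    proof (rule psubsetI)
      show "(\<lambda>j. {v, j}) ` ?J \<noteq> E"
      proof
        assume eq: "(\<lambda>j. {v, j}) ` ?J = E"
        have "{1, z} \<in> E" using z by (simp add: induced_edges_def)
        then have "{1, z} \<in> (\<lambda>j. {v, j}) ` ?J" by (simp only: eq)
        then obtain j where j: "{1, z} = {v, j}" "j \<in> ?J" by (rule imageE)
        have "{1, z} \<subseteq> {1..r}" using z by (simp only: induced_edges_def mem_Collect_eq)
        then have "j \<in> {1..r}" unfolding j(1) by simp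
        then show False using j(2) by simp
      qed
    qed auto
    then have "card ((\<lambda>j. {v, j}) ` ?J) < card E" by (rule psubset_card_mono[OF G.finite_E])
    moreover have "card ((\<lambda>j. {v, j}) ` ?J) = card ?J"
      using v(1) by (intro card_image) (auto simp: inj_on_def doubleton_eq_iff)
    ultimately show ?thesis using v(2) by simp
  qed
  interpret T: two_regimes "CNF n r" card "\<lambda>\<rho>. card (D \<rho>)" K c n r "card E" a \<kappa>
  proof
    show "\<kappa> t = (\<Sum>\<rho>\<in>CNF n r. t ^ card \<rho> * c t ^ card (D \<rho>) * K \<rho>)" if "t > 0" for t by (rule \<kappa>_eq[OF that])
    show "0 \<le> K \<rho>" for \<rho> by (simp add: K_def)
    show "\<exists>\<rho>\<in>CNF n r. card \<rho> = 1 + (r - 1) * n \<and> card (D \<rho>) \<le> n * (card E - a) + a \<and> K \<rho> > 0"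
      using G.star_CNF[OF n1 v(1)] G.card_star[OF n1 v(1)] G.card_glued_star[OF n1 v(1), unfolded v(2)]
        G.graph_weight_star[OF n1 v(1) nondegenerate] fin[OF _ G.star_NF[OF n1 v(1)]]
      by (intro bexI[of _ "G.star n v"]) (auto simp: D_def K_def enn2real_positive_iff)
    show "\<exists>\<rho>\<in>CNF n r. card \<rho> = r \<and> card (D \<rho>) \<le> card E \<and> K \<rho> > 0"
      using G.columns_CNF[OF n1] G.card_columns[OF n1] G.card_glued_columns[OF n1]
        G.graph_weight_columns[OF n1 nondegenerate] fin[OF _ G.columns_NF[OF n1]]
      by (intro bexI[of _ "G.columns n"]) (auto simp: D_def K_def enn2real_positive_iff)
    fix \<rho> assume \<rho>: "\<rho> \<in> CNF n r"
    have fin\<rho>: "finite \<rho>"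
      using NF[OF \<rho>] finite_elements[of "{1..n} \<times> {1..r}" \<rho>] by (simp add: NF_def)
    have verts: "card (partition_graph_verts m \<rho>) = card \<rho> + m"
      unfolding partition_graph_verts_def using fin\<rho>
      by (subst card_Un_disjoint) (auto simp: card_image)
    have "(real (n * r + m) - real (card (partition_graph_verts m \<rho>)),
           real (n * card E) - real (card (partition_graph_edges n r m E \<rho>))) \<in> Sigma_set n r m E"
      unfolding Sigma_set_def using \<rho> by (rule imageI)
    \<comment> \<open>The \<open>m\<close> terminal nodes cancel in the first coordinate.\<close>
    then have "(real (n * r) - real (card \<rho>), real (n * card E) - real (card (D \<rho>))) \<in> Sigma_set n r m E"
      by (simp add: verts G.partition_graph_edges_eq[OF NF[OF \<rho>]] D_def)
    moreover have "finite (Sigma_set n r m E)" unfolding Sigma_set_def using finCNF by simp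
    ultimately show "\<exists>u. 0 \<le> u \<and> u \<le> 1 \<and>
      real (n * r) - real (card \<rho>) = (1 - u) * real (n - 1) + u * real ((n - 1) * r) \<and>
      real (n * card E) - real (card (D \<rho>)) \<le> (1 - u) * real ((n - 1) * a) + u * real ((n - 1) * card E)"
      using upper_boundary_segment[OF _ boundary] unfolding a_def by (metis fst_conv snd_conv)
  qed (use finCNF c n1 r a_less in auto)
  have \<kappa>: "(\<lambda>t. cumulant (M t) (subgraph_count r m E (\<tau> t) (F t)) n) = \<kappa>" by (simp add: \<kappa>_def fun_eq_iff)
  have th: "(\<lambda>t. t powr (- (real (r - 1) / (real (card E) - real a)))) = T.threshold"
    by (simp add: T.threshold_def fun_eq_iff)
  show ?thesis
    unfolding Let_def a_def[symmetric] \<kappa> th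
    using T.regime_left T.regime_threshold T.regime_right by blast
qed

end
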